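(* Let $\Omega\subset\mathbb R^n$ ($n\ge2$) be a bounded smooth domain, $0<\theta<n\pi/2$, and let $P,K_\varphi,Z\ge0$. Every $(P,K_\varphi,Z)$-controlled convex solution $u$ of $F(A[u])=\theta$ in $\Omega$ satisfies $$\sup_{\overline\Omega}|D^2u|+\sup_{\overline\Omega}|A[u]|\le C\bigl(1+\cot\delta_*(u)\bigr)$$ and $$\sup_{\overline\Omega}|D^2u|\ge\cot\delta_*(u)-C .$$ Here $C$ depends only on $n,P,K_\varphi,Z$ and the fixed boundary geometry. Consequently, for any family of convex solutions $u_j$ that are $(P,K_\varphi,Z)$-controlled with the same $P,K_\varphi,Z$, $$\sup_{\overline\Omega}|D^2u_j|\to\infty\quad\Longleftrightarrow\quad\delta_*(u_j)\to0 .$$ The same equivalence holds with $|D^2u_j|$ replaced by the curvature norm $|A[u_j]|$.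
   Context: Solutions are smooth up to the boundary, and convex means $D^2u\ge0$. $|\cdot|$ on matrices is the operator norm. $\nu$ is the inward unit normal, $\mathrm{II}_{\partial\Omega}$ the second fundamental form, positive for convex boundaries. $F(M)=\sum_{i=1}^n\arctan\lambda_i(M)$ and $$A[u]=\frac1{w}B\,D^2u\,B,\qquad w=\sqrt{1+|Du|^2},\quad B=(I+Du\otimes Du)^{-1/2},$$ whose eigenvalues are the principal curvatures of the graph of $u$. A convex solution $u$ with boundary value $\varphi=u|_{\partial\Omega}$ is $(P,K_\varphi,Z)$-controlled if $$\|u\|_{C^1(\overline\Omega)}\le P,\qquad \|\varphi\|_{C^2(\partial\Omega)}\le K_\varphi,\qquad \sup_{x\in\partial\Omega}\sup_{\xi\in T_x\partial\Omega,\,|\xi|=1}|D^2u(\xi,\nu)|\le Z .$$ For $x\in\partial\Omega$, $s\in\mathbb R$ put $q=D_T\varphi(x)$ (tangential gradient), $M(x,s)=D^2_{\partial\Omega}\varphi(x)-s\,\mathrm{II}_{\partial\Omega}(x)$ (intrinsic boundary Hessian; it equals the tangential block of $D^2u$ when $s=u_\nu(x)$), $C_{1,T}=\sqrt{1+|q|^2+s^2}\,(I_T+q\otimes q)$ on $T_x\partial\Omega$, and when $M(x,s)\ge0$ $$\mathcal B(x,s)=\frac\pi2+\sum_{\alpha=1}^{n-1}\arctan\lambda_\alpha\bigl(C_{1,T}^{-1/2}M(x,s)C_{1,T}^{-1/2}\bigr).$$ The actual boundary gap is $\delta_*(u)=\min_{x\in\partial\Omega}\bigl(\mathcal B(x,u_\nu(x))-\theta\bigr)$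 (it is positive for such solutions). *)

theory Defs
  imports "HOL-Analysis.Analysis"
begin

text \<open>
  All derivatives are taken within \<open>S\<close>.  For open \<open>S\<close> this is the usual class \<open>C\<^sup>k(S)\<close>; if \<open>S\<close> is the
  closure of a bounded smooth domain, derivatives within \<open>S\<close> are unique also at boundary points, and
  the class is that of the functions which are \<open>C\<^sup>k\<close> up to the boundary.  The function \<open>g b\<close> is
  the partial derivative in the coordinate direction \<open>b\<close>.
\<close>

primrec Ck_on :: "nat \<Rightarrow> 'a::euclidean_space set \<Rightarrow> ('a \<Rightarrow> real) \<Rightarrow> bool" where
  "Ck_on 0 S f \<longleftrightarrow> continuous_on S f"
| "Ck_on (Suc k) S f \<longleftrightarrow>
     (\<exists>g. (\<forall>x\<in>S. (f has_derivative (\<lambda>h. \<Sum>b\<in>Basis. (h \<bullet> b) * g b x)) (at x within S)) \<and>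
          (\<forall>b\<in>Basis. Ck_on k S (g b)))"

definition smooth_on :: "'a::euclidean_space set \<Rightarrow> ('a \<Rightarrow> real) \<Rightarrow> bool" where
  "smooth_on S f \<longleftrightarrow> (\<forall>k. Ck_on k S f)"

definition grad_on :: "'a::euclidean_space set \<Rightarrow> ('a \<Rightarrow> real) \<Rightarrow> 'a \<Rightarrow> 'a" where
  "grad_on S f x = (\<Sum>b\<in>Basis. frechet_derivative f (at x within S) b *\<^sub>R b)"

text \<open>The Hessian is treated as the linear map representing the form: \<open>D\<^sup>2f(\<xi>,\<eta>)\<close> is \<open>hess_on S f x \<xi> \<bullet> \<eta>\<close>.\<close>

definition hess_on :: "'a::euclidean_space set \<Rightarrow> ('a \<Rightarrow> real) \<Rightarrow> 'a \<Rightarrow> 'a \<Rightarrow> 'a" where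
  "hess_on S f x = frechet_derivative (grad_on S f) (at x within S)"

definition local_defining :: "'a::euclidean_space set \<Rightarrow> 'a set \<Rightarrow> ('a \<Rightarrow> real) \<Rightarrow> bool" where
  "local_defining \<Omega> U \<rho> \<longleftrightarrow>
     open U \<and> smooth_on U \<rho> \<and> (\<forall>y\<in>U. grad_on U \<rho> y \<noteq> 0) \<and> \<Omega> \<inter> U = {y\<in>U. \<rho> y > 0}"

definition bounded_smooth_domain :: "'a::euclidean_space set \<Rightarrow> bool" where
  "bounded_smooth_domain \<Omega> \<longleftrightarrow>
     open \<Omega> \<and> connected \<Omega> \<and> bounded \<Omega> \<and> \<Omega> \<noteq> {} \<and>
     (\<forall>x\<in>frontier \<Omega>. \<exists>U \<rho>. x \<in> U \<and> local_defining \<Omega> U \<rho>)"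

text \<open>Independent of the choice of \<open>U\<close> and \<open>\<rho>\<close>; inward because \<open>\<rho> > 0\<close> inside \<open>\<Omega>\<close>.\<close>

definition inward_normal :: "'a::euclidean_space set \<Rightarrow> 'a \<Rightarrow> 'a" where
  "inward_normal \<Omega> x =
     (THE v. \<exists>U \<rho>. x \<in> U \<and> local_defining \<Omega> U \<rho> \<and> v = sgn (grad_on U \<rho> x))"

definition tangent_space :: "'a::euclidean_space set \<Rightarrow> 'a \<Rightarrow> 'a set" where
  "tangent_space \<Omega> x = {v. v \<bullet> inward_normal \<Omega> x = 0}"

definition tproj :: "'a::euclidean_space set \<Rightarrow> 'a \<Rightarrow> 'a \<Rightarrow> 'a" where
  "tproj \<Omega> x v = v - (v \<bullet> inward_normal \<Omega> x) *\<^sub>R inward_normal \<Omega> x"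

text \<open>
  A derivative within \<open>frontier \<Omega>\<close> is determined by the values on the boundary, but only in
  tangential directions.  Below it is therefore only ever applied to tangent vectors, if necessary
  after projection.

  The second fundamental form is \<open>II(\<xi>,\<eta>) = shape_op \<Omega> x \<xi> \<bullet> \<eta>\<close>; for the inward normal this is
  positive on convex boundaries (it is \<open>1/R\<close> times the identity on the sphere of radius \<open>R\<close>).
\<close>

definition shape_op :: "'a::euclidean_space set \<Rightarrow> 'a \<Rightarrow> 'a \<Rightarrow> 'a" where
  "shape_op \<Omega> x \<xi> = - frechet_derivative (inward_normal \<Omega>) (at x within frontier \<Omega>) (tproj \<Omega> x \<xi>)"

definition tgrad :: "'a::euclidean_space set \<Rightarrow> ('a \<Rightarrow> real) \<Rightarrow> 'a \<Rightarrow> 'a" where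
  "tgrad \<Omega> \<phi> x =
     (\<Sum>b\<in>Basis. frechet_derivative \<phi> (at x within frontier \<Omega>) (tproj \<Omega> x b) *\<^sub>R b)"

text \<open>
  The Levi-Civita connection of a hypersurface is the tangential part of the flat derivative, so
  the intrinsic Hessian \<open>\<nabla>\<^sup>2\<phi>(\<xi>,\<eta>) = \<langle>\<nabla>\<^sub>\<xi> grad \<phi>, \<eta>\<rangle>\<close> is represented by the following map, which
  is extended by \<open>0\<close> in the normal direction.
\<close>

definition boundary_hess :: "'a::euclidean_space set \<Rightarrow> ('a \<Rightarrow> real) \<Rightarrow> 'a \<Rightarrow> 'a \<Rightarrow> 'a" where
  "boundary_hess \<Omega> \<phi> x \<xi> =
     tproj \<Omega> x (frechet_derivative (tgrad \<Omega> \<phi>) (at x within frontier \<Omega>) (tproj \<Omega> x \<xi>))"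

text \<open>
  \<open>arctan_sum V L\<close> is the sum of the arctangents of the eigenvalues of \<open>L\<close> on \<open>V\<close>, each counted with
  its multiplicity; \<open>L\<close> maps \<open>V\<close> to itself and is symmetric there, so that the multiplicity is the
  dimension of the eigenspace.
\<close>

definition arctan_sum :: "'a::euclidean_space set \<Rightarrow> ('a \<Rightarrow> 'a) \<Rightarrow> real" where
  "arctan_sum V L =
     (\<Sum>l\<in>{l. \<exists>v\<in>V. v \<noteq> 0 \<and> L v = l *\<^sub>R v}. real (dim {v\<in>V. L v = l *\<^sub>R v}) * arctan l)"

text \<open>
  The positive definite square root of the inverse of an operator \<open>L\<close> that is symmetric and positive
  definite on \<open>V\<close>, extended by \<open>0\<close> to the orthogonal complement of \<open>V\<close> to make it unique.
\<close>

definition inv_sqrt_on :: "'a::euclidean_space set \<Rightarrow> ('a \<Rightarrow> 'a) \<Rightarrow> 'a \<Rightarrow> 'a" where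
  "inv_sqrt_on V L =
     (THE R. linear R \<and> R ` V \<subseteq> V \<and> (\<forall>x\<in>V. \<forall>y\<in>V. R x \<bullet> y = x \<bullet> R y) \<and>
             (\<forall>x\<in>V. x \<noteq> 0 \<longrightarrow> R x \<bullet> x > 0) \<and> (\<forall>x\<in>V. R (R (L x)) = x) \<and>
             (\<forall>x\<in>orthogonal_comp V. R x = 0))"

definition curv_op :: "'a::euclidean_space set \<Rightarrow> ('a \<Rightarrow> real) \<Rightarrow> 'a \<Rightarrow> 'a \<Rightarrow> 'a" where
  "curv_op \<Omega> u x =
     (let p = grad_on (closure \<Omega>) u x;
          B = inv_sqrt_on UNIV (\<lambda>v. v + (p \<bullet> v) *\<^sub>R p)
      in (\<lambda>v. (1 / sqrt (1 + (norm p)\<^sup>2)) *\<^sub>R B (hess_on (closure \<Omega>) u x (B v))))"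

definition convex_solution :: "'a::euclidean_space set \<Rightarrow> real \<Rightarrow> ('a \<Rightarrow> real) \<Rightarrow> bool" where
  "convex_solution \<Omega> \<theta> u \<longleftrightarrow>
     smooth_on (closure \<Omega>) u \<and>
     (\<forall>x\<in>closure \<Omega>. \<forall>\<xi>. hess_on (closure \<Omega>) u x \<xi> \<bullet> \<xi> \<ge> 0) \<and>
     (\<forall>x\<in>\<Omega>. arctan_sum UNIV (curv_op \<Omega> u x) = \<theta>)"

definition sup_hess :: "'a::euclidean_space set \<Rightarrow> ('a \<Rightarrow> real) \<Rightarrow> real" where
  "sup_hess \<Omega> u = (SUP x\<in>closure \<Omega>. onorm (hess_on (closure \<Omega>) u x))"

definition sup_curv :: "'a::euclidean_space set \<Rightarrow> ('a \<Rightarrow> real) \<Rightarrow> real" where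
  "sup_curv \<Omega> u = (SUP x\<in>closure \<Omega>. onorm (curv_op \<Omega> u x))"

definition C1_norm :: "'a::euclidean_space set \<Rightarrow> ('a \<Rightarrow> real) \<Rightarrow> real" where
  "C1_norm \<Omega> u = (SUP x\<in>closure \<Omega>. \<bar>u x\<bar>) + (SUP x\<in>closure \<Omega>. norm (grad_on (closure \<Omega>) u x))"

definition boundary_C2_norm :: "'a::euclidean_space set \<Rightarrow> ('a \<Rightarrow> real) \<Rightarrow> real" where
  "boundary_C2_norm \<Omega> \<phi> =
     (SUP x\<in>frontier \<Omega>. \<bar>\<phi> x\<bar>) + (SUP x\<in>frontier \<Omega>. norm (tgrad \<Omega> \<phi> x)) +
     (SUP x\<in>frontier \<Omega>. onorm (boundary_hess \<Omega> \<phi> x))"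

text \<open>
  Here and in \<open>boundary_gap\<close>, \<open>u\<close> itself plays the role of its boundary value \<open>\<phi>\<close>, since the boundary
  operators only see the restriction to \<open>frontier \<Omega>\<close>.
\<close>

definition controlled ::
  "'a::euclidean_space set \<Rightarrow> real \<Rightarrow> real \<Rightarrow> real \<Rightarrow> ('a \<Rightarrow> real) \<Rightarrow> bool" where
  "controlled \<Omega> P K Z u \<longleftrightarrow>
     C1_norm \<Omega> u \<le> P \<and> boundary_C2_norm \<Omega> u \<le> K \<and>
     (SUP x\<in>frontier \<Omega>. SUP \<xi>\<in>{\<xi>\<in>tangent_space \<Omega> x. norm \<xi> = 1}.
        \<bar>hess_on (closure \<Omega>) u x \<xi> \<bullet> inward_normal \<Omega> x\<bar>) \<le> Z"

text \<open>
  \<open>bdry_M\<close> and \<open>bdry_C\<close> are the maps \<open>M(x,s)\<close> and \<open>C\<^sub>1\<^sub>,\<^sub>T\<close> on the tangent space.  The function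
  \<open>bdry_phase\<close> is meaningful for \<open>M(x,s) \<ge> 0\<close>; this always holds for a convex \<open>u\<close> with \<open>s = u\<^sub>\<nu>(x)\<close>.
\<close>

definition bdry_M :: "'a::euclidean_space set \<Rightarrow> ('a \<Rightarrow> real) \<Rightarrow> 'a \<Rightarrow> real \<Rightarrow> 'a \<Rightarrow> 'a" where
  "bdry_M \<Omega> \<phi> x s v = boundary_hess \<Omega> \<phi> x v - s *\<^sub>R shape_op \<Omega> x v"

definition bdry_C :: "'a::euclidean_space set \<Rightarrow> ('a \<Rightarrow> real) \<Rightarrow> 'a \<Rightarrow> real \<Rightarrow> 'a \<Rightarrow> 'a" where
  "bdry_C \<Omega> \<phi> x s v =
     (let q = tgrad \<Omega> \<phi> x in sqrt (1 + (norm q)\<^sup>2 + s\<^sup>2) *\<^sub>R (v + (q \<bullet> v) *\<^sub>R q))"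

definition bdry_phase :: "'a::euclidean_space set \<Rightarrow> ('a \<Rightarrow> real) \<Rightarrow> 'a \<Rightarrow> real \<Rightarrow> real" where
  "bdry_phase \<Omega> \<phi> x s =
     (let T = tangent_space \<Omega> x; R = inv_sqrt_on T (bdry_C \<Omega> \<phi> x s)
      in pi / 2 + arctan_sum T (\<lambda>v. R (bdry_M \<Omega> \<phi> x s (R v))))"

text \<open>The infimum is a minimum, by continuity and compactness of the boundary.\<close>

definition boundary_gap :: "'a::euclidean_space set \<Rightarrow> real \<Rightarrow> ('a \<Rightarrow> real) \<Rightarrow> real" where
  "boundary_gap \<Omega> \<theta> u =
     (INF x\<in>frontier \<Omega>.
        bdry_phase \<Omega> u x (grad_on (closure \<Omega>) u x \<bullet> inward_normal \<Omega> x) - \<theta>)"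

end

theory Submission
  imports Defs
begin

text \<open>
  With \<open>p = Du\<close>, \<open>w = \<surd>(1 + |p|\<^sup>2)\<close> and \<open>g = I + p \<otimes> p\<close>, the principal curvatures are the eigenvalues
  of \<open>D\<^sup>2u / w\<close> relative to \<open>g\<close>.  Since \<open>arctan\<close> is concave on \<open>[0, \<infinity>)\<close>, Jensen's inequality gives
  \<open>\<theta> \<le> \<Sum> arctan (D\<^sup>2u(f\<^sub>i, f\<^sub>i) / w)\<close> for every \<open>g\<close>-orthonormal frame, with equality for an eigenframe;
  this replaces all differentiation of eigenvalues.

  Interior: let \<open>a\<close> be the maximum of \<open>D\<^sup>2u(\<xi>, \<xi>) / g(\<xi>, \<xi>)\<close>, that is of curvature times \<open>w\<close>.  If it is
  attained at an interior point in direction \<open>e\<close>, move an eigenframe at that point by the minimal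
  rotations of the normals.  Along the line in direction \<open>e\<close> the Jensen sum has a minimum there;
  comparing its second derivative with the maximality of \<open>a\<close> in the other directions, all third
  and fourth derivatives of \<open>u\<close> cancel and \<open>0 \<le> c \<cdot> \<partial>\<^sub>e\<^sup>2(1/w)\<close> with \<open>c > 0\<close> remains, but
  \<open>\<partial>\<^sub>e\<^sup>2(1/w) < 0\<close>.

  Boundary: in a frame of tangential eigenvectors, completed by the \<open>g\<close>-normal of the tangent space,
  only the last diagonal entry \<open>m\<close> of the curvature operator is not controlled.  Jensen's inequality
  bounds the gap below by \<open>\<pi>/2 - arctan m\<close>, and completing the square bounds it above by \<open>C/m\<close>.
\<close>

section \<open>Symmetric operators and sums of arctangents\<close>

text \<open>At a maximum point Jensen's inequality is an equality for an eigenframe, so for any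
  smooth orthonormal continuation of that frame the Jensen sum has a minimum there, even where
  eigenvalues cross.

  The curvature alone cannot be excluded from having an interior maximum: on a spherical cap all
  curvatures are one constant. The factor \<open>w\<close> supplies a strict sign, and it makes the
  quotient have D^2u itself as numerator, so that only plain derivatives of u and the motion of the
  frame are differentiated.

  The maximum then lies at a boundary point that need not be the one with the smallest gap. This
  does no harm, since every boundary point relates its own gap to its own entry \<open>m\<close>:
  the smallest gap is at most C/m at the maximum point, and \<open>m\<close> is everywhere at most
  the supremum of the curvature.

  The constants are uniform in \<theta>, which enters only as the common value of the arctangent
  sums and through \<theta> > 0, which excludes zero curvature at the maximum.\<close>

definition onframe :: "'a::euclidean_space set \<Rightarrow> 'i set \<Rightarrow> ('i \<Rightarrow> 'a) \<Rightarrow> bool" where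
  "onframe V I e \<longleftrightarrow> finite I \<and> card I = dim V \<and> (\<forall>i\<in>I. e i \<in> V) \<and>
     (\<forall>i\<in>I. \<forall>j\<in>I. e i \<bullet> e j = (if i = j then 1 else 0))"

lemma onframe_span:
  assumes "subspace V" "onframe V I e"
  shows "span (e ` I) = V"
proof -
  have inj: "inj_on e I"
  proof (rule inj_onI)
    fix i j assume "i \<in> I" "j \<in> I" "e i = e j"
    then have "e i \<bullet> e j = 1"
      using assms(2) unfolding onframe_def by (metis)
    then show "i = j" using assms(2) \<open>i \<in> I\<close> \<open>j \<in> I\<close> unfolding onframe_def
      by (metis zero_neq_one)
  qed
  have po: "pairwise orthogonal (e ` I)"
    using assms(2) unfolding onframe_def pairwise_def orthogonal_def by (auto split: if_splits)
  have nz: "0 \<notin> e ` I"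
    using assms(2) unfolding onframe_def by (metis imageE inner_zero_left zero_neq_one)
  have ind: "independent (e ` I)" using pairwise_orthogonal_independent[OF po nz] .
  have "card (e ` I) = dim V" using card_image[OF inj] assms(2) unfolding onframe_def by simp
  moreover have "e ` I \<subseteq> V" using assms(2) unfolding onframe_def by auto
  ultimately have "V \<subseteq> span (e ` I)"
    using card_ge_dim_independent[of "e ` I" V] ind by simp
  then show ?thesis
    using \<open>e ` I \<subseteq> V\<close> assms(1) by (metis span_minimal subset_antisym)
qed

lemma onframe_expand:
  assumes V: "subspace V" and e: "onframe V I e" and v: "v \<in> V"
  shows "v = (\<Sum>i\<in>I. (v \<bullet> e i) *\<^sub>R e i)"
proof -
  have fin: "finite I" using e unfolding onframe_def by simp
  define r where "r = v - (\<Sum>i\<in>I. (v \<bullet> e i) *\<^sub>R e i)"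
  have "r \<in> V" unfolding r_def using V v e unfolding onframe_def
    by (intro subspace_diff subspace_sum subspace_scale) auto
  have "r \<bullet> e j = 0" if "j \<in> I" for j
  proof -
    have "(\<Sum>i\<in>I. (v \<bullet> e i) *\<^sub>R e i) \<bullet> e j = (\<Sum>i\<in>I. (v \<bullet> e i) * (if i = j then 1 else 0))"
      unfolding inner_sum_left using e that unfolding onframe_def
      by (intro sum.cong) auto
    also have "\<dots> = v \<bullet> e j" using fin that by (simp add: if_distrib cong: if_cong)
    finally show ?thesis unfolding r_def by (simp add: inner_diff_left)
  qed
  then have "orthogonal r x" if "x \<in> e ` I" for x using that unfolding orthogonal_def by auto
  then have "orthogonal r x" if "x \<in> span (e ` I)" for x
    using orthogonal_to_span that by blast
  then have "orthogonal r r" using onframe_span[OF V e] \<open>r \<in> V\<close> by auto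
  then show ?thesis unfolding r_def by (simp add: orthogonal_self)
qed

lemma onframe_parseval:
  assumes "subspace V" "onframe V I e" "v \<in> V"
  shows "v \<bullet> w = (\<Sum>i\<in>I. (v \<bullet> e i) * (w \<bullet> e i))"
proof -
  have "v \<bullet> w = (\<Sum>i\<in>I. (v \<bullet> e i) *\<^sub>R e i) \<bullet> w" using onframe_expand[OF assms] by simp
  then show ?thesis by (simp only: inner_sum_left inner_scaleR_left inner_commute[of "e _" w])
qed

section \<open>The spectral theorem on a subspace\<close>

lemma psd_cauchy_schwarz:
  fixes L :: "'a::euclidean_space \<Rightarrow> 'a"
  assumes L: "linear L" and V: "subspace V"
    and sym: "\<And>x y. x \<in> V \<Longrightarrow> y \<in> V \<Longrightarrow> L x \<bullet> y = x \<bullet> L y"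
    and psd: "\<And>x. x \<in> V \<Longrightarrow> L x \<bullet> x \<ge> 0"
    and x: "x \<in> V" and y: "y \<in> V"
  shows "(L x \<bullet> y)\<^sup>2 \<le> (L x \<bullet> x) * (L y \<bullet> y)"
proof -
  define a b c where "a = L x \<bullet> x" and "b = L x \<bullet> y" and "c = L y \<bullet> y"
  have q: "a * s\<^sup>2 + 2 * b * s * t + c * t\<^sup>2 \<ge> 0" for s t
  proof -
    have "L (s *\<^sub>R x + t *\<^sub>R y) \<bullet> (s *\<^sub>R x + t *\<^sub>R y) \<ge> 0"
      using psd V x y by (simp add: subspace_add subspace_scale)
    moreover have "L y \<bullet> x = b" using sym[OF y x] unfolding b_def by (simp add: inner_commute)
    ultimately show ?thesis
      unfolding a_def b_def c_def linear_add[OF L] linear_scale[OF L]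
      by (simp add: inner_add_left inner_add_right algebra_simps power2_eq_square)
  qed
  have "a \<ge> 0" "c \<ge> 0" using psd x y unfolding a_def c_def by auto
  have "b\<^sup>2 \<le> a * c"
  proof (cases "c = 0")
    case True
    have "b = 0"
    proof (rule ccontr)
      assume "b \<noteq> 0"
      \<comment> \<open>For c = 0 and s = 1 the expression is affine in t; at this t it would equal
        -1.\<close>
      have "a * 1\<^sup>2 + 2 * b * 1 * (- (a + 1) / (2 * b)) + c * (- (a + 1) / (2 * b))\<^sup>2 \<ge> 0" by (rule q)
      with True \<open>b \<noteq> 0\<close> show False by simp
    qed
    then show ?thesis using True by simp
  next
    case False
    have "a * c\<^sup>2 + 2 * b * c * (-b) + c * (-b)\<^sup>2 \<ge> 0" by (rule q)
    then have "c * (a * c - b\<^sup>2) \<ge> 0" by (simp add: power2_eq_square algebra_simps)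
    then show ?thesis using False \<open>c \<ge> 0\<close> by (simp add: zero_le_mult_iff)
  qed
  then show ?thesis unfolding a_def b_def c_def .
qed

text \<open>A maximiser e of the quadratic form on the unit sphere makes l I - L positive
  semidefinite with value 0 at e. Cauchy-Schwarz for that form forces (l I - L) e = 0, so no
  Rayleigh quotient is differentiated.\<close>

lemma symmetric_eigenvector_exists:
  fixes L :: "'a::euclidean_space \<Rightarrow> 'a"
  assumes L: "linear L" and V: "subspace V" and LV: "\<And>x. x \<in> V \<Longrightarrow> L x \<in> V"
    and sym: "\<And>x y. x \<in> V \<Longrightarrow> y \<in> V \<Longrightarrow> L x \<bullet> y = x \<bullet> L y"
    and nt: "V \<noteq> {0}"
  obtains e where "e \<in> V" "norm e = 1" "L e = (L e \<bullet> e) *\<^sub>R e"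
proof -
  have bl: "bounded_linear L" using L by (simp add: linear_linear)
  obtain v where v: "v \<in> V" "v \<noteq> 0" using nt V subspace_0 by blast
  have "compact (V \<inter> sphere 0 1)" using closed_subspace[OF V] by (simp add: closed_Int_compact)
  moreover have "V \<inter> sphere 0 1 \<noteq> {}"
  proof -
    have "v /\<^sub>R norm v \<in> V \<inter> sphere 0 1" using v V by (auto simp: subspace_scale)
    then show ?thesis by blast
  qed
  moreover have "continuous_on (V \<inter> sphere 0 1) (\<lambda>x. L x \<bullet> x)"
    using bl by (intro continuous_intros linear_continuous_on)
  ultimately obtain e where e: "e \<in> V \<inter> sphere 0 1"
      and max: "\<And>x. x \<in> V \<inter> sphere 0 1 \<Longrightarrow> L x \<bullet> x \<le> L e \<bullet> e"
    using continuous_attains_sup[of "V \<inter> sphere 0 1" "\<lambda>x. L x \<bullet> x"] by blast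
  define l where "l = L e \<bullet> e"
  define Q where "Q = (\<lambda>x. l *\<^sub>R x - L x)"
  have eV: "e \<in> V" and en: "norm e = 1" using e by auto
  have Qlin: "linear Q" unfolding Q_def
    using L by (intro linear_compose_sub linear_scale_self) auto
  have Qsym: "Q x \<bullet> y = x \<bullet> Q y" if "x \<in> V" "y \<in> V" for x y
    using sym[OF that] unfolding Q_def by (simp add: inner_diff_left inner_diff_right)
  have Qpsd: "Q x \<bullet> x \<ge> 0" if "x \<in> V" for x
  proof (cases "x = 0")
    case False
    let ?y = "x /\<^sub>R norm x"
    have "L ?y \<bullet> ?y \<le> l" unfolding l_def
      using max[of ?y] that V False by (simp add: subspace_scale)
    then have "(L x \<bullet> x) / (norm x)\<^sup>2 \<le> l"
      using False by (simp add: linear_scale[OF L] power2_eq_square field_simps)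
    then have "L x \<bullet> x \<le> l * (x \<bullet> x)" using False by (simp add: field_simps power2_norm_eq_inner)
    then show ?thesis unfolding Q_def by (simp add: inner_diff_left)
  qed (simp add: linear_0[OF Qlin])
  have "e \<bullet> e = 1" using en by (simp add: norm_eq_1)
  then have Qe: "Q e \<bullet> e = 0" unfolding Q_def l_def by (simp add: inner_diff_left)
  have QeV: "Q e \<in> V" unfolding Q_def using eV LV V by (simp add: subspace_diff subspace_scale)
  have "(Q e \<bullet> Q e)\<^sup>2 \<le> (Q e \<bullet> e) * (Q (Q e) \<bullet> Q e)"
    by (rule psd_cauchy_schwarz[OF Qlin V Qsym Qpsd eV QeV])
  then have "Q e = 0" using Qe by simp
  then have "L e = (L e \<bullet> e) *\<^sub>R e" unfolding Q_def l_def by simp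
  then show thesis using that eV en by blast
qed

lemma symmetric_eigenframe:
  fixes L :: "'a::euclidean_space \<Rightarrow> 'a"
  assumes "linear L" and "subspace V" and "\<And>x. x \<in> V \<Longrightarrow> L x \<in> V"
    and "\<And>x y. x \<in> V \<Longrightarrow> y \<in> V \<Longrightarrow> L x \<bullet> y = x \<bullet> L y"
  shows "\<exists>E::'a set. onframe V E (\<lambda>x. x) \<and> (\<forall>e\<in>E. L e = (L e \<bullet> e) *\<^sub>R e)"
  using assms(2-)
proof (induction "dim V" arbitrary: V)
  case 0
  then have "onframe V {} (\<lambda>x. x)" unfolding onframe_def by simp
  then show ?case by blast
next
  case (Suc n)
  note V = \<open>subspace V\<close>
  have "V \<noteq> {0}" using Suc.hyps(2) by (metis dim_eq_0 nat.distinct(1) order_refl)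
  then obtain e where e: "e \<in> V" "norm e = 1" "L e = (L e \<bullet> e) *\<^sub>R e"
    using symmetric_eigenvector_exists[OF assms(1) V] Suc.prems by metis
  define W where "W = {y \<in> V. \<forall>x\<in>span {e}. orthogonal x y}"
  have Wchar: "W = {y \<in> V. e \<bullet> y = 0}"
    unfolding W_def orthogonal_def by (auto simp: span_breakdown_eq) (metis span_base singletonI)
  have W: "subspace W" unfolding Wchar using V
    by (auto simp: subspace_def inner_add_right)
  have "dim W + dim (span {e}) = dim V" unfolding W_def
    using dim_subspace_orthogonal_to_vectors[of "span {e}" V] V e
    by (simp add: span_minimal)
  moreover have "dim (span {e}) = 1" using e(2) by (auto simp: dim_span dim_singleton)
  ultimately have dW: "dim W = n" using Suc.hyps(2) by simp
  have "\<exists>E::'a set. onframe W E (\<lambda>x. x) \<and> (\<forall>e\<in>E. L e = (L e \<bullet> e) *\<^sub>R e)"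
  proof (rule Suc.hyps(1))
    show "n = dim W" using dW by simp
    show "subspace W" by fact
    fix x assume x: "x \<in> W"
    have "e \<bullet> L x = L e \<bullet> x" using Suc.prems(3)[of e x] e x unfolding Wchar by simp
    also have "\<dots> = 0" by (subst e(3)) (use x in \<open>simp add: Wchar\<close>)
    finally show "L x \<in> W" using x Suc.prems(2) unfolding Wchar by simp
    fix y assume "y \<in> W"
    then show "L x \<bullet> y = x \<bullet> L y" using x Suc.prems(3) unfolding Wchar by simp
  qed
  then obtain E where E: "onframe W E (\<lambda>x. x)" "\<forall>e\<in>E. L e = (L e \<bullet> e) *\<^sub>R e" by blast
  have ee: "e \<bullet> e = 1" using e(2) by (simp add: norm_eq_1)
  have eE: "x \<bullet> e = 0" "e \<bullet> x = 0" if "x \<in> E" for x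
    using E(1) that unfolding onframe_def Wchar by (auto simp: inner_commute)
  then have "e \<notin> E" using ee by force
  then have "onframe V (insert e E) (\<lambda>x. x)"
    using E(1) dW Suc.hyps(2) e(1) ee eE unfolding onframe_def
    by (auto simp: Wchar)
  then show ?case using E(2) e(3) by blast
qed

section \<open>Sums of arctangents and weighted averages\<close>

lemma sum_card_fibres:
  fixes f :: "'b \<Rightarrow> real"
  assumes "finite I"
  shows "(\<Sum>l\<in>g ` I. real (card {i\<in>I. g i = l}) * f l) = (\<Sum>i\<in>I. f (g i))"
proof -
  have "(\<Sum>i\<in>I. f (g i)) = (\<Sum>l\<in>g ` I. \<Sum>i\<in>{i\<in>I. g i = l}. f (g i))"
    by (rule sum.image_gen[OF assms])
  also have "\<dots> = (\<Sum>l\<in>g ` I. real (card {i\<in>I. g i = l}) * f l)"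
    by (intro sum.cong) auto
  finally show ?thesis by simp
qed

text \<open>The bridge from distinct eigenvalues with multiplicities to a sum over a frame: the
  eigenspace of r is spanned by exactly those frame vectors whose eigenvalue is r.\<close>

lemma arctan_sum_eigenframe:
  assumes L: "linear L" and V: "subspace V" and e: "onframe V I e"
    and ev: "\<And>i. i \<in> I \<Longrightarrow> L (e i) = l i *\<^sub>R e i"
  shows "arctan_sum V L = (\<Sum>i\<in>I. arctan (l i))"
proof -
  have fin: "finite I" and eV: "\<And>i. i \<in> I \<Longrightarrow> e i \<in> V"
    and on: "\<And>i j. i \<in> I \<Longrightarrow> j \<in> I \<Longrightarrow> e i \<bullet> e j = (if i = j then 1 else 0)"
    using e unfolding onframe_def by auto
  \<comment> \<open>An eigenvector has no component along frame vectors belonging to another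
    eigenvalue.\<close>
  have coeff: "(v \<bullet> e i) * (l i - r) = 0" if "v \<in> V" "L v = r *\<^sub>R v" "i \<in> I" for v r i
  proof -
    have "L v = L (\<Sum>j\<in>I. (v \<bullet> e j) *\<^sub>R e j)" using onframe_expand[OF V e that(1)] by simp
    also have "\<dots> = (\<Sum>j\<in>I. (v \<bullet> e j) *\<^sub>R (l j *\<^sub>R e j))"
      by (simp add: linear_sum[OF L] linear_scale[OF L] ev)
    finally have "L v \<bullet> e i = (\<Sum>j\<in>I. (v \<bullet> e j) * l j * (e j \<bullet> e i))"
      by (simp add: inner_sum_left mult.assoc)
    also have "\<dots> = (\<Sum>j\<in>I. if j = i then (v \<bullet> e i) * l i else 0)"
      using on that(3) by (intro sum.cong) auto
    also have "\<dots> = (v \<bullet> e i) * l i" using fin that(3) by simp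
    finally show ?thesis using that(2) by (auto simp: algebra_simps)
  qed
  have eigset: "{r. \<exists>v\<in>V. v \<noteq> 0 \<and> L v = r *\<^sub>R v} = l ` I"
  proof (intro set_eqI iffI)
    fix r assume "r \<in> {r. \<exists>v\<in>V. v \<noteq> 0 \<and> L v = r *\<^sub>R v}"
    then obtain v where v: "v \<in> V" "v \<noteq> 0" "L v = r *\<^sub>R v" by blast
    have "\<exists>i\<in>I. v \<bullet> e i \<noteq> 0"
    proof (rule ccontr)
      assume "\<not> ?thesis"
      then have "(\<Sum>i\<in>I. (v \<bullet> e i) *\<^sub>R e i) = 0" by simp
      then show False using onframe_expand[OF V e v(1)] v(2) by simp
    qed
    then show "r \<in> l ` I" using coeff[OF v(1,3)] by fastforce
  next
    fix r assume "r \<in> l ` I"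
    then obtain i where i: "i \<in> I" "r = l i" by blast
    have "e i \<noteq> 0" using on[OF i(1) i(1)] by auto
    then show "r \<in> {r. \<exists>v\<in>V. v \<noteq> 0 \<and> L v = r *\<^sub>R v}" using i ev eV by auto
  qed
  have dims: "dim {v\<in>V. L v = r *\<^sub>R v} = card {i\<in>I. l i = r}" for r
  proof -
    let ?J = "{i\<in>I. l i = r}"
    have inj: "inj_on e ?J"
      by (rule inj_onI) (metis (mono_tags, lifting) mem_Collect_eq on zero_neq_one)
    have po: "pairwise orthogonal (e ` ?J)"
      using on unfolding pairwise_def orthogonal_def by (auto split: if_splits)
    have nz: "0 \<notin> e ` ?J"
      using on by (metis (mono_tags, lifting) imageE inner_zero_left mem_Collect_eq zero_neq_one)
    have ind: "independent (e ` ?J)" using pairwise_orthogonal_independent[OF po nz] .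
    have "{v\<in>V. L v = r *\<^sub>R v} = span (e ` ?J)"
    proof
      show "{v\<in>V. L v = r *\<^sub>R v} \<subseteq> span (e ` ?J)"
      proof clarify
        fix v assume v: "v \<in> V" "L v = r *\<^sub>R v"
        have "v = (\<Sum>i\<in>I. (v \<bullet> e i) *\<^sub>R e i)" by (rule onframe_expand[OF V e v(1)])
        also have "\<dots> \<in> span (e ` ?J)"
        proof (rule span_sum)
          fix i assume i: "i \<in> I"
          show "(v \<bullet> e i) *\<^sub>R e i \<in> span (e ` ?J)"
            proof (cases "l i = r")
            case True
            then have "e i \<in> e ` ?J" using i by blast
            then show ?thesis by (intro span_scale span_base)
          next
            case False
            then have "v \<bullet> e i = 0" using coeff[OF v i] by simp
            then show ?thesis by (simp add: span_zero)
          qed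
        qed
        finally show "v \<in> span (e ` ?J)" .
      qed
      have "subspace {v\<in>V. L v = r *\<^sub>R v}"
        using V by (auto simp: subspace_def linear_add[OF L] linear_scale[OF L] linear_0[OF L] algebra_simps)
      then show "span (e ` ?J) \<subseteq> {v\<in>V. L v = r *\<^sub>R v}"
        by (intro span_minimal) (auto simp: ev eV)
    qed
    then show ?thesis using dim_span_eq_card_independent[OF ind] card_image[OF inj] by simp
  qed
  show ?thesis
    unfolding arctan_sum_def eigset dims by (rule sum_card_fibres[OF fin])
qed

text \<open>Concavity on the half line in tangent form. Besides giving Jensen's inequality, it later
  replaces the arctangents near a maximum point by fixed linear weights.\<close>

lemma arctan_le_tangent:
  fixes x y :: real
  assumes "x \<ge> 0" "y \<ge> 0"
  shows "arctan y \<le> arctan x + (y - x) / (1 + x\<^sup>2)"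
proof -
  consider "x = y" | "x < y" | "y < x" by linarith
  then show ?thesis
  proof cases
    case 2
    obtain z where z: "x < z" "z < y" "arctan y - arctan x = (y - x) * inverse (1 + z\<^sup>2)"
      using MVT2[OF 2, of arctan "\<lambda>z. inverse (1 + z\<^sup>2)"] DERIV_arctan by blast
    have "inverse (1 + z\<^sup>2) \<le> inverse (1 + x\<^sup>2)"
      using z assms by (intro le_imp_inverse_le) (auto simp: power_mono add_pos_nonneg)
    then have "(y - x) * inverse (1 + z\<^sup>2) \<le> (y - x) * inverse (1 + x\<^sup>2)"
      using 2 by (intro mult_left_mono) auto
    then show ?thesis using z by (simp add: divide_inverse algebra_simps)
  next
    case 3
    obtain z where z: "y < z" "z < x" "arctan x - arctan y = (x - y) * inverse (1 + z\<^sup>2)"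
      using MVT2[OF 3, of arctan "\<lambda>z. inverse (1 + z\<^sup>2)"] DERIV_arctan by blast
    have "inverse (1 + x\<^sup>2) \<le> inverse (1 + z\<^sup>2)"
      using z assms by (intro le_imp_inverse_le) (auto simp: power_mono add_pos_nonneg)
    then have "(x - y) * inverse (1 + x\<^sup>2) \<le> (x - y) * inverse (1 + z\<^sup>2)"
      using 3 by (intro mult_left_mono) auto
    then show ?thesis using z by (simp add: divide_inverse algebra_simps)
  qed simp
qed

text \<open>Jensen's inequality for total weight at most 1: the missing mass is placed at 0, where
  arctan vanishes.\<close>

lemma arctan_sub_average:
  fixes c \<mu> :: "'i \<Rightarrow> real"
  assumes "finite A" "\<And>a. a \<in> A \<Longrightarrow> c a \<ge> 0" "\<And>a. a \<in> A \<Longrightarrow> \<mu> a \<ge> 0" "sum c A \<le> 1"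
  shows "(\<Sum>a\<in>A. c a * arctan (\<mu> a)) \<le> arctan (\<Sum>a\<in>A. c a * \<mu> a)"
proof -
  define s where "s = (\<Sum>a\<in>A. c a * \<mu> a)"
  have s: "s \<ge> 0" unfolding s_def using assms by (intro sum_nonneg) auto
  have "(\<Sum>a\<in>A. c a * arctan (\<mu> a)) \<le> (\<Sum>a\<in>A. c a * (arctan s + (\<mu> a - s) / (1 + s\<^sup>2)))"
    using assms s by (intro sum_mono mult_left_mono arctan_le_tangent) auto
  also have "\<dots> = (\<Sum>a\<in>A. c a * (arctan s - s / (1 + s\<^sup>2)) + (c a * \<mu> a) / (1 + s\<^sup>2))"
    by (intro sum.cong) (auto simp: algebra_simps diff_divide_distrib)
  also have "\<dots> = sum c A * (arctan s - s / (1 + s\<^sup>2)) + s / (1 + s\<^sup>2)"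
    unfolding sum.distrib s_def sum_distrib_right sum_divide_distrib ..
  \<comment> \<open>The tangent at s lies above the graph at 0, so arctan s - s / (1 + s^2) is
    nonnegative and the total weight may be raised to 1.\<close>
  also have "\<dots> \<le> 1 * (arctan s - s / (1 + s\<^sup>2)) + s / (1 + s\<^sup>2)"
    using arctan_le_tangent[of s 0] s assms(4) by (intro add_right_mono mult_right_mono) auto
  finally show ?thesis unfolding s_def by simp
qed

text \<open>A weak majorisation principle: each \<mu> a is distributed completely over the k, and no
  k receives total weight above 1, so Jensen's inequality applies to each k. The three frame
  comparisons that follow differ in the choice of c.\<close>

lemma arctan_sum_mono_weights:
  fixes c :: "'k \<Rightarrow> 'a \<Rightarrow> real"
  assumes "finite A" "finite K"
    and "\<And>k a. k \<in> K \<Longrightarrow> a \<in> A \<Longrightarrow> c k a \<ge> 0" "\<And>a. a \<in> A \<Longrightarrow> \<mu> a \<ge> 0"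
    and "\<And>k. k \<in> K \<Longrightarrow> (\<Sum>a\<in>A. c k a) \<le> 1" "\<And>a. a \<in> A \<Longrightarrow> (\<Sum>k\<in>K. c k a) = 1"
    and "\<And>k. k \<in> K \<Longrightarrow> (\<Sum>a\<in>A. c k a * \<mu> a) \<le> l k"
  shows "(\<Sum>a\<in>A. arctan (\<mu> a)) \<le> (\<Sum>k\<in>K. arctan (l k))"
proof -
  have "(\<Sum>a\<in>A. arctan (\<mu> a)) = (\<Sum>a\<in>A. (\<Sum>k\<in>K. c k a) * arctan (\<mu> a))" using assms by simp
  also have "\<dots> = (\<Sum>k\<in>K. \<Sum>a\<in>A. c k a * arctan (\<mu> a))"
    unfolding sum_distrib_right by (rule sum.swap)
  also have "\<dots> \<le> (\<Sum>k\<in>K. arctan (l k))"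
  proof (rule sum_mono)
    fix k assume k: "k \<in> K"
    have "(\<Sum>a\<in>A. c k a * arctan (\<mu> a)) \<le> arctan (\<Sum>a\<in>A. c k a * \<mu> a)"
      using assms k by (intro arctan_sub_average) auto
    also have "\<dots> \<le> arctan (l k)" using assms k by (simp add: arctan_monotone')
    finally show "(\<Sum>a\<in>A. c k a * arctan (\<mu> a)) \<le> arctan (l k)" .
  qed
  finally show ?thesis .
qed

lemma arctan_add_le: "arctan (x + d) \<le> arctan x + d" if "d \<ge> 0" for x d :: real
proof (cases "d = 0")
  case False
  then have d: "x < x + d" using that by simp
  obtain z where z: "arctan (x + d) - arctan x = (x + d - x) * inverse (1 + z\<^sup>2)"
    using MVT2[OF d, of arctan "\<lambda>z. inverse (1 + z\<^sup>2)"] DERIV_arctan by blast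
  have "inverse (1 + z\<^sup>2) \<le> 1" by (simp add: inverse_le_1_iff)
  then have "d * inverse (1 + z\<^sup>2) \<le> d" using that by (simp add: mult_left_le)
  then show ?thesis using z by simp
qed simp

section \<open>Arctangent sums compared in different frames\<close>

locale psd_operator =
  fixes A :: "'a::euclidean_space \<Rightarrow> 'a"
  assumes lin: "linear A" and sym: "A x \<bullet> y = x \<bullet> A y" and psd: "A x \<bullet> x \<ge> 0"
begin

lemma cauchy_schwarz: "(A x \<bullet> y)\<^sup>2 \<le> (A x \<bullet> x) * (A y \<bullet> y)"
  using psd_cauchy_schwarz[OF lin, of UNIV] sym psd by auto

lemma eigenframe:
  obtains E :: "'a set" where "onframe UNIV E (\<lambda>x. x)" "\<And>e. e \<in> E \<Longrightarrow> A e = (A e \<bullet> e) *\<^sub>R e"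
    "arctan_sum UNIV A = (\<Sum>e\<in>E. arctan (A e \<bullet> e))"
proof -
  obtain E where E: "onframe UNIV E (\<lambda>x. x)" "\<forall>e\<in>E. A e = (A e \<bullet> e) *\<^sub>R e"
    using symmetric_eigenframe[OF lin, of UNIV] sym by auto
  then show thesis
    using that arctan_sum_eigenframe[OF lin subspace_UNIV E(1), of "\<lambda>e. A e \<bullet> e"] by blast
qed

lemma quadratic_eigenframe:
  assumes E: "onframe UNIV E (\<lambda>x. x)" "\<And>e. e \<in> E \<Longrightarrow> A e = (A e \<bullet> e) *\<^sub>R e"
  shows "A v \<bullet> v = (\<Sum>e\<in>E. (v \<bullet> e)\<^sup>2 * (A e \<bullet> e))"
proof -
  have "A v \<bullet> v = (\<Sum>e\<in>E. (A v \<bullet> e) * (v \<bullet> e))"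
    using onframe_parseval[OF subspace_UNIV E(1), of "A v" v] by simp
  also have "\<dots> = (\<Sum>e\<in>E. (v \<bullet> e)\<^sup>2 * (A e \<bullet> e))"
  proof (rule sum.cong[OF refl])
    fix e assume "e \<in> E"
    have "A v \<bullet> e = v \<bullet> A e" by (rule sym)
    also have "\<dots> = (A e \<bullet> e) * (v \<bullet> e)" by (subst E(2)[OF \<open>e \<in> E\<close>]) simp
    finally show "(A v \<bullet> e) * (v \<bullet> e) = (v \<bullet> e)\<^sup>2 * (A e \<bullet> e)"
      by (simp add: power2_eq_square algebra_simps)
  qed
  finally show ?thesis .
qed

text \<open>Diagonal entries are averages of the eigenvalues with the doubly stochastic weights (b i
  . e)^2, as in Schur's theorem, and concavity makes averaging raise the sum.\<close>

lemma arctan_sum_le_frame: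
  assumes o: "onframe UNIV I b"
  shows "arctan_sum UNIV A \<le> (\<Sum>i\<in>I. arctan (A (b i) \<bullet> b i))"
proof -
  obtain E where E: "onframe UNIV E (\<lambda>x. x)" "\<And>e. e \<in> E \<Longrightarrow> A e = (A e \<bullet> e) *\<^sub>R e"
    "arctan_sum UNIV A = (\<Sum>e\<in>E. arctan (A e \<bullet> e))" using eigenframe by blast
  show ?thesis unfolding E(3)
  proof (rule arctan_sum_mono_weights[where c = "\<lambda>i e. (b i \<bullet> e)\<^sup>2"])
    show "finite E" "finite I" using E(1) o unfolding onframe_def by auto
    fix i assume i: "i \<in> I"
    have "b i \<bullet> b i = 1" using o i unfolding onframe_def by simp
    then show "(\<Sum>e\<in>E. (b i \<bullet> e)\<^sup>2) \<le> 1"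
      using onframe_parseval[OF subspace_UNIV E(1), of "b i" "b i"] by (simp add: power2_eq_square)
    show "(\<Sum>e\<in>E. (b i \<bullet> e)\<^sup>2 * (A e \<bullet> e)) \<le> A (b i) \<bullet> b i"
      by (subst quadratic_eigenframe[OF E(1,2), of "b i"]) simp_all
  next
    fix e assume e: "e \<in> E"
    have "e \<bullet> e = 1" using E(1) e unfolding onframe_def by simp
    then show "(\<Sum>i\<in>I. (b i \<bullet> e)\<^sup>2) = 1"
      using onframe_parseval[OF subspace_UNIV o, of e e] by (simp add: power2_eq_square inner_commute)
  qed (auto simp: psd)
qed

text \<open>Here the d i are averaged at the eigenvectors of A. The assumption at an eigenvector
  bounds the average by the eigenvalue plus \<epsilon>, and arctan, being 1-Lipschitz, pays at most
  \<epsilon> for each of them.\<close>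

lemma arctan_sum_ge_frame:
  assumes o: "onframe UNIV I b" and d: "\<And>i. i \<in> I \<Longrightarrow> d i \<ge> 0" and \<epsilon>: "\<epsilon> \<ge> 0"
    and le: "\<And>v. (\<Sum>i\<in>I. d i * (v \<bullet> b i)\<^sup>2) \<le> A v \<bullet> v + \<epsilon> * (v \<bullet> v)"
  shows "(\<Sum>i\<in>I. arctan (d i)) \<le> arctan_sum UNIV A + real DIM('a) * \<epsilon>"
proof -
  obtain E where E: "onframe UNIV E (\<lambda>x. x)" "\<And>e. e \<in> E \<Longrightarrow> A e = (A e \<bullet> e) *\<^sub>R e"
    "arctan_sum UNIV A = (\<Sum>e\<in>E. arctan (A e \<bullet> e))" using eigenframe by blast
  have "(\<Sum>i\<in>I. arctan (d i)) \<le> (\<Sum>e\<in>E. arctan (A e \<bullet> e + \<epsilon>))"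
  proof (rule arctan_sum_mono_weights[where c = "\<lambda>e i. (b i \<bullet> e)\<^sup>2"])
    show "finite E" "finite I" using E(1) o unfolding onframe_def by auto
    fix i assume i: "i \<in> I"
    have "b i \<bullet> b i = 1" using o i unfolding onframe_def by simp
    then show "(\<Sum>e\<in>E. (b i \<bullet> e)\<^sup>2) = 1"
      using onframe_parseval[OF subspace_UNIV E(1), of "b i" "b i"] by (simp add: power2_eq_square)
  next
    fix e assume e: "e \<in> E"
    have ee: "e \<bullet> e = 1" using E(1) e unfolding onframe_def by simp
    then show "(\<Sum>i\<in>I. (b i \<bullet> e)\<^sup>2) \<le> 1"
      using onframe_parseval[OF subspace_UNIV o, of e e] by (simp add: power2_eq_square inner_commute)
    show "(\<Sum>i\<in>I. (b i \<bullet> e)\<^sup>2 * d i) \<le> A e \<bullet> e + \<epsilon>"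
      using le[of e] ee by (simp add: inner_commute mult.commute)
  qed (auto simp: d)
  also have "\<dots> \<le> (\<Sum>e\<in>E. arctan (A e \<bullet> e) + \<epsilon>)"
    using \<epsilon> by (intro sum_mono arctan_add_le)
  also have "\<dots> = arctan_sum UNIV A + real DIM('a) * \<epsilon>"
    using E(1) unfolding E(3) onframe_def by (simp add: sum.distrib)
  finally show ?thesis .
qed

text \<open>An interlacing statement, proved without min-max. The family is only partial and A may
  mix it with its complement, so the squared coordinates are rescaled by the eigenvalue over \<mu>
  i; this makes each \<mu> i fully distributed. Indices with \<mu> i = 0 are dropped, because arctan
  0 = 0.\<close>

lemma arctan_sum_ge_compression:
  assumes J: "finite J"
    and o: "\<And>i j. i \<in> J \<Longrightarrow> j \<in> J \<Longrightarrow> b i \<bullet> b j = (if i = j then 1 else 0)"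
    and diag: "pairwise (\<lambda>i j. A (b i) \<bullet> b j = 0) J"
  shows "(\<Sum>i\<in>J. arctan (A (b i) \<bullet> b i)) \<le> arctan_sum UNIV A"
proof -
  obtain E where E: "onframe UNIV E (\<lambda>x. x)" "\<And>e. e \<in> E \<Longrightarrow> A e = (A e \<bullet> e) *\<^sub>R e"
    "arctan_sum UNIV A = (\<Sum>e\<in>E. arctan (A e \<bullet> e))" using eigenframe by blast
  define \<mu> where "\<mu> = (\<lambda>i. A (b i) \<bullet> b i)"
  define J' where "J' = {i\<in>J. \<mu> i \<noteq> 0}"
  have fJ': "finite J'" and J'J: "J' \<subseteq> J" unfolding J'_def using J by auto
  have \<mu>pos: "\<mu> i > 0" if "i \<in> J'" for i
    using that psd[of "b i"] unfolding J'_def \<mu>_def by (simp add: order_less_le)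
  have "(\<Sum>i\<in>J. arctan (\<mu> i)) = (\<Sum>i\<in>J'. arctan (\<mu> i))"
    unfolding J'_def using J by (intro sum.mono_neutral_right) auto
  also have "\<dots> \<le> (\<Sum>e\<in>E. arctan (A e \<bullet> e))"
  proof (rule arctan_sum_mono_weights[where c = "\<lambda>e i. (A e \<bullet> e) * (e \<bullet> b i)\<^sup>2 / \<mu> i"])
    show "finite E" using E(1) unfolding onframe_def by auto
    show "finite J'" by fact
    show "(A e \<bullet> e) * (e \<bullet> b i)\<^sup>2 / \<mu> i \<ge> 0" if "i \<in> J'" for e i
      using psd \<mu>pos[OF that] by auto
    show "\<mu> i \<ge> 0" if "i \<in> J'" for i using \<mu>pos[OF that] by simp
    show "(\<Sum>e\<in>E. (A e \<bullet> e) * (e \<bullet> b i)\<^sup>2 / \<mu> i) = 1" if "i \<in> J'" for i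
    proof -
      have "(\<Sum>e\<in>E. (A e \<bullet> e) * (e \<bullet> b i)\<^sup>2) = \<mu> i"
        unfolding \<mu>_def 
        by (subst quadratic_eigenframe[OF E(1,2), of "b i"], assumption, intro sum.cong)
          (auto simp: inner_commute mult.commute)
      then show ?thesis using \<mu>pos[OF that] by (simp flip: sum_divide_distrib)
    qed
    fix e assume e: "e \<in> E"
    have ee: "e \<bullet> e = 1" using E(1) e unfolding onframe_def by simp
    \<comment> \<open>v is the vector in the span of the b i with A v . b j = e . b j, so that A v .
      v and v . e both equal t. With \<lambda> = A e . e, Cauchy-Schwarz for A reads (\<lambda> t)^2
      \<le> \<lambda> t, which bounds the total weight \<lambda> t at e by 1.\<close>
    define v where "v = (\<Sum>i\<in>J'. ((e \<bullet> b i) / \<mu> i) *\<^sub>R b i)"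
    define t where "t = (\<Sum>i\<in>J'. (e \<bullet> b i)\<^sup>2 / \<mu> i)"
    have Avb: "A v \<bullet> b j = e \<bullet> b j" if "j \<in> J'" for j
    proof -
      have "A v \<bullet> b j = (\<Sum>i\<in>J'. ((e \<bullet> b i) / \<mu> i) * (A (b i) \<bullet> b j))"
        unfolding v_def by (simp add: linear_sum[OF lin] linear_scale[OF lin] inner_sum_left)
      also have "\<dots> = (\<Sum>i\<in>J'. if i = j then e \<bullet> b j else 0)"
        using pairwiseD[OF diag subsetD[OF J'J] subsetD[OF J'J that]] \<mu>pos[OF that]
          by (intro sum.cong) (auto simp: \<mu>_def)
      also have "\<dots> = e \<bullet> b j" using fJ' that by simp
      finally show ?thesis .
    qed
    have ve: "v \<bullet> e = t" unfolding v_def t_def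
      by (simp add: inner_sum_left power2_eq_square inner_commute[of "b _" e])
    have "A v \<bullet> v = (\<Sum>i\<in>J'. ((e \<bullet> b i) / \<mu> i) * (A v \<bullet> b i))"
      by (subst (2) v_def) (simp add: inner_sum_right)
    also have "\<dots> = t" unfolding t_def by (intro sum.cong) (auto simp: Avb power2_eq_square)
    finally have vv: "A v \<bullet> v = t" .
    have "A v \<bullet> e = (A e \<bullet> e) * t"
      using sym[of v e] E(2)[OF e] ve by (metis inner_scaleR_right)
    then have "((A e \<bullet> e) * t)\<^sup>2 \<le> t * (A e \<bullet> e)" using cauchy_schwarz[of v e] vv by simp
    then have "((A e \<bullet> e) * t) * ((A e \<bullet> e) * t) \<le> 1 * ((A e \<bullet> e) * t)"
      by (simp add: power2_eq_square algebra_simps)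
    moreover have "(A e \<bullet> e) * t \<ge> 0" using psd[of v] psd[of e] vv by simp
    ultimately have "(A e \<bullet> e) * t \<le> 1"
      by (metis mult_right_le_imp_le order_le_less zero_le_one)
    then show "(\<Sum>i\<in>J'. (A e \<bullet> e) * (e \<bullet> b i)\<^sup>2 / \<mu> i) \<le> 1"
      unfolding t_def sum_distrib_left by simp
    have bessel: "(\<Sum>i\<in>J'. (e \<bullet> b i)\<^sup>2) \<le> 1"
    proof -
      define r where "r = (\<Sum>i\<in>J'. (e \<bullet> b i) *\<^sub>R b i)"
      have rb: "r \<bullet> b j = e \<bullet> b j" if "j \<in> J'" for j
      proof -
        have "r \<bullet> b j = (\<Sum>i\<in>J'. if i = j then e \<bullet> b j else 0)"
          unfolding r_def inner_sum_left using o[OF subsetD[OF J'J] subsetD[OF J'J that]]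
          by (intro sum.cong) auto
        then show ?thesis using fJ' that by simp
      qed
      have "r \<bullet> r = (\<Sum>i\<in>J'. (e \<bullet> b i) * (r \<bullet> b i))"
        by (subst (2) r_def) (simp add: inner_sum_right)
      also have "\<dots> = (\<Sum>i\<in>J'. (e \<bullet> b i)\<^sup>2)" by (intro sum.cong) (auto simp: rb power2_eq_square)
      finally have rr: "r \<bullet> r = (\<Sum>i\<in>J'. (e \<bullet> b i)\<^sup>2)" .
      have "e \<bullet> r = (\<Sum>i\<in>J'. (e \<bullet> b i)\<^sup>2)"
        unfolding r_def by (simp add: inner_sum_right power2_eq_square)
      then have "(e - r) \<bullet> (e - r) = 1 - (\<Sum>i\<in>J'. (e \<bullet> b i)\<^sup>2)"
        using rr ee by (simp add: inner_diff_left inner_diff_right inner_commute)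
      then show ?thesis using inner_ge_zero[of "e - r"] by linarith
    qed
    have "(\<Sum>i\<in>J'. (A e \<bullet> e) * (e \<bullet> b i)\<^sup>2 / \<mu> i * \<mu> i) = (A e \<bullet> e) * (\<Sum>i\<in>J'. (e \<bullet> b i)\<^sup>2)"
      unfolding sum_distrib_left using \<mu>pos by (intro sum.cong) (force)+
    also have "\<dots> \<le> A e \<bullet> e" using bessel psd[of e] by (simp add: mult_left_le)
    finally show "(\<Sum>i\<in>J'. (A e \<bullet> e) * (e \<bullet> b i)\<^sup>2 / \<mu> i * \<mu> i) \<le> A e \<bullet> e" .
  qed
  finally show ?thesis unfolding E(3) \<mu>_def .
qed

text \<open>Cauchy-Schwarz for the form at v and A v converts a bound on the form into a bound on
  the norm.\<close>

lemma norm_le_of_quadratic_le: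
  assumes "\<And>v. A v \<bullet> v \<le> a * (v \<bullet> v)"
  shows "norm (A v) \<le> a * norm v"
proof (cases "A v = 0")
  case True
  have "0 \<le> a * (v \<bullet> v)" using assms[of v] psd[of v] by linarith
  then have "0 \<le> a * norm v * norm v" by (simp add: power2_norm_eq_inner[symmetric] power2_eq_square)
  then show ?thesis using True by (cases "v = 0") (auto simp: zero_le_mult_iff)
next
  case False
  have a: "a \<ge> 0"
  proof -
    have "0 \<le> a * (A v \<bullet> A v)" using assms[of "A v"] psd[of "A v"] by linarith
    moreover have "A v \<bullet> A v > 0" using False by simp
    ultimately show ?thesis by (metis mult_neg_pos not_le)
  qed
  have "(A v \<bullet> A v)\<^sup>2 \<le> (A v \<bullet> v) * (A (A v) \<bullet> A v)" by (rule cauchy_schwarz)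
  also have "\<dots> \<le> (a * (v \<bullet> v)) * (a * (A v \<bullet> A v))"
    using assms psd a by (intro mult_mono) auto
  finally have "(A v \<bullet> A v) * (A v \<bullet> A v) \<le> (a\<^sup>2 * (v \<bullet> v)) * (A v \<bullet> A v)"
    by (simp add: power2_eq_square algebra_simps)
  moreover have "A v \<bullet> A v > 0" using False by simp
  ultimately have "A v \<bullet> A v \<le> a\<^sup>2 * (v \<bullet> v)" by (rule mult_right_le_imp_le)
  then have "(norm (A v))\<^sup>2 \<le> (a * norm v)\<^sup>2" by (simp add: power2_norm_eq_inner power_mult_distrib)
  then show ?thesis using a by (simp add: power2_le_iff_abs_le)
qed

lemma quadratic_add_le: "A (x + y) \<bullet> (x + y) \<le> 2 * (A x \<bullet> x) + 2 * (A y \<bullet> y)"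
proof -
  have "0 \<le> A (x - y) \<bullet> (x - y)" by (rule psd)
  then show ?thesis
    by (simp add: linear_add[OF lin] linear_diff[OF lin] inner_add_left inner_add_right
        inner_diff_left inner_diff_right)
qed

text \<open>B is estimated in the eigenframe of A. Used in both directions this gives continuity of
  the sum, although eigenvectors may jump.\<close>

lemma arctan_sum_perturb:
  assumes "psd_operator B" and "\<And>v. norm v = 1 \<Longrightarrow> B v \<bullet> v \<le> A v \<bullet> v + r" and "r \<ge> 0"
  shows "arctan_sum UNIV B \<le> arctan_sum UNIV A + real DIM('a) * r"
proof -
  obtain E where E: "onframe UNIV E (\<lambda>x. x)" "\<And>e. e \<in> E \<Longrightarrow> A e = (A e \<bullet> e) *\<^sub>R e"
    "arctan_sum UNIV A = (\<Sum>e\<in>E. arctan (A e \<bullet> e))" using eigenframe by blast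
  have "arctan_sum UNIV B \<le> (\<Sum>e\<in>E. arctan (B e \<bullet> e))"
    using psd_operator.arctan_sum_le_frame[OF assms(1) E(1)] .
  also have "\<dots> \<le> (\<Sum>e\<in>E. arctan (A e \<bullet> e) + r)"
  proof (rule sum_mono)
    fix e assume "e \<in> E"
    then have "norm e = 1" using E(1) unfolding onframe_def by (simp add: norm_eq_1)
    then have "arctan (B e \<bullet> e) \<le> arctan (A e \<bullet> e + r)" using assms(2) by (simp add: arctan_monotone')
    also have "\<dots> \<le> arctan (A e \<bullet> e) + r" using assms(3) by (rule arctan_add_le)
    finally show "arctan (B e \<bullet> e) \<le> arctan (A e \<bullet> e) + r" .
  qed
  also have "\<dots> = arctan_sum UNIV A + real DIM('a) * r"
    using E(1) unfolding E(3) onframe_def by (simp add: sum.distrib)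
  finally show ?thesis .
qed

end

section \<open>The graph metric and its square roots\<close>

text \<open>The square of the root is prescribed only on the image of V under L, so L is first shown
  to map V onto V. For D = R - S, equality of the squares reads R D + D S = 0; on an eigenvector of
  D this says that its eigenvalue times a positive number is 0.\<close>

lemma inv_sqrt_on_unique:
  fixes L :: "'a::euclidean_space \<Rightarrow> 'a"
  assumes V: "subspace V" and L: "linear L" "\<And>x. x \<in> V \<Longrightarrow> L x \<in> V"
    and R: "linear R" "R ` V \<subseteq> V" "\<forall>x\<in>V. \<forall>y\<in>V. R x \<bullet> y = x \<bullet> R y" "\<forall>x\<in>V. x \<noteq> 0 \<longrightarrow> R x \<bullet> x > 0"
      "\<forall>x\<in>V. R (R (L x)) = x" "\<forall>x\<in>orthogonal_comp V. R x = 0"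
    and S: "linear S" "S ` V \<subseteq> V" "\<forall>x\<in>V. \<forall>y\<in>V. S x \<bullet> y = x \<bullet> S y" "\<forall>x\<in>V. x \<noteq> 0 \<longrightarrow> S x \<bullet> x > 0"
      "\<forall>x\<in>V. S (S (L x)) = x" "\<forall>x\<in>orthogonal_comp V. S x = 0"
  shows "R = S"
proof -
  have "inj_on L V" by (rule inj_onI) (metis R(5))
  then have "dim (L ` V) = dim V" using dim_image_eq[OF L(1)] V by (simp add: span_eq_iff[THEN iffD2])
  then have LV: "L ` V = V"
    using subspace_dim_equal[of "L ` V" V] V L linear_subspace_image by fastforce
  have sq: "R (R y) = S (S y)" if "y \<in> V" for y
  proof -
    have "y \<in> L ` V" unfolding LV by (rule that)
    then obtain x where x: "x \<in> V" "y = L x" by blast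
    show ?thesis unfolding x(2) using bspec[OF R(5) x(1)] bspec[OF S(5) x(1)] by simp
  qed
  define D where "D = (\<lambda>x. R x - S x)"
  have Dlin: "linear D" unfolding D_def using R(1) S(1) by (rule linear_compose_sub)
  have DV: "D x \<in> V" if "x \<in> V" for x
    unfolding D_def using that R(2) S(2) by (intro subspace_diff[OF V]) auto
  have Dsym: "D x \<bullet> y = x \<bullet> D y" if "x \<in> V" "y \<in> V" for x y
    using that R(3) S(3) unfolding D_def by (simp add: inner_diff_left inner_diff_right)
  obtain E :: "'a set" where E: "onframe V E (\<lambda>x. x)" "\<forall>e\<in>E. D e = (D e \<bullet> e) *\<^sub>R e"
    using symmetric_eigenframe[OF Dlin V DV Dsym] by blast
  have De: "D e = 0" if e: "e \<in> E" for e
  proof -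
    have eV: "e \<in> V" and "e \<bullet> e = 1" using E(1) e unfolding onframe_def by auto
    then have e0: "e \<noteq> 0" by auto
    define l where "l = D e \<bullet> e"
    have l: "D e = l *\<^sub>R e" using E(2) e unfolding l_def by blast
    have "R (D e) + D (S e) = 0"
      using sq[OF eV] unfolding D_def by (simp add: linear_diff[OF R(1)])
    then have "0 = (R (D e) + D (S e)) \<bullet> e" by simp
    also have "\<dots> = l * (R e \<bullet> e) + S e \<bullet> D e"
      using Dsym[of "S e" e] S(2) eV by (auto simp: l linear_scale[OF R(1)] inner_add_left)
    also have "\<dots> = l * (R e \<bullet> e + S e \<bullet> e)" unfolding l by (simp add: algebra_simps)
    finally have "l * (R e \<bullet> e + S e \<bullet> e) = 0" by simp
    moreover have "R e \<bullet> e + S e \<bullet> e > 0" using R(4) S(4) eV e0 by (simp add: add_pos_pos)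
    ultimately show "D e = 0" using l by simp
  qed
  have DV0: "D x = 0" if "x \<in> V" for x
  proof -
    have "D x = D (\<Sum>e\<in>E. (x \<bullet> e) *\<^sub>R e)" using onframe_expand[OF V E(1) that] by simp
    also have "\<dots> = 0" by (simp add: linear_sum[OF Dlin] linear_scale[OF Dlin] De)
    finally show ?thesis .
  qed
  show "R = S"
  proof
    fix x
    obtain y z where yz: "y \<in> span V" "\<And>w. w \<in> span V \<Longrightarrow> orthogonal z w" "x = y + z"
      using orthogonal_subspace_decomp_exists by blast
    have "z \<in> orthogonal_comp V" using yz(2) unfolding orthogonal_comp_def by (auto simp: orthogonal_commute span_base)
    then have "R z = S z" using R(6) S(6) by simp
    moreover have "R y = S y" using DV0[of y] yz(1) V unfolding D_def by (simp add: span_eq_iff[THEN iffD2])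
    ultimately show "R x = S x" using yz(3) by (simp add: linear_add[OF R(1)] linear_add[OF S(1)])
  qed
qed

lemma inv_sqrt_on_eq:
  fixes L :: "'a::euclidean_space \<Rightarrow> 'a"
  assumes "subspace V" "linear L" "\<And>x. x \<in> V \<Longrightarrow> L x \<in> V"
    and "linear R" "R ` V \<subseteq> V" "\<forall>x\<in>V. \<forall>y\<in>V. R x \<bullet> y = x \<bullet> R y" "\<forall>x\<in>V. x \<noteq> 0 \<longrightarrow> R x \<bullet> x > 0"
      "\<forall>x\<in>V. R (R (L x)) = x" "\<forall>x\<in>orthogonal_comp V. R x = 0"
  shows "inv_sqrt_on V L = R"
  unfolding inv_sqrt_on_def
proof (rule the_equality)
  show "linear R \<and> R ` V \<subseteq> V \<and> (\<forall>x\<in>V. \<forall>y\<in>V. R x \<bullet> y = x \<bullet> R y) \<and>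
             (\<forall>x\<in>V. x \<noteq> 0 \<longrightarrow> R x \<bullet> x > 0) \<and> (\<forall>x\<in>V. R (R (L x)) = x) \<and>
             (\<forall>x\<in>orthogonal_comp V. R x = 0)"
    using assms by blast
  fix S
  assume "linear S \<and> S ` V \<subseteq> V \<and> (\<forall>x\<in>V. \<forall>y\<in>V. S x \<bullet> y = x \<bullet> S y) \<and>
             (\<forall>x\<in>V. x \<noteq> 0 \<longrightarrow> S x \<bullet> x > 0) \<and> (\<forall>x\<in>V. S (S (L x)) = x) \<and>
             (\<forall>x\<in>orthogonal_comp V. S x = 0)"
  then show "S = R" using inv_sqrt_on_unique[OF assms(1-3), of S R] assms(4-) by blast
qed

definition slope :: "'a::euclidean_space \<Rightarrow> real" where
  "slope p = sqrt (1 + (norm p)\<^sup>2)"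

definition graph_metric :: "'a::euclidean_space \<Rightarrow> 'a \<Rightarrow> 'a \<Rightarrow> real" where
  "graph_metric p v w = v \<bullet> w + (p \<bullet> v) * (p \<bullet> w)"

text \<open>The positive root of I + p \<otimes> p is the identity orthogonally to p and multiplies
  p by its slope w. The coefficient (w - 1) / |p|^2 is written as 1 / (1 + w), which is also valid
  at p = 0. Likewise the coefficient in \<open>metric_inv_sqrt\<close> is (1 - 1 / w) /
  |p|^2.\<close>

definition metric_sqrt :: "'a::euclidean_space \<Rightarrow> 'a \<Rightarrow> 'a" where
  "metric_sqrt p v = v + ((p \<bullet> v) / (1 + slope p)) *\<^sub>R p"

definition metric_inv_sqrt :: "'a::euclidean_space \<Rightarrow> 'a \<Rightarrow> 'a" where
  "metric_inv_sqrt p v = v - ((p \<bullet> v) / (slope p * (1 + slope p))) *\<^sub>R p"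

lemma slope_ge_1: "slope p \<ge> 1" unfolding slope_def by simp
lemma slope_pos: "slope p > 0" using slope_ge_1[of p] by linarith
lemma slope_sq: "(slope p)\<^sup>2 = 1 + p \<bullet> p" unfolding slope_def by (simp add: power2_norm_eq_inner)
lemma slope_le: "slope p \<le> 1 + norm p"
  using sqrt_sum_squares_le_sum_abs[of 1 "norm p"] unfolding slope_def by simp
lemma inner_self_slope: "p \<bullet> p = (slope p - 1) * (slope p + 1)"
  using slope_sq[of p] by (simp add: algebra_simps power2_eq_square)

lemma linear_metric_inv_sqrt: "linear (metric_inv_sqrt p)"
  unfolding metric_inv_sqrt_def
  by (intro linearI) (auto simp: inner_add_right algebra_simps add_divide_distrib)

lemma metric_inv_sqrt_sym: "metric_inv_sqrt p v \<bullet> w = v \<bullet> metric_inv_sqrt p w"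
  unfolding metric_inv_sqrt_def by (simp add: inner_diff_left inner_diff_right inner_commute)

lemma inner_metric_inv_sqrt: "p \<bullet> metric_inv_sqrt p v = (p \<bullet> v) / slope p"
proof -
  have "1 + slope p \<noteq> 0" "slope p \<noteq> 0" using slope_pos[of p] by linarith+
  then have "(slope p - 1) * (slope p + 1) / (slope p * (1 + slope p)) = 1 - 1 / slope p"
    by (simp add: divide_simps)
  then have "p \<bullet> v / (slope p * (1 + slope p)) * ((slope p - 1) * (slope p + 1)) = (p \<bullet> v) * (1 - 1 / slope p)"
    by (metis times_divide_eq_left times_divide_eq_right)
  then show ?thesis unfolding metric_inv_sqrt_def inner_diff_right inner_scaleR_right inner_self_slope
    by (simp add: algebra_simps)
qed

lemma inner_metric_sqrt: "p \<bullet> metric_sqrt p v = (p \<bullet> v) * slope p"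
proof -
  have "1 + slope p \<noteq> 0" using slope_pos[of p] by linarith
  then show ?thesis unfolding metric_sqrt_def inner_add_right inner_scaleR_right inner_self_slope
    by (simp add: field_simps)
qed

lemma metric_sqrt_inverse: "metric_sqrt p (metric_inv_sqrt p v) = v"
proof -
  have "1 + slope p \<noteq> 0" "slope p \<noteq> 0" using slope_pos[of p] by linarith+
  then show ?thesis
    unfolding metric_sqrt_def inner_metric_inv_sqrt unfolding metric_inv_sqrt_def
    by (simp add: field_simps)
qed

lemma metric_inv_sqrt_inverse: "metric_inv_sqrt p (metric_sqrt p v) = v"
proof -
  have "1 + slope p \<noteq> 0" "slope p \<noteq> 0" using slope_pos[of p] by linarith+
  then show ?thesis
    unfolding metric_inv_sqrt_def inner_metric_sqrt unfolding metric_sqrt_def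
    by simp
qed

lemma inner_metric_sqrt_metric_sqrt: "metric_sqrt p v \<bullet> metric_sqrt p w = graph_metric p v w"
proof -
  have s: "1 + slope p \<noteq> 0" using slope_pos[of p] by linarith
  have "metric_sqrt p v \<bullet> metric_sqrt p w
      = v \<bullet> w + (p \<bullet> v) * (p \<bullet> w) * (2 / (1 + slope p) + (p \<bullet> p) / (1 + slope p)\<^sup>2)"
    unfolding metric_sqrt_def
    by (simp add: inner_add_left inner_add_right inner_commute power2_eq_square algebra_simps)
  also have "2 / (1 + slope p) + (p \<bullet> p) / (1 + slope p)\<^sup>2 = 1"
    unfolding inner_self_slope using s
    by (simp add: divide_simps) (simp add: algebra_simps power2_eq_square)
  finally show ?thesis unfolding graph_metric_def by simp
qed

lemma graph_metric_metric_inv_sqrt: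
  "graph_metric p (metric_inv_sqrt p v) (metric_inv_sqrt p w) = v \<bullet> w"
  by (simp flip: inner_metric_sqrt_metric_sqrt add: metric_sqrt_inverse)

lemma graph_metric_ge: "v \<bullet> v \<le> graph_metric p v v"
  unfolding graph_metric_def by simp

lemma graph_metric_le: "graph_metric p v v \<le> (slope p)\<^sup>2 * (v \<bullet> v)"
proof -
  have "(p \<bullet> v) * (p \<bullet> v) \<le> (p \<bullet> p) * (v \<bullet> v)"
    using Cauchy_Schwarz_ineq[of p v] by (simp add: power2_eq_square)
  then show ?thesis unfolding graph_metric_def slope_sq by (simp add: algebra_simps)
qed

lemma norm_metric_inv_sqrt_le: "norm (metric_inv_sqrt p v) \<le> norm v"
proof -
  have "(norm (metric_inv_sqrt p v))\<^sup>2 \<le> (norm v)\<^sup>2"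
    using graph_metric_ge[of "metric_inv_sqrt p v" p]
    by (simp add: graph_metric_metric_inv_sqrt power2_norm_eq_inner)
  then show ?thesis by (simp add: power2_le_iff_abs_le)
qed

text \<open>One formula serves the curvature operator (the whole space, c = 1) and the boundary
  operator (the tangent space, c the slope). P realises the extension by 0 off V.\<close>

lemma inv_sqrt_on_rank_one:
  fixes q :: "'a::euclidean_space"
  assumes V: "subspace V" and q: "q \<in> V" and c: "c > 0"
    and P: "linear P" "\<And>v. P v \<in> V" "\<And>v. v \<in> V \<Longrightarrow> P v = v" "\<And>v. v \<in> orthogonal_comp V \<Longrightarrow> P v = 0"
  shows "inv_sqrt_on V (\<lambda>v. c *\<^sub>R (v + (q \<bullet> v) *\<^sub>R q)) = (\<lambda>v. (1 / sqrt c) *\<^sub>R metric_inv_sqrt q (P v))"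
proof (rule inv_sqrt_on_eq[OF V])
  let ?R = "\<lambda>v. (1 / sqrt c) *\<^sub>R metric_inv_sqrt q (P v)"
  show "linear (\<lambda>v. c *\<^sub>R (v + (q \<bullet> v) *\<^sub>R q))"
    by (intro linearI) (auto simp: inner_add_right algebra_simps)
  show "c *\<^sub>R (x + (q \<bullet> x) *\<^sub>R q) \<in> V" if "x \<in> V" for x
    using V q that by (intro subspace_scale subspace_add) auto
  have ml: "linear (metric_inv_sqrt q)" by (rule linear_metric_inv_sqrt)
  show "linear ?R"
    by (intro linearI) (auto simp: linear_add[OF P(1)] linear_scale[OF P(1)] linear_add[OF ml]
        linear_scale[OF ml] algebra_simps)
  have mV: "metric_inv_sqrt q x \<in> V" if "x \<in> V" for x
    unfolding metric_inv_sqrt_def using V q that by (intro subspace_scale subspace_diff) auto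
  then show "?R ` V \<subseteq> V" using P(2) V by (auto intro: subspace_scale)
  show "\<forall>x\<in>V. \<forall>y\<in>V. ?R x \<bullet> y = x \<bullet> ?R y" by (simp add: P(3) metric_inv_sqrt_sym)
  show "\<forall>x\<in>V. x \<noteq> 0 \<longrightarrow> ?R x \<bullet> x > 0"
  proof (intro ballI impI)
    fix x assume x: "x \<in> V" "x \<noteq> 0"
    define y where "y = metric_inv_sqrt q x"
    have xy: "x = metric_sqrt q y" unfolding y_def by (simp add: metric_sqrt_inverse)
    have "y \<noteq> 0" using x(2) xy by (auto simp: metric_sqrt_def)
    moreover have "y \<bullet> metric_sqrt q y = y \<bullet> y + (q \<bullet> y)\<^sup>2 / (1 + slope q)"
      unfolding metric_sqrt_def by (simp add: inner_add_right power2_eq_square inner_commute)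
    moreover have "1 + slope q > 0" using slope_pos[of q] by linarith
    ultimately have "y \<bullet> x > 0" unfolding xy by (simp add: add_pos_nonneg)
    then show "?R x \<bullet> x > 0" using c x(1) unfolding y_def by (simp add: P(3))
  qed
  show "\<forall>x\<in>V. ?R (?R (c *\<^sub>R (x + (q \<bullet> x) *\<^sub>R q))) = x"
  proof
    fix x assume x: "x \<in> V"
    let ?y = "x + (q \<bullet> x) *\<^sub>R q"
    have yV: "?y \<in> V" using V q x by (intro subspace_scale subspace_add) auto
    have s: "slope q * (1 + slope q) \<noteq> 0" "slope q \<noteq> 0" "1 + slope q \<noteq> 0"
      using slope_pos[of q] by (auto simp: add_pos_pos[THEN less_imp_neq, THEN not_sym])
    have "metric_sqrt q (metric_sqrt q x) = ?y"
    proof -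
      have "metric_sqrt q (metric_sqrt q x)
          = x + ((q \<bullet> x) * (1 / (1 + slope q) + slope q / (1 + slope q))) *\<^sub>R q"
        unfolding metric_sqrt_def[of q "metric_sqrt q x"] inner_metric_sqrt
        unfolding metric_sqrt_def by (simp add: algebra_simps)
      also have "1 / (1 + slope q) + slope q / (1 + slope q) = 1" using s by (simp flip: add_divide_distrib)
      finally show ?thesis by simp
    qed
    then have my: "metric_inv_sqrt q (metric_inv_sqrt q ?y) = x"
      by (metis metric_inv_sqrt_inverse)
    have "P (c *\<^sub>R ?y) = c *\<^sub>R ?y" using P(3) yV V by (simp add: subspace_scale)
    moreover have "P (metric_inv_sqrt q ?y) = metric_inv_sqrt q ?y" using P(3) mV yV by blast
    ultimately have "?R (?R (c *\<^sub>R ?y)) = ((1 / sqrt c) * (1 / sqrt c) * c) *\<^sub>R metric_inv_sqrt q (metric_inv_sqrt q ?y)"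
      by (simp only: linear_scale[OF P(1)] linear_scale[OF ml] scaleR_scaleR mult.assoc)
    also have "(1 / sqrt c) * (1 / sqrt c) * c = 1" using c by simp
    finally show "?R (?R (c *\<^sub>R ?y)) = x" using my by simp
  qed
  show "\<forall>x\<in>orthogonal_comp V. ?R x = 0" using P(4) by (simp add: linear_0[OF ml])
qed

definition graph_curv :: "'a::euclidean_space \<Rightarrow> ('a \<Rightarrow> 'a) \<Rightarrow> 'a \<Rightarrow> 'a" where
  "graph_curv p H v = (1 / slope p) *\<^sub>R metric_inv_sqrt p (H (metric_inv_sqrt p v))"

lemma curv_op_eq:
  "curv_op \<Omega> u x = graph_curv (grad_on (closure \<Omega>) u x) (hess_on (closure \<Omega>) u x)"
proof -
  have "inv_sqrt_on UNIV (\<lambda>v. v + (p \<bullet> v) *\<^sub>R p) = metric_inv_sqrt p" for p :: 'a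
    using inv_sqrt_on_rank_one[of UNIV p 1 "\<lambda>v. v"] by (simp add: linear_id[unfolded id_def])
  then show ?thesis unfolding curv_op_def graph_curv_def slope_def Let_def by simp
qed

text \<open>Frames orthonormal for the graph metric become orthonormal frames in which the curvature
  operator has the entries D^2u(f i, f j) / w. The matrix roots therefore never have to be
  differentiated.\<close>

lemma graph_curv_metric_sqrt:
  "graph_curv p H (metric_sqrt p v) \<bullet> metric_sqrt p w = (H v \<bullet> w) / slope p"
  unfolding graph_curv_def
  by (simp add: metric_inv_sqrt_inverse metric_inv_sqrt_sym)

lemma psd_operator_graph_curv:
  assumes "psd_operator H"
  shows "psd_operator (graph_curv p H)"
proof -
  interpret H: psd_operator H by (rule assms)
  have ml: "linear (metric_inv_sqrt p)" by (rule linear_metric_inv_sqrt)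
  show ?thesis
  proof (rule psd_operator.intro)
    show "linear (graph_curv p H)" unfolding graph_curv_def
      by (intro linearI) (auto simp: linear_add[OF ml] linear_scale[OF ml] linear_add[OF H.lin]
          linear_scale[OF H.lin] algebra_simps)
    fix x y
    show "graph_curv p H x \<bullet> y = x \<bullet> graph_curv p H y"
      unfolding graph_curv_def by (simp add: metric_inv_sqrt_sym H.sym)
    show "graph_curv p H x \<bullet> x \<ge> 0"
      unfolding graph_curv_def using H.psd slope_pos[of p]
      by (simp add: metric_inv_sqrt_sym less_imp_le)
  qed
qed

lemma onframe_metric_sqrt:
  assumes "finite I" "card I = DIM('a)"
    "\<And>i j. i \<in> I \<Longrightarrow> j \<in> I \<Longrightarrow> graph_metric p (f i) (f j) = (if i = j then 1 else 0)"
  shows "onframe (UNIV :: 'a::euclidean_space set) I (\<lambda>i. metric_sqrt p (f i))"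
  using assms unfolding onframe_def by (simp add: inner_metric_sqrt_metric_sqrt)

section \<open>Second-order jets and smooth functions\<close>

text \<open>The first derivative is required near 0, the second only at 0. As a relation carrying
  all three coefficients it turns the calculus rules into a symbolic computation of second
  derivatives.\<close>

definition jet2 :: "(real \<Rightarrow> real) \<Rightarrow> real \<Rightarrow> real \<Rightarrow> real \<Rightarrow> bool" where
  "jet2 \<phi> a b c \<longleftrightarrow> (\<exists>\<phi>'. (\<forall>\<^sub>F t in nhds 0. (\<phi> has_real_derivative \<phi>' t) (at t)) \<and>
     \<phi> 0 = a \<and> \<phi>' 0 = b \<and> (\<phi>' has_real_derivative c) (at 0))"

lemma jet2_value: "jet2 \<phi> a b c \<Longrightarrow> \<phi> 0 = a"
  unfolding jet2_def by blast

lemma jet2_deriv: "jet2 \<phi> a b c \<Longrightarrow> (\<phi> has_real_derivative b) (at 0)"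
  unfolding jet2_def by (metis eventually_nhds_x_imp_x)

lemma jet2_const: "jet2 (\<lambda>t. k) k 0 0"
  unfolding jet2_def by (rule exI[of _ "\<lambda>t. 0"]) auto

lemma jet2_add:
  assumes "jet2 \<phi> a b c" "jet2 \<psi> a' b' c'"
  shows "jet2 (\<lambda>t. \<phi> t + \<psi> t) (a + a') (b + b') (c + c')"
proof -
  obtain f where f: "\<forall>\<^sub>F t in nhds 0. (\<phi> has_real_derivative f t) (at t)" "\<phi> 0 = a" "f 0 = b"
    "(f has_real_derivative c) (at 0)" using assms(1) unfolding jet2_def by blast
  obtain g where g: "\<forall>\<^sub>F t in nhds 0. (\<psi> has_real_derivative g t) (at t)" "\<psi> 0 = a'" "g 0 = b'"
    "(g has_real_derivative c') (at 0)" using assms(2) unfolding jet2_def by blast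
  have "\<forall>\<^sub>F t in nhds 0. ((\<lambda>t. \<phi> t + \<psi> t) has_real_derivative f t + g t) (at t)"
    using f(1) g(1) by eventually_elim (rule DERIV_add)
  then show ?thesis unfolding jet2_def using f g
    by (intro exI[of _ "\<lambda>t. f t + g t"]) (auto intro: DERIV_add)
qed

lemma jet2_mult:
  assumes "jet2 \<phi> a b c" "jet2 \<psi> a' b' c'"
  shows "jet2 (\<lambda>t. \<phi> t * \<psi> t) (a * a') (a * b' + b * a') (a * c' + 2 * b * b' + c * a')"
proof -
  obtain f where f: "\<forall>\<^sub>F t in nhds 0. (\<phi> has_real_derivative f t) (at t)" "\<phi> 0 = a" "f 0 = b"
    "(f has_real_derivative c) (at 0)" using assms(1) unfolding jet2_def by blast
  obtain g where g: "\<forall>\<^sub>F t in nhds 0. (\<psi> has_real_derivative g t) (at t)" "\<psi> 0 = a'" "g 0 = b'"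
    "(g has_real_derivative c') (at 0)" using assms(2) unfolding jet2_def by blast
  have "\<forall>\<^sub>F t in nhds 0. ((\<lambda>t. \<phi> t * \<psi> t) has_real_derivative \<phi> t * g t + f t * \<psi> t) (at t)"
    using f(1) g(1) by eventually_elim (auto intro!: derivative_eq_intros)
  moreover have "(\<phi> has_real_derivative b) (at 0)" "(\<psi> has_real_derivative b') (at 0)"
    using assms by (auto dest: jet2_deriv)
  then have "((\<lambda>t. \<phi> t * g t + f t * \<psi> t) has_real_derivative a * c' + 2 * b * b' + c * a') (at 0)"
    using f(2-4) g(2-4) by (auto intro!: derivative_eq_intros)
  ultimately show ?thesis unfolding jet2_def using f g
    by (intro exI[of _ "\<lambda>t. \<phi> t * g t + f t * \<psi> t"]) auto
qed

lemma jet2_cong: "jet2 \<phi> a b c \<Longrightarrow> a = a' \<Longrightarrow> b = b' \<Longrightarrow> c = c' \<Longrightarrow> jet2 \<phi> a' b' c'"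
  by simp

lemma jet2_cmult: "jet2 \<phi> a b c \<Longrightarrow> jet2 (\<lambda>t. k * \<phi> t) (k * a) (k * b) (k * c)"
  by (rule jet2_cong[OF jet2_mult[OF jet2_const]]) auto

lemma jet2_sum:
  assumes "\<And>i. i \<in> I \<Longrightarrow> jet2 (\<phi> i) (a i) (b i) (c i)"
  shows "jet2 (\<lambda>t. \<Sum>i\<in>I. \<phi> i t) (sum a I) (sum b I) (sum c I)"
proof (cases "finite I")
  case True
  then show ?thesis using assms
    by (induction I rule: finite_induct) (auto intro: jet2_const[of 0] jet2_add)
qed (auto intro: jet2_const)

lemma jet2_compose:
  assumes "jet2 \<phi> a b c"
    and G: "\<forall>\<^sub>F x in nhds a. (G has_real_derivative G' x) (at x)" "(G' has_real_derivative d) (at a)"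
  shows "jet2 (\<lambda>t. G (\<phi> t)) (G a) (G' a * b) (d * b\<^sup>2 + G' a * c)"
proof -
  obtain f where f: "\<forall>\<^sub>F t in nhds 0. (\<phi> has_real_derivative f t) (at t)" "\<phi> 0 = a" "f 0 = b"
    "(f has_real_derivative c) (at 0)" using assms(1) unfolding jet2_def by blast
  have \<phi>0: "(\<phi> has_real_derivative b) (at 0)" using assms(1) by (rule jet2_deriv)
  have "\<phi> \<midarrow>0\<rightarrow> a" using DERIV_isCont[OF \<phi>0] f(2) by (simp add: isCont_def)
  then have "filterlim \<phi> (nhds a) (nhds 0)" using f(2) tendsto_at_iff_tendsto_nhds by blast
  then have "\<forall>\<^sub>F t in nhds 0. (G has_real_derivative G' (\<phi> t)) (at (\<phi> t))"
    using G(1) unfolding filterlim_iff by blast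
  then have "\<forall>\<^sub>F t in nhds 0. ((\<lambda>t. G (\<phi> t)) has_real_derivative G' (\<phi> t) * f t) (at t)"
    using f(1) by eventually_elim (rule DERIV_chain2)
  moreover have "((\<lambda>t. G' (\<phi> t) * f t) has_real_derivative d * b\<^sup>2 + G' a * c) (at 0)"
  proof -
    have "((\<lambda>t. G' (\<phi> t)) has_real_derivative d * b) (at 0)"
      using DERIV_chain2[of G' d \<phi> 0] G(2) f(2) \<phi>0 by simp
    from DERIV_mult[OF this f(4)] show ?thesis using f(2,3)
      by (simp add: power2_eq_square algebra_simps)
  qed
  ultimately show ?thesis unfolding jet2_def using f
    by (intro exI[of _ "\<lambda>t. G' (\<phi> t) * f t"]) auto
qed

lemma jet2_inverse:
  assumes "jet2 \<phi> a b c" "a \<noteq> 0"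
  shows "jet2 (\<lambda>t. inverse (\<phi> t)) (inverse a) (- inverse (a\<^sup>2) * b) (2 * inverse (a ^ 3) * b\<^sup>2 - inverse (a\<^sup>2) * c)"
proof -
  have "\<forall>\<^sub>F x in nhds a. x \<noteq> 0" using assms(2) by (metis t1_space_nhds)
  then have "\<forall>\<^sub>F x in nhds a. (inverse has_real_derivative - inverse (x\<^sup>2)) (at x)"
    by eventually_elim (auto intro!: derivative_eq_intros simp: power2_eq_square)
  moreover have "((\<lambda>x. - inverse (x\<^sup>2)) has_real_derivative 2 * inverse (a ^ 3)) (at a)"
    using assms(2) by (auto intro!: derivative_eq_intros simp: field_simps power2_eq_square power3_eq_cube)
  ultimately show ?thesis using jet2_compose[OF assms(1)] by fastforce
qed

lemma jet2_sqrt: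
  assumes "jet2 \<phi> a b c" "a > 0"
  shows "jet2 (\<lambda>t. sqrt (\<phi> t)) (sqrt a) (b / (2 * sqrt a)) (c / (2 * sqrt a) - b\<^sup>2 / (4 * sqrt a ^ 3))"
proof -
  have "\<forall>\<^sub>F x in nhds a. x > 0" using assms(2) eventually_nhds_in_open[of "{0<..}" a] by simp
  then have "\<forall>\<^sub>F x in nhds a. (sqrt has_real_derivative inverse (2 * sqrt x)) (at x)"
    by eventually_elim (auto intro!: derivative_eq_intros simp: field_simps)
  moreover have "((\<lambda>x. inverse (2 * sqrt x)) has_real_derivative - 1 / (4 * sqrt a ^ 3)) (at a)"
    using assms(2) by (auto intro!: derivative_eq_intros simp: field_simps power2_eq_square power3_eq_cube)
  ultimately have "jet2 (\<lambda>t. sqrt (\<phi> t)) (sqrt a) (inverse (2 * sqrt a) * b)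
      (- 1 / (4 * sqrt a ^ 3) * b\<^sup>2 + inverse (2 * sqrt a) * c)"
    using jet2_compose[OF assms(1)] by fastforce
  then show ?thesis by (rule jet2_cong) (auto simp: field_simps)
qed

text \<open>With a second derivative at 0 only, monotonicity replaces Taylor's formula: if b = 0 and
  c < 0, the first derivative is negative just to the right of 0, and the mean value theorem takes
  \<phi> below a.\<close>

lemma jet2_local_min:
  assumes j: "jet2 \<phi> a b c" and min: "\<forall>\<^sub>F t in nhds 0. a \<le> \<phi> t"
  shows "b = 0" and "c \<ge> 0"
proof -
  obtain f where f: "\<forall>\<^sub>F t in nhds 0. (\<phi> has_real_derivative f t) (at t)" "\<phi> 0 = a" "f 0 = b"
    "(f has_real_derivative c) (at 0)" using j unfolding jet2_def by blast
  obtain d where d: "d > 0" "\<And>t. \<bar>t\<bar> < d \<Longrightarrow> a \<le> \<phi> t \<and> (\<phi> has_real_derivative f t) (at t)"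
    using eventually_conj[OF min f(1)] unfolding eventually_nhds_metric by (auto simp: dist_real_def)
  show b: "b = 0"
    by (rule DERIV_local_min[OF jet2_deriv[OF j] d(1)]) (use d f(2) in auto)
  show "c \<ge> 0"
  proof (rule ccontr)
    assume "\<not> c \<ge> 0"
    then obtain r where r: "r > 0" "\<And>h. 0 < h \<Longrightarrow> h < r \<Longrightarrow> f (0 + h) < f 0"
      using DERIV_neg_dec_right[OF f(4)] by auto
    define t where "t = min d r / 2"
    have t: "0 < t" "t < d" "t < r" using d(1) r(1) unfolding t_def by auto
    obtain z where z: "0 < z" "z < t" "\<phi> t - \<phi> 0 = (t - 0) * f z"
      using MVT2[OF t(1), of \<phi> f] d(2) t by force
    have "f z < 0" using r(2)[of z] z t f(3) b by simp
    then have "\<phi> t < a" using z t f(2) by (simp add: mult_pos_neg algebra_simps)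
    then show False using d(2)[of t] t by simp
  qed
qed

text \<open>Schwarz's argument: the double difference over a square of side h is h^2 times a value
  of either mixed derivative, by two mean value theorems in each order. Continuity at the origin
  identifies the two limits.\<close>

lemma mixed_partials_commute:
  fixes F Fs Ft Fst Fts :: "real \<Rightarrow> real \<Rightarrow> real"
  assumes d: "d > 0"
    and Fs: "\<And>s t. \<bar>s\<bar> < d \<Longrightarrow> \<bar>t\<bar> < d \<Longrightarrow> ((\<lambda>s. F s t) has_real_derivative Fs s t) (at s)"
    and Ft: "\<And>s t. \<bar>s\<bar> < d \<Longrightarrow> \<bar>t\<bar> < d \<Longrightarrow> ((\<lambda>t. F s t) has_real_derivative Ft s t) (at t)"
    and Fst: "\<And>s t. \<bar>s\<bar> < d \<Longrightarrow> \<bar>t\<bar> < d \<Longrightarrow> ((\<lambda>t. Fs s t) has_real_derivative Fst s t) (at t)"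
    and Fts: "\<And>s t. \<bar>s\<bar> < d \<Longrightarrow> \<bar>t\<bar> < d \<Longrightarrow> ((\<lambda>s. Ft s t) has_real_derivative Fts s t) (at s)"
    and cont: "((\<lambda>(s, t). Fst s t) \<longlongrightarrow> Fst 0 0) (nhds (0, 0))" "((\<lambda>(s, t). Fts s t) \<longlongrightarrow> Fts 0 0) (nhds (0, 0))"
  shows "Fst 0 0 = Fts 0 0"
proof (rule ccontr)
  assume ne: "Fst 0 0 \<noteq> Fts 0 0"
  define \<epsilon> where "\<epsilon> = \<bar>Fst 0 0 - Fts 0 0\<bar> / 2"
  have \<epsilon>: "\<epsilon> > 0" using ne unfolding \<epsilon>_def by simp
  have "\<forall>\<^sub>F z in nhds (0, 0). dist (Fst (fst z) (snd z)) (Fst 0 0) < \<epsilon> \<and> dist (Fts (fst z) (snd z)) (Fts 0 0) < \<epsilon>"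
    using tendstoD[OF cont(1) \<epsilon>] tendstoD[OF cont(2) \<epsilon>]
    by eventually_elim (auto simp: split_beta)
  then obtain r where r: "r > 0" "\<And>s t. dist (s, t) (0, 0) < r \<Longrightarrow>
      dist (Fst s t) (Fst 0 0) < \<epsilon> \<and> dist (Fts s t) (Fts 0 0) < \<epsilon>"
    unfolding eventually_nhds_metric by (metis fst_conv snd_conv)
  define h where "h = min d r / 2"
  have h: "0 < h" "h < d" "2 * h \<le> r" using d r(1) unfolding h_def by auto
  have small: "dist (s, t) (0, 0) < r" if "0 < s" "s < h" "0 < t" "t < h" for s t
  proof -
    have "dist (s, t) (0, 0 :: real) \<le> \<bar>s\<bar> + \<bar>t\<bar>"
      unfolding dist_prod_def by (simp add: dist_real_def sqrt_sum_squares_le_sum_abs)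
    then show ?thesis using that h by simp
  qed
  have dF: "((\<lambda>s. F s h - F s 0) has_real_derivative Fs s h - Fs s 0) (at s)"
    "((\<lambda>t. F h t - F 0 t) has_real_derivative Ft h t - Ft 0 t) (at t)"
    if "0 \<le> s" "s \<le> h" "0 \<le> t" "t \<le> h" for s t
    using that h by (intro DERIV_diff Fs Ft; simp)+
  obtain s where s: "0 < s" "s < h" "(F h h - F h 0) - (F 0 h - F 0 0) = (h - 0) * (Fs s h - Fs s 0)"
    using MVT2[OF h(1), of "\<lambda>s. F s h - F s 0" "\<lambda>s. Fs s h - Fs s 0"] dF(1) h by auto
  have dFs: "(Fs s has_real_derivative Fst s t) (at t)" if "0 \<le> t" "t \<le> h" for t
    using that h s by (intro Fst) auto
  obtain t where t: "0 < t" "t < h" "Fs s h - Fs s 0 = (h - 0) * Fst s t"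
    using MVT2[OF h(1) dFs] by blast
  obtain t' where t': "0 < t'" "t' < h" "(F h h - F 0 h) - (F h 0 - F 0 0) = (h - 0) * (Ft h t' - Ft 0 t')"
    using MVT2[OF h(1), of "\<lambda>t. F h t - F 0 t" "\<lambda>t. Ft h t - Ft 0 t"] dF(2) h by auto
  have dFt: "((\<lambda>s. Ft s t') has_real_derivative Fts s t') (at s)" if "0 \<le> s" "s \<le> h" for s
    using that h t' by (intro Fts) auto
  obtain s' where s': "0 < s'" "s' < h" "Ft h t' - Ft 0 t' = (h - 0) * Fts s' t'"
    using MVT2[OF h(1) dFt] by blast
  have "h * (h * Fst s t) = (F h h - F h 0) - (F 0 h - F 0 0)" using s(3) t(3) by simp
  also have "\<dots> = (F h h - F 0 h) - (F h 0 - F 0 0)" by simp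
  also have "\<dots> = h * (h * Fts s' t')" using t'(3) s'(3) by simp
  finally have "h * (h * Fst s t) = h * (h * Fts s' t')" .
  then have "Fst s t = Fts s' t'" using h(1) by simp
  moreover have "dist (Fst s t) (Fst 0 0) < \<epsilon>" using r(2)[OF small[OF s(1,2) t(1,2)]] by simp
  moreover have "dist (Fts s' t') (Fts 0 0) < \<epsilon>" using r(2)[OF small[OF s'(1,2) t'(1,2)]] by simp
  moreover have "dist (Fst 0 0) (Fts 0 0) \<le> dist (Fst s t) (Fst 0 0) + dist (Fst s t) (Fts 0 0)"
    by (rule dist_triangle3)
  ultimately have "dist (Fst 0 0) (Fts 0 0) < \<epsilon> + \<epsilon>" by simp
  then show False unfolding \<epsilon>_def dist_real_def by simp
qed

text \<open>\<open>frechet_derivative\<close> within a set is a choice and is meaningful only where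
  derivatives are unique. It is enough to ask this for the zero function, because two derivatives of
  one function differ by a derivative of 0.\<close>

definition unique_derivatives :: "'a::euclidean_space set \<Rightarrow> bool" where
  "unique_derivatives S \<longleftrightarrow>
     (\<forall>x\<in>S. \<forall>L. ((\<lambda>_. 0 :: real) has_derivative L) (at x within S) \<longrightarrow> L = (\<lambda>_. 0))"

definition dir_deriv :: "'a::euclidean_space set \<Rightarrow> 'a \<Rightarrow> ('a \<Rightarrow> real) \<Rightarrow> 'a \<Rightarrow> real" where
  "dir_deriv S v f x = frechet_derivative f (at x within S) v"

lemma unique_derivatives_open: "open S \<Longrightarrow> unique_derivatives S"
  unfolding unique_derivatives_def
  by (metis at_within_open has_derivative_const has_derivative_unique)

lemma has_derivative_unique_on:
  fixes f :: "'a::euclidean_space \<Rightarrow> 'b::euclidean_space"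
  assumes S: "unique_derivatives S" "x \<in> S"
    and "(f has_derivative L) (at x within S)" "(f has_derivative M) (at x within S)"
  shows "L = M"
proof -
  have "L v \<bullet> b = M v \<bullet> b" for v b
  proof -
    have "((\<lambda>y. (f y - f y) \<bullet> b) has_derivative (\<lambda>h. (L h - M h) \<bullet> b)) (at x within S)"
      using assms(3,4) by (intro has_derivative_inner_left has_derivative_diff)
    then have "(\<lambda>h. (L h - M h) \<bullet> b) = (\<lambda>_. 0)" using S unfolding unique_derivatives_def by auto
    then have "(L v - M v) \<bullet> b = 0" by meson
    then show ?thesis by (simp add: inner_diff_left)
  qed
  then show ?thesis by (metis euclidean_eqI ext)
qed

lemma frechet_derivative_on:
  fixes f :: "'a::euclidean_space \<Rightarrow> 'b::euclidean_space"
  assumes "unique_derivatives S" "x \<in> S" "(f has_derivative L) (at x within S)"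
  shows "frechet_derivative f (at x within S) = L"
  using has_derivative_unique_on[OF assms(1,2) _ assms(3)] assms(3)
  by (metis differentiable_def frechet_derivative_works)

section \<open>Smooth functions and their directional derivatives\<close>

lemma Ck_on_cong:
  assumes "\<And>x. x \<in> S \<Longrightarrow> f x = g x" "Ck_on k S f"
  shows "Ck_on k S g"
proof (cases k)
  case 0
  then show ?thesis using assms by (metis Ck_on.simps(1) continuous_on_cong)
next
  case (Suc m)
  then obtain F where F: "\<forall>x\<in>S. (f has_derivative (\<lambda>h. \<Sum>b\<in>Basis. (h \<bullet> b) * F b x)) (at x within S)"
    "\<forall>b\<in>Basis. Ck_on m S (F b)" using assms(2) by auto
  have "\<forall>x\<in>S. (g has_derivative (\<lambda>h. \<Sum>b\<in>Basis. (h \<bullet> b) * F b x)) (at x within S)"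
  proof
    fix x assume x: "x \<in> S"
    show "(g has_derivative (\<lambda>h. \<Sum>b\<in>Basis. (h \<bullet> b) * F b x)) (at x within S)"
      by (rule has_derivative_transform[OF x _ bspec[OF F(1) x]]) (simp add: assms(1))
  qed
  then show ?thesis using F(2) Suc by auto
qed

lemma Ck_on_combine:
  assumes "Ck_on k S f" "Ck_on k S g"
  shows "Ck_on k S (\<lambda>x. c * f x + d * g x)"
  using assms
proof (induction k arbitrary: f g)
  case 0
  then show ?case by (auto intro!: continuous_intros)
next
  case (Suc k)
  obtain F where F: "\<forall>x\<in>S. (f has_derivative (\<lambda>h. \<Sum>b\<in>Basis. (h \<bullet> b) * F b x)) (at x within S)"
    "\<forall>b\<in>Basis. Ck_on k S (F b)" using Suc.prems(1) by auto
  obtain G where G: "\<forall>x\<in>S. (g has_derivative (\<lambda>h. \<Sum>b\<in>Basis. (h \<bullet> b) * G b x)) (at x within S)"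
    "\<forall>b\<in>Basis. Ck_on k S (G b)" using Suc.prems(2) by auto
  have "((\<lambda>x. c * f x + d * g x) has_derivative (\<lambda>h. \<Sum>b\<in>Basis. (h \<bullet> b) * (c * F b x + d * G b x))) (at x within S)"
    if "x \<in> S" for x
  proof -
    have "((\<lambda>x. c * f x + d * g x) has_derivative
        (\<lambda>h. c * (\<Sum>b\<in>Basis. (h \<bullet> b) * F b x) + d * (\<Sum>b\<in>Basis. (h \<bullet> b) * G b x))) (at x within S)"
      using F(1) G(1) that by (intro has_derivative_add has_derivative_mult_right) auto
    then show ?thesis by (simp add: sum_distrib_left sum.distrib algebra_simps)
  qed
  moreover have "\<forall>b\<in>Basis. Ck_on k S (\<lambda>x. c * F b x + d * G b x)" using Suc.IH F(2) G(2) by blast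
  ultimately show ?case by (auto intro!: exI[of _ "\<lambda>b x. c * F b x + d * G b x"])
qed

lemma Ck_on_zero: "Ck_on k S (\<lambda>x. 0)"
proof (induction k)
  case (Suc k)
  then show ?case by (auto intro!: exI[of _ "\<lambda>b x. 0"])
qed simp

lemma Ck_on_sum:
  assumes "finite B" "\<And>b. b \<in> B \<Longrightarrow> Ck_on k S (f b)"
  shows "Ck_on k S (\<lambda>x. \<Sum>b\<in>B. c b * f b x)"
  using assms
proof (induction B rule: finite_induct)
  case (insert b B)
  then show ?case using Ck_on_combine[of k S "f b" "\<lambda>x. \<Sum>b\<in>B. c b * f b x" "c b" 1] by simp
qed (simp add: Ck_on_zero)

lemma smooth_on_has_derivative:
  assumes S: "unique_derivatives S" and f: "smooth_on S f" and x: "x \<in> S"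
  shows "(f has_derivative (\<lambda>h. dir_deriv S h f x)) (at x within S)"
proof -
  have "Ck_on (Suc 0) S f" using f unfolding smooth_on_def by blast
  then have "f differentiable (at x within S)" using x unfolding differentiable_def by auto
  then have "(f has_derivative frechet_derivative f (at x within S)) (at x within S)"
    using frechet_derivative_works by blast
  then show ?thesis unfolding dir_deriv_def .
qed

lemma smooth_on_continuous: "smooth_on S f \<Longrightarrow> continuous_on S f"
  unfolding smooth_on_def by (metis Ck_on.simps(1))

lemma linear_dir_deriv:
  assumes "unique_derivatives S" "smooth_on S f" "x \<in> S"
  shows "linear (\<lambda>v. dir_deriv S v f x)"
  using smooth_on_has_derivative[OF assms] has_derivative_linear by blast

lemma dir_deriv_basis:
  assumes "unique_derivatives S" "smooth_on S f" "x \<in> S"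
  shows "dir_deriv S v f x = (\<Sum>b\<in>Basis. (v \<bullet> b) * dir_deriv S b f x)"
proof -
  note l = linear_dir_deriv[OF assms]
  have "dir_deriv S v f x = dir_deriv S (\<Sum>b\<in>Basis. (v \<bullet> b) *\<^sub>R b) f x" by (simp add: euclidean_representation)
  then show ?thesis by (simp add: linear_sum[OF l] linear_scale[OF l])
qed

text \<open>The partial derivatives supplied by \<open>Ck_on\<close> may depend on k; uniqueness
  identifies them, for every k, with the same directional derivatives.\<close>

lemma smooth_on_dir_deriv:
  assumes S: "unique_derivatives S" and f: "smooth_on S f"
  shows "smooth_on S (dir_deriv S v f)"
  unfolding smooth_on_def
proof
  fix k
  have "Ck_on (Suc k) S f" using f unfolding smooth_on_def by blast
  then obtain g where g: "\<And>x. x \<in> S \<Longrightarrow> (f has_derivative (\<lambda>h. \<Sum>b\<in>Basis. (h \<bullet> b) * g b x)) (at x within S)"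
    "\<And>b. b \<in> Basis \<Longrightarrow> Ck_on k S (g b)" by auto
  have "Ck_on k S (\<lambda>x. \<Sum>b\<in>Basis. (v \<bullet> b) * g b x)" using g(2) by (intro Ck_on_sum) auto
  then show "Ck_on k S (dir_deriv S v f)"
  proof (rule Ck_on_cong[rotated])
    fix x assume "x \<in> S"
    then show "(\<Sum>b\<in>Basis. (v \<bullet> b) * g b x) = dir_deriv S v f x"
      unfolding dir_deriv_def using frechet_derivative_on[OF S \<open>x \<in> S\<close> g(1)] by simp
  qed
qed

text \<open>Lets an identity known only on an open set be differentiated once more.\<close>

lemma dir_deriv_cong_open:
  assumes "open U" "U \<subseteq> S" "\<And>y. y \<in> U \<Longrightarrow> f y = g y" "x \<in> U"
  shows "dir_deriv S v f x = dir_deriv S v g x"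
proof -
  have "at x within S = at x" using assms by (meson at_within_interior interior_maximal subsetD)
  moreover have "(f has_derivative L) (at x) \<longleftrightarrow> (g has_derivative L) (at x)" for L
    using assms by (metis has_derivative_transform_within_open)
  ultimately show ?thesis unfolding dir_deriv_def frechet_derivative_def by simp
qed

lemma inner_grad_on:
  assumes "unique_derivatives S" "smooth_on S f" "x \<in> S"
  shows "grad_on S f x \<bullet> v = dir_deriv S v f x"
  unfolding grad_on_def inner_sum_left dir_deriv_basis[OF assms, of v]
  by (intro sum.cong) (auto simp: dir_deriv_def inner_commute)

lemma has_derivative_grad_on:
  assumes S: "unique_derivatives S" and f: "smooth_on S f" and x: "x \<in> S"
  shows "(grad_on S f has_derivative hess_on S f x) (at x within S)"
proof -
  have "((\<lambda>y. \<Sum>b\<in>Basis. dir_deriv S b f y *\<^sub>R b) has_derivative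
      (\<lambda>h. \<Sum>b\<in>Basis. dir_deriv S h (dir_deriv S b f) x *\<^sub>R b)) (at x within S)"
    using smooth_on_has_derivative[OF S smooth_on_dir_deriv[OF S f] x]
    by (intro has_derivative_sum has_derivative_scaleR_left)
  then have "grad_on S f differentiable (at x within S)"
    unfolding differentiable_def grad_on_def dir_deriv_def by blast
  then show ?thesis unfolding hess_on_def using frechet_derivative_works by blast
qed

lemma inner_hess_on:
  assumes S: "unique_derivatives S" and f: "smooth_on S f" and x: "x \<in> S"
  shows "hess_on S f x v \<bullet> w = dir_deriv S v (dir_deriv S w f) x"
proof -
  have gw: "((\<lambda>y. grad_on S f y \<bullet> w) has_derivative (\<lambda>h. hess_on S f x h \<bullet> w)) (at x within S)"
    using has_derivative_grad_on[OF assms] by (rule has_derivative_inner_left)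
  have "(dir_deriv S w f has_derivative (\<lambda>h. hess_on S f x h \<bullet> w)) (at x within S)"
    by (rule has_derivative_transform[OF x _ gw]) (simp add: inner_grad_on[OF S f])
  then show ?thesis unfolding dir_deriv_def[of S v] using frechet_derivative_on[OF S x] by metis
qed

lemma linear_hess_on:
  assumes "unique_derivatives S" "smooth_on S f" "x \<in> S"
  shows "linear (hess_on S f x)"
  using has_derivative_grad_on[OF assms] has_derivative_linear by blast

lemma dir_deriv_along_line:
  assumes S: "unique_derivatives S" and f: "smooth_on S f" and U: "open U" "U \<subseteq> S" and "x + t *\<^sub>R e \<in> U"
  shows "((\<lambda>t. f (x + t *\<^sub>R e)) has_real_derivative dir_deriv S e f (x + t *\<^sub>R e)) (at t)"
proof -
  let ?y = "x + t *\<^sub>R e"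
  have y: "?y \<in> S" using assms by blast
  have "at ?y within S = at ?y" using assms by (meson at_within_interior interior_maximal subsetD)
  then have d: "(f has_derivative (\<lambda>h. dir_deriv S h f ?y)) (at ?y)"
    using smooth_on_has_derivative[OF S f y] by simp
  have "((\<lambda>t. x + t *\<^sub>R e) has_derivative (\<lambda>h. h *\<^sub>R e)) (at t)"
    by (auto intro!: derivative_eq_intros)
  then have "((\<lambda>t. f (x + t *\<^sub>R e)) has_derivative (\<lambda>h. dir_deriv S (h *\<^sub>R e) f ?y)) (at t)"
    using has_derivative_compose[of "\<lambda>t. x + t *\<^sub>R e" "\<lambda>h. h *\<^sub>R e" t UNIV f, OF _ d] by blast
  then show ?thesis unfolding has_field_derivative_def
    by (simp add: linear_scale[OF linear_dir_deriv[OF S f y]] mult_commute_abs)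
qed

lemma jet2_smooth:
  assumes S: "unique_derivatives S" and f: "smooth_on S f" and U: "open U" "U \<subseteq> S" and x: "x \<in> U"
  shows "jet2 (\<lambda>t. f (x + t *\<^sub>R e)) (f x) (dir_deriv S e f x) (dir_deriv S e (dir_deriv S e f) x)"
proof -
  have "((\<lambda>t. x + t *\<^sub>R e) \<longlongrightarrow> x + 0 *\<^sub>R e) (nhds 0)"
    by (intro tendsto_intros filterlim_ident)
  then have ev: "\<forall>\<^sub>F t in nhds 0. x + t *\<^sub>R e \<in> U"
    using topological_tendstoD[of _ _ "nhds 0" U] U(1) x by simp
  then have "\<forall>\<^sub>F t in nhds 0. ((\<lambda>t. f (x + t *\<^sub>R e)) has_real_derivative dir_deriv S e f (x + t *\<^sub>R e)) (at t)"
    by eventually_elim (rule dir_deriv_along_line[OF S f U])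
  moreover have "((\<lambda>t. dir_deriv S e f (x + t *\<^sub>R e)) has_real_derivative dir_deriv S e (dir_deriv S e f) x) (at 0)"
    using dir_deriv_along_line[OF S smooth_on_dir_deriv[OF S f] U, of x 0 e e] x by simp
  ultimately show ?thesis unfolding jet2_def
    by (intro exI[of _ "\<lambda>t. dir_deriv S e f (x + t *\<^sub>R e)"]) auto
qed

text \<open>The square of parameters around x must stay in U, so this covers interior points;
  symmetry of the Hessian at the boundary will follow by continuity.\<close>

lemma dir_deriv_commute:
  assumes S: "unique_derivatives S" and f: "smooth_on S f" and U: "open U" "U \<subseteq> S" and x: "x \<in> U"
  shows "dir_deriv S v (dir_deriv S w f) x = dir_deriv S w (dir_deriv S v f) x"
proof -
  let ?D = "\<lambda>v. dir_deriv S v"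
  let ?y = "\<lambda>s t. x + s *\<^sub>R v + t *\<^sub>R w"
  have lim: "((\<lambda>z. ?y (fst z) (snd z)) \<longlongrightarrow> ?y (fst (0 :: real, 0 :: real)) (snd (0 :: real, 0 :: real))) (nhds (0, 0))"
    by (intro tendsto_intros) (rule filterlim_ident)+
  then have "\<forall>\<^sub>F z in nhds (0, 0). ?y (fst z) (snd z) \<in> U"
    using topological_tendstoD[OF lim U(1)] x by simp
  then obtain r where r: "r > 0" "\<And>s t. dist (s, t) (0, 0) < r \<Longrightarrow> ?y s t \<in> U"
    unfolding eventually_nhds_metric by (metis fst_conv snd_conv)
  have inU: "?y s t \<in> U" if "\<bar>s\<bar> < r / 2" "\<bar>t\<bar> < r / 2" for s t
  proof -
    have "dist (s, t) (0, 0 :: real) \<le> \<bar>s\<bar> + \<bar>t\<bar>"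
      unfolding dist_prod_def by (simp add: dist_real_def sqrt_sum_squares_le_sum_abs)
    then show ?thesis using r(2) that by simp
  qed
  have line_s: "((\<lambda>s. g (?y s t)) has_real_derivative ?D v g (?y s t)) (at s)"
    if "smooth_on S g" "\<bar>s\<bar> < r / 2" "\<bar>t\<bar> < r / 2" for g s t
  proof -
    have e: "?y s' t = (x + t *\<^sub>R w) + s' *\<^sub>R v" for s' by (simp add: algebra_simps)
    show ?thesis using dir_deriv_along_line[OF S that(1) U, of "x + t *\<^sub>R w" s v] inU[OF that(2,3)]
      unfolding e by simp
  qed
  have line_t: "((\<lambda>t. g (?y s t)) has_real_derivative ?D w g (?y s t)) (at t)"
    if "smooth_on S g" "\<bar>s\<bar> < r / 2" "\<bar>t\<bar> < r / 2" for g s t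
    using dir_deriv_along_line[OF S that(1) U, of "x + s *\<^sub>R v" t w] inU[OF that(2,3)] by simp
  have cont: "((\<lambda>(s, t). g (?y s t)) \<longlongrightarrow> g (?y 0 0)) (nhds (0, 0))" if "smooth_on S g" for g
  proof -
    have "isCont g x"
      using smooth_on_continuous[OF that] U x by (meson continuous_on_eq_continuous_at continuous_on_subset)
    then have "(g \<longlongrightarrow> g x) (nhds x)" by (simp add: isCont_def tendsto_at_iff_tendsto_nhds)
    then show ?thesis using filterlim_compose[of g "nhds (g x)" "nhds x"] lim by (simp add: split_beta')
  qed
  note sm = smooth_on_dir_deriv[OF S]
  have "?D w (?D v f) (?y 0 0) = ?D v (?D w f) (?y 0 0)"
    by (rule mixed_partials_commute[of "r / 2" "\<lambda>s t. f (?y s t)" "\<lambda>s t. ?D v f (?y s t)"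
        "\<lambda>s t. ?D w f (?y s t)" "\<lambda>s t. ?D w (?D v f) (?y s t)" "\<lambda>s t. ?D v (?D w f) (?y s t)",
        OF _ line_s[OF f] line_t[OF f] line_t[OF sm[OF f]] line_s[OF sm[OF f]]
          cont[OF sm[OF sm[OF f]]] cont[OF sm[OF sm[OF f]]]])
      (use r(1) in simp)
  then show ?thesis by simp
qed

section \<open>The interior maximum principle\<close>

text \<open>Meant for factors whose derivatives drop out in the end, so that existence of the jet is
  enough.\<close>

definition has_jet2 :: "(real \<Rightarrow> real) \<Rightarrow> bool" where
  "has_jet2 \<phi> \<longleftrightarrow> (\<exists>b c. jet2 \<phi> (\<phi> 0) b c)"

lemma has_jet2I: "jet2 \<phi> a b c \<Longrightarrow> has_jet2 \<phi>"
  unfolding has_jet2_def using jet2_value by blast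

lemma has_jet2_const: "has_jet2 (\<lambda>t. k)"
  by (rule has_jet2I[OF jet2_const])

lemma has_jet2_add: "has_jet2 \<phi> \<Longrightarrow> has_jet2 \<psi> \<Longrightarrow> has_jet2 (\<lambda>t. \<phi> t + \<psi> t)"
  unfolding has_jet2_def[of \<phi>] has_jet2_def[of \<psi>] using has_jet2I jet2_add by blast

lemma has_jet2_mult: "has_jet2 \<phi> \<Longrightarrow> has_jet2 \<psi> \<Longrightarrow> has_jet2 (\<lambda>t. \<phi> t * \<psi> t)"
  unfolding has_jet2_def[of \<phi>] has_jet2_def[of \<psi>] using has_jet2I jet2_mult by blast

lemma has_jet2_sum: "(\<And>i. i \<in> I \<Longrightarrow> has_jet2 (\<phi> i)) \<Longrightarrow> has_jet2 (\<lambda>t. \<Sum>i\<in>I. \<phi> i t)"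
proof (induction I rule: infinite_finite_induct)
  case (insert x F)
  then show ?case by (simp add: has_jet2_add)
qed (simp_all add: has_jet2_const)

lemma has_jet2_inverse: "has_jet2 \<phi> \<Longrightarrow> \<phi> 0 \<noteq> 0 \<Longrightarrow> has_jet2 (\<lambda>t. inverse (\<phi> t))"
  unfolding has_jet2_def[of \<phi>] using has_jet2I jet2_inverse by blast

lemma has_jet2_sqrt: "has_jet2 \<phi> \<Longrightarrow> \<phi> 0 > 0 \<Longrightarrow> has_jet2 (\<lambda>t. sqrt (\<phi> t))"
  unfolding has_jet2_def[of \<phi>] using has_jet2I jet2_sqrt by blast

lemma jet2_eventually_cong:
  assumes "jet2 \<phi> a b c" "\<forall>\<^sub>F t in nhds 0. \<phi> t = \<psi> t"
  shows "jet2 \<psi> a b c"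
proof -
  obtain f where f: "\<forall>\<^sub>F t in nhds 0. (\<phi> has_real_derivative f t) (at t)" "\<phi> 0 = a" "f 0 = b"
    "(f has_real_derivative c) (at 0)" using assms(1) unfolding jet2_def by blast
  have "\<forall>\<^sub>F t in nhds 0. \<forall>\<^sub>F s in nhds t. \<phi> s = \<psi> s"
    using assms(2) by (simp add: eventually_eventually)
  then have "\<forall>\<^sub>F t in nhds 0. (\<psi> has_real_derivative f t) (at t)"
    using f(1) by eventually_elim (simp add: DERIV_cong_ev)
  moreover have "\<psi> 0 = a" using eventually_nhds_x_imp_x[OF assms(2)] f(2) by simp
  ultimately show ?thesis unfolding jet2_def using f(3,4) by blast
qed

text \<open>With N_p = (-p, 1) / slope p, the minimal rotation from N_p to N_q subtracts from a
  tangent vector X the vector (X . N_q) / (1 + N_p . N_q) times N_p + N_q. For X = (v, p . v) one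
  has X . N_q = - ((q - p) . v) / slope q; the horizontal part of what remains is this
  direction.\<close>

definition move_dir :: "'a::euclidean_space \<Rightarrow> 'a \<Rightarrow> 'a" where
  "move_dir p q = inverse (slope q * (slope q * slope p + 1 + q \<bullet> p)) *\<^sub>R (slope q *\<^sub>R p + slope p *\<^sub>R q)"

text \<open>The minimal rotation of \<open>\<real>\<^sup>n\<^sup>+\<^sup>1\<close> taking the upward normal of slope \<open>p\<close> to the one of slope \<open>q\<close>,
  read off on horizontal components of tangent vectors.  To second order along a geodesic it is
  parallel transport on the graph.\<close>

definition move_frame :: "'a::euclidean_space \<Rightarrow> 'a \<Rightarrow> 'a \<Rightarrow> 'a" where
  "move_frame p q v = v - ((q - p) \<bullet> v) *\<^sub>R move_dir p q"

lemma norm_less_slope: "norm p < slope p"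
  unfolding slope_def by (rule real_less_rsqrt) simp

text \<open>The quantity is slope p * slope q * (1 + N_p . N_q), and two upward normals are never
  opposite.\<close>

lemma move_denom_pos: "slope q * slope p + 1 + q \<bullet> p > 0"
proof -
  have "\<bar>q \<bullet> p\<bar> \<le> norm q * norm p" by (rule Cauchy_Schwarz_ineq2)
  also have "\<dots> \<le> slope q * slope p"
    using norm_less_slope[of q] norm_less_slope[of p] slope_pos[of q] by (intro mult_mono) auto
  finally show ?thesis by linarith
qed

lemma move_dir_self: "move_dir p p = (1 / (slope p)\<^sup>2) *\<^sub>R p"
proof -
  have "slope p * slope p + 1 + p \<bullet> p = 2 * (slope p)\<^sup>2"
    using slope_sq[of p] by (simp add: power2_eq_square)
  moreover have "slope p *\<^sub>R p + slope p *\<^sub>R p = (2 * slope p) *\<^sub>R p" by (simp flip: scaleR_add_left)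
  moreover have "inverse (slope p * (2 * (slope p)\<^sup>2)) * (2 * slope p) = 1 / (slope p)\<^sup>2"
    using slope_pos[of p] by (simp add: field_simps)
  ultimately show ?thesis unfolding move_dir_def by simp
qed

text \<open>A rotation preserves the inner product of the lifted vectors (v, p . v), and that
  product is the graph metric.\<close>

lemma graph_metric_move_frame:
  "graph_metric q (move_frame p q v) (move_frame p q z) = graph_metric p v z"
proof -
  define w w0 c D where "w = slope q" and "w0 = slope p" and "c = q \<bullet> p"
    and "D = slope q * (slope q * slope p + 1 + q \<bullet> p)"
  have D: "D \<noteq> 0" unfolding D_def using slope_pos[of q] move_denom_pos[of q p] by simp
  have Dexp: "D = w * (w * w0 + 1 + c)" unfolding D_def w_def w0_def c_def ..
  have qq: "q \<bullet> q = w\<^sup>2 - 1" and pp: "p \<bullet> p = w0\<^sup>2 - 1"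
    unfolding w_def w0_def slope_sq by auto
  \<comment> \<open>With k = w0 / D, the relations q . h = 1 - r, h . h = 2 k - r^2 and h . v = r (p
    . v) + k ((q - p) . v) make all terms containing q - p cancel.\<close>
  define r where "r = (w + w0) / D"
  define h where "h = move_dir p q"
  have h: "h = (1 / D) *\<^sub>R (w *\<^sub>R p + w0 *\<^sub>R q)"
    unfolding h_def move_dir_def D_def w_def w0_def by (simp add: divide_inverse)
  have qh: "q \<bullet> h = 1 - r"
  proof -
    have "q \<bullet> h = (w * c + w0 * (w\<^sup>2 - 1)) / D"
      unfolding h by (simp add: inner_add_right qq c_def)
    also have "w * c + w0 * (w\<^sup>2 - 1) = D - (w + w0)"
      unfolding Dexp by (simp add: algebra_simps power2_eq_square)
    finally show ?thesis unfolding r_def using D by (simp add: diff_divide_distrib)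
  qed
  have hh: "h \<bullet> h = 2 * w0 / D - r\<^sup>2"
  proof -
    have "h \<bullet> h = (w\<^sup>2 * (w0\<^sup>2 - 1) + 2 * w * w0 * c + w0\<^sup>2 * (w\<^sup>2 - 1)) / D\<^sup>2"
    proof -
      have "(w *\<^sub>R p + w0 *\<^sub>R q) \<bullet> (w *\<^sub>R p + w0 *\<^sub>R q) = w\<^sup>2 * (p \<bullet> p) + 2 * w * w0 * c + w0\<^sup>2 * (q \<bullet> q)"
        unfolding c_def by (simp add: inner_add_right inner_add_left inner_commute power2_eq_square algebra_simps)
      then show ?thesis unfolding h qq pp by (simp add: power2_eq_square)
    qed
    also have "w\<^sup>2 * (w0\<^sup>2 - 1) + 2 * w * w0 * c + w0\<^sup>2 * (w\<^sup>2 - 1) = 2 * w0 * D - (w + w0)\<^sup>2"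
      unfolding Dexp by (simp add: algebra_simps power2_eq_square)
    finally show ?thesis unfolding r_def using D by (simp add: diff_divide_distrib power2_eq_square)
  qed
  have hv: "h \<bullet> v = r * (p \<bullet> v) + w0 / D * ((q - p) \<bullet> v)" for v
    unfolding h r_def by (simp add: inner_add_left inner_diff_left algebra_simps add_divide_distrib diff_divide_distrib)
  define \<alpha> \<beta> x y k where "\<alpha> = (q - p) \<bullet> v" and "\<beta> = (q - p) \<bullet> z" and "x = p \<bullet> v" and "y = p \<bullet> z"
    and "k = w0 / D"
  have qv: "q \<bullet> v = \<alpha> + x" "q \<bullet> z = \<beta> + y" unfolding \<alpha>_def \<beta>_def x_def y_def by (auto simp: inner_diff_left)
  have hv': "h \<bullet> v = r * x + k * \<alpha>" "h \<bullet> z = r * y + k * \<beta>"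
    unfolding hv \<alpha>_def \<beta>_def x_def y_def k_def by auto
  have hh': "h \<bullet> h = 2 * k - r\<^sup>2" unfolding hh k_def by simp
  have "graph_metric q (move_frame p q v) (move_frame p q z)
     = v \<bullet> z - \<beta> * (h \<bullet> v) - \<alpha> * (h \<bullet> z) + \<alpha> * \<beta> * (h \<bullet> h)
       + (q \<bullet> v - \<alpha> * (q \<bullet> h)) * (q \<bullet> z - \<beta> * (q \<bullet> h))"
    unfolding graph_metric_def move_frame_def \<alpha>_def[symmetric] \<beta>_def[symmetric] h_def[symmetric]
    by (simp add: inner_diff_left inner_diff_right inner_commute algebra_simps)
  also have "\<dots> = v \<bullet> z + x * y"
    unfolding qh hh' hv' qv by (simp add: algebra_simps power2_eq_square)
  finally show ?thesis unfolding graph_metric_def x_def y_def .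
qed

text \<open>S carries the derivatives and will be the closure of the domain. Inside the open set U
  partial derivatives commute and identities can be differentiated again.\<close>

locale smooth_graph =
  fixes S U :: "'a::euclidean_space set" and u :: "'a \<Rightarrow> real"
  assumes ud: "unique_derivatives S" and smooth: "smooth_on S u"
    and openU: "open U" and US: "U \<subseteq> S"
    and convex: "\<And>x \<xi>. x \<in> U \<Longrightarrow> hess_on S u x \<xi> \<bullet> \<xi> \<ge> 0"
begin

abbreviation "D \<equiv> dir_deriv S"
abbreviation "p \<equiv> grad_on S u"
abbreviation "H \<equiv> hess_on S u"

lemma smooth_D: "smooth_on S f \<Longrightarrow> smooth_on S (D v f)"
  using smooth_on_dir_deriv[OF ud] .

lemma commute: "smooth_on S f \<Longrightarrow> x \<in> U \<Longrightarrow> D v (D w f) x = D w (D v f) x"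
  using dir_deriv_commute[OF ud _ openU US] .

lemma commute3: "smooth_on S f \<Longrightarrow> x \<in> U \<Longrightarrow> D v (D w (D z f)) x = D w (D z (D v f)) x"
proof -
  assume f: "smooth_on S f" and x: "x \<in> U"
  have "D v (D w (D z f)) x = D w (D v (D z f)) x" using commute[OF smooth_D[OF f] x] .
  also have "\<dots> = D w (D z (D v f)) x"
    by (rule dir_deriv_cong_open[OF openU US commute[OF f] x])
  finally show ?thesis .
qed

lemma commute4: "smooth_on S f \<Longrightarrow> x \<in> U \<Longrightarrow> D v (D v (D w (D w f))) x = D w (D w (D v (D v f))) x"
proof -
  assume f: "smooth_on S f" and x: "x \<in> U"
  have "D v (D v (D w (D w f))) x = D v (D w (D w (D v f))) x"
    by (rule dir_deriv_cong_open[OF openU US commute3[OF f] x])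
  also have "\<dots> = D w (D w (D v (D v f))) x" by (rule commute3[OF smooth_D[OF f] x])
  finally show ?thesis .
qed

lemma hess_D: "x \<in> U \<Longrightarrow> H x v \<bullet> w = D v (D w u) x"
  using inner_hess_on[OF ud smooth] US by blast

lemma psd_hess: assumes x: "x \<in> U" shows "psd_operator (H x)"
proof (rule psd_operator.intro)
  show "linear (H x)" using linear_hess_on[OF ud smooth] x US by blast
  show "H x v \<bullet> v \<ge> 0" for v using convex x .
  show "H x v \<bullet> w = v \<bullet> H x w" for v w
    using commute[OF smooth x] by (simp add: hess_D[OF x] inner_commute[of v])
qed

lemma grad_basis: "b \<in> Basis \<Longrightarrow> p x \<bullet> b = D b u x"
  unfolding grad_on_def dir_deriv_def
  by (simp add: inner_sum_left inner_Basis if_distrib cong: if_cong)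

lemma inner_grad_basis: "p x \<bullet> v = (\<Sum>b\<in>Basis. D b u x * (v \<bullet> b))"
  by (subst euclidean_inner) (simp add: grad_basis)

lemma inner_hess_basis: "x \<in> U \<Longrightarrow> H x w \<bullet> v = (\<Sum>b\<in>Basis. D w (D b u) x * (v \<bullet> b))"
  by (subst euclidean_inner) (simp add: hess_D)

lemma near: "x \<in> U \<Longrightarrow> \<forall>\<^sub>F t in nhds 0. x + t *\<^sub>R e \<in> U"
proof -
  assume "x \<in> U"
  have "((\<lambda>t. x + t *\<^sub>R e) \<longlongrightarrow> x + 0 *\<^sub>R e) (nhds 0)"
    by (intro tendsto_intros filterlim_ident)
  then show ?thesis using topological_tendstoD[of _ _ "nhds 0" U] openU \<open>x \<in> U\<close> by simp
qed

lemma jet2_D: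
  "smooth_on S f \<Longrightarrow> x \<in> U \<Longrightarrow> jet2 (\<lambda>t. f (x + t *\<^sub>R e)) (f x) (D e f x) (D e (D e f) x)"
  using jet2_smooth[OF ud _ openU US] .

section \<open>Second-order expansions of the slope and of the moved second fundamental form\<close>

lemma jet2_slope_sq:
  assumes x: "x \<in> U"
  shows "jet2 (\<lambda>t. 1 + (norm (p (x + t *\<^sub>R e)))\<^sup>2) ((slope (p x))\<^sup>2) (2 * (H x e \<bullet> p x))
     (2 * (H x e \<bullet> H x e + D e (D e (D (p x) u)) x))"
proof -
  have xS: "x \<in> S" using x US by blast
  have e: "1 + (norm (p y))\<^sup>2 = 1 + (\<Sum>b\<in>Basis. D b u y * D b u y)" for y
    by (simp add: power2_norm_eq_inner inner_grad_basis[of y "p y"] grad_basis)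
  have j: "jet2 (\<lambda>t. 1 + (\<Sum>b\<in>Basis. D b u (x + t *\<^sub>R e) * D b u (x + t *\<^sub>R e)))
     (1 + (\<Sum>b\<in>Basis. D b u x * D b u x)) (0 + (\<Sum>b\<in>Basis. D b u x * D e (D b u) x + D e (D b u) x * D b u x))
     (0 + (\<Sum>b\<in>Basis. D b u x * D e (D e (D b u)) x + 2 * D e (D b u) x * D e (D b u) x + D e (D e (D b u)) x * D b u x))"
    by (intro jet2_add jet2_const jet2_sum jet2_mult jet2_D smooth_D smooth x)
  have He: "H x e \<bullet> v = (\<Sum>b\<in>Basis. D e (D b u) x * (v \<bullet> b))" for v
    by (rule inner_hess_basis[OF x])
  have HH: "H x e \<bullet> H x e = (\<Sum>b\<in>Basis. D e (D b u) x * D e (D b u) x)"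
    by (subst euclidean_inner) (simp add: hess_D[OF x])
  \<comment> \<open>The direction \<open>p x\<close> is frozen at x. Commuting it to the outside
    makes linearity in the direction available for the expansion.\<close>
  have eep: "D e (D e (D (p x) u)) x = (\<Sum>b\<in>Basis. D e (D e (D b u)) x * D b u x)"
  proof -
    have 1: "D e (D e (D v u)) x = D v (D e (D e u)) x" for v
      using commute3[OF smooth x, of v e e] by simp
    show ?thesis unfolding 1
      by (subst dir_deriv_basis[OF ud smooth_D[OF smooth_D[OF smooth]] xS])
        (intro sum.cong, auto simp: grad_basis)
  qed
  show ?thesis unfolding e
    by (rule jet2_cong[OF j])
      (simp_all add: slope_sq inner_grad_basis[of x "p x"] grad_basis He[of "p x"] HH eep sum.distrib
        sum_distrib_left algebra_simps flip: sum_distrib_left)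
qed

lemma jet2_inverse_slope:
  assumes x: "x \<in> U"
  shows "jet2 (\<lambda>t. inverse (slope (p (x + t *\<^sub>R e)))) (1 / slope (p x))
     (- (H x e \<bullet> p x) / slope (p x) ^ 3)
     (- (H x e \<bullet> H x e + D e (D e (D (p x) u)) x) / slope (p x) ^ 3
        + 3 * (H x e \<bullet> p x)\<^sup>2 / slope (p x) ^ 5)"
proof -
  define w where "w = slope (p x)"
  have w: "w > 0" unfolding w_def by (rule slope_pos)
  then have w': "sqrt (w\<^sup>2) = w" by simp
  have j1: "jet2 (\<lambda>t. slope (p (x + t *\<^sub>R e))) w ((2 * (H x e \<bullet> p x)) / (2 * w))
     ((2 * (H x e \<bullet> H x e + D e (D e (D (p x) u)) x)) / (2 * w) - (2 * (H x e \<bullet> p x))\<^sup>2 / (4 * w ^ 3))"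
    using jet2_sqrt[OF jet2_slope_sq[OF x, of e]] w unfolding slope_def[of "p (x + _ *\<^sub>R e)"] w_def[symmetric] w'
    by simp
  show ?thesis unfolding w_def[symmetric]
    by (rule jet2_cong[OF jet2_inverse[OF j1]])
      (use w in \<open>auto simp: field_simps power2_eq_square power3_eq_cube power_numeral_reduce\<close>)
qed

text \<open>\<open>Q v\<close> is the second fundamental form on the moved vector, times the slope.\<close>

definition Q :: "'a \<Rightarrow> 'a \<Rightarrow> 'a \<Rightarrow> real" where
  "Q x0 v x = H x (move_frame (p x0) (p x) v) \<bullet> move_frame (p x0) (p x) v"

lemma has_jet2_move_dir:
  assumes x: "x \<in> U" and b: "b \<in> Basis"
  shows "has_jet2 (\<lambda>t. move_dir (p x) (p (x + t *\<^sub>R e)) \<bullet> b)"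
proof -
  let ?y = "\<lambda>t. x + t *\<^sub>R e"
  have s: "has_jet2 (\<lambda>t. slope (p (?y t)))"
    unfolding slope_def
    using has_jet2_sqrt[OF has_jet2I[OF jet2_slope_sq[OF x, of e]]] by (simp add: add_pos_nonneg)
  have c: "has_jet2 (\<lambda>t. p (?y t) \<bullet> p x)"
    unfolding inner_grad_basis[of _ "p x"]
    by (intro has_jet2_sum has_jet2_mult has_jet2_const; rule has_jet2I[OF jet2_D[OF smooth_D[OF smooth] x]])
  have g: "has_jet2 (\<lambda>t. p (?y t) \<bullet> b)"
    unfolding grad_basis[OF b] using x smooth by (auto intro!: has_jet2I[OF jet2_D] smooth_D)
  have d: "has_jet2 (\<lambda>t. slope (p (?y t)) * (slope (p (?y t)) * slope (p x) + 1 + p (?y t) \<bullet> p x))"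
    by (intro has_jet2_mult has_jet2_add has_jet2_const s c)
  have nz: "slope (p x) * (slope (p x) * slope (p x) + 1 + p x \<bullet> p x) \<noteq> 0"
    using slope_pos[of "p x"] move_denom_pos[of "p x" "p x"] by simp
  have "has_jet2 (\<lambda>t. inverse (slope (p (?y t)) * (slope (p (?y t)) * slope (p x) + 1 + p (?y t) \<bullet> p x))
      * (slope (p (?y t)) * (p x \<bullet> b) + slope (p x) * (p (?y t) \<bullet> b)))"
    by (intro has_jet2_mult has_jet2_add has_jet2_const s g has_jet2_inverse[OF d]) (use nz in simp)
  then show ?thesis unfolding move_dir_def by (simp add: inner_add_left)
qed

text \<open>Q is H(v, v) - 2 A K + A^2 M, where A = (p y - p x) . v vanishes at x. Hence M does not
  reach the first derivative and enters the second only through A' = D^2u(e, v). When A' = 0, only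
  A'' and the value of K at 0 survive, so c is determined in that case without the derivatives of K
  and M.\<close>

lemma jet2_Q:
  assumes x: "x \<in> U"
  obtains c where "jet2 (\<lambda>t. Q x v (x + t *\<^sub>R e)) (H x v \<bullet> v)
     (D e (D v (D v u)) x - 2 * (H x e \<bullet> v) * (H x v \<bullet> p x) / (slope (p x))\<^sup>2) c"
    "H x e \<bullet> v = 0 \<Longrightarrow>
       c = D e (D e (D v (D v u))) x - 2 * D e (D e (D v u)) x * (H x v \<bullet> p x) / (slope (p x))\<^sup>2"
proof -
  let ?y = "\<lambda>t. x + t *\<^sub>R e"
  define h where "h = (\<lambda>t. move_dir (p x) (p (?y t)))"
  define K where "K = (\<lambda>t. \<Sum>b\<in>Basis. (h t \<bullet> b) * D v (D b u) (?y t))"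
  define M where "M = (\<lambda>t. \<Sum>b\<in>Basis. \<Sum>b'\<in>Basis. (h t \<bullet> b) * (h t \<bullet> b') * D b (D b' u) (?y t))"
  have hb: "has_jet2 (\<lambda>t. h t \<bullet> b)" if "b \<in> Basis" for b
    unfolding h_def by (rule has_jet2_move_dir[OF x that])
  have "has_jet2 K" unfolding K_def
    by (intro has_jet2_sum has_jet2_mult hb has_jet2I[OF jet2_D] smooth_D smooth x)
  then obtain K1 K2 where K: "jet2 K (K 0) K1 K2" unfolding has_jet2_def by blast
  have "has_jet2 M" unfolding M_def
    by (intro has_jet2_sum has_jet2_mult hb has_jet2I[OF jet2_D] smooth_D smooth x)
  then obtain M1 M2 where M: "jet2 M (M 0) M1 M2" unfolding has_jet2_def by blast
  define A where "A = (\<lambda>t. D v u (?y t) + - D v u x)"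
  have A: "jet2 A (D v u x + - D v u x) (D e (D v u) x + 0) (D e (D e (D v u)) x + 0)"
    unfolding A_def by (intro jet2_add jet2_const jet2_D smooth_D smooth x)
  have V: "jet2 (\<lambda>t. D v (D v u) (?y t)) (D v (D v u) x) (D e (D v (D v u)) x) (D e (D e (D v (D v u))) x)"
    by (intro jet2_D smooth_D smooth x)
  note J = jet2_add[OF V jet2_add[OF jet2_cmult[OF jet2_mult[OF A K], of "-2"] jet2_mult[OF jet2_mult[OF A A] M]]]
  have hv: "H x e \<bullet> v = D e (D v u) x" "H x v \<bullet> v = D v (D v u) x" using x by (auto simp: hess_D)
  \<comment> \<open>At equal slopes \<open>move_dir\<close> is p / w^2: to first order the frame
    moves by the Christoffel symbols u_ij u_k / w^2 of the graph.\<close>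
  have K0: "K 0 = (H x v \<bullet> p x) / (slope (p x))\<^sup>2"
  proof -
    have "K 0 = (\<Sum>b\<in>Basis. (p x \<bullet> b) * (H x v \<bullet> b)) / (slope (p x))\<^sup>2"
      unfolding K_def h_def sum_divide_distrib by (simp add: move_dir_self hess_D[OF x])
    then show ?thesis by (subst euclidean_inner) (simp add: mult.commute)
  qed
  have "\<forall>\<^sub>F t in nhds 0. D v (D v u) (?y t) + (-2 * (A t * K t) + A t * A t * M t) = Q x v (?y t)"
    using near[OF x, of e]
  proof eventually_elim
    case (elim t)
    let ?z = "?y t"
    interpret Hz: psd_operator "H ?z" using psd_hess[OF elim] .
    have a: "(p ?z - p x) \<bullet> v = A t"
      unfolding A_def using inner_grad_on[OF ud smooth subsetD[OF US elim]] inner_grad_on[OF ud smooth subsetD[OF US x]]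
      by (simp add: inner_diff_left)
    have rep: "H ?z w \<bullet> h t = (\<Sum>b\<in>Basis. (h t \<bullet> b) * (H ?z w \<bullet> b))" for w
      by (subst euclidean_inner) (simp add: mult.commute)
    have k: "H ?z v \<bullet> h t = K t" unfolding K_def rep by (simp add: hess_D[OF elim])
    have m: "H ?z (h t) \<bullet> h t = M t"
    proof -
      have swap: "H ?z (h t) \<bullet> b = H ?z b \<bullet> h t" for b
        using Hz.sym[of "h t" b] by (simp add: inner_commute)
      have "H ?z (h t) \<bullet> h t = (\<Sum>b\<in>Basis. (h t \<bullet> b) * (H ?z b \<bullet> h t))"
        by (subst rep[of "h t"]) (intro sum.cong refl arg_cong2[where f = times] swap)
      also have "\<dots> = M t" unfolding M_def rep sum_distrib_left by (simp add: hess_D[OF elim] mult.assoc)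
      finally show ?thesis .
    qed
    have ht: "move_dir (p x) (p ?z) = h t" unfolding h_def ..
    have "Q x v ?z = H ?z v \<bullet> v - 2 * A t * (H ?z v \<bullet> h t) + A t * A t * (H ?z (h t) \<bullet> h t)"
      unfolding Q_def move_frame_def a ht
      using Hz.sym[of "h t" v]
      by (simp add: linear_diff[OF Hz.lin] linear_scale[OF Hz.lin] inner_diff_left inner_diff_right
          inner_commute algebra_simps)
    then show ?case unfolding k m by (simp add: hess_D[OF elim])
  qed
  note J' = jet2_eventually_cong[OF J this]
  show thesis
  proof (rule that)
    show "jet2 (\<lambda>t. Q x v (x + t *\<^sub>R e)) (H x v \<bullet> v)
     (D e (D v (D v u)) x - 2 * (H x e \<bullet> v) * (H x v \<bullet> p x) / (slope (p x))\<^sup>2)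
     (D e (D e (D v (D v u))) x +
       (-2 * ((D v u x + - D v u x) * K2 + 2 * (D e (D v u) x + 0) * K1 + (D e (D e (D v u)) x + 0) * K 0) +
        ((D v u x + - D v u x) * (D v u x + - D v u x) * M2 +
          2 * ((D v u x + - D v u x) * (D e (D v u) x + 0) + (D e (D v u) x + 0) * (D v u x + - D v u x)) * M1 +
         ((D v u x + - D v u x) * (D e (D e (D v u)) x + 0) + 2 * (D e (D v u) x + 0) * (D e (D v u) x + 0) +
          (D e (D e (D v u)) x + 0) * (D v u x + - D v u x)) * M 0)))"
      by (rule jet2_cong[OF J']) (simp_all add: hv K0)
  qed (simp add: hv K0)
qed

theorem no_interior_max:
  assumes eq: "\<And>x. x \<in> U \<Longrightarrow> arctan_sum UNIV (graph_curv (p x) (H x)) = \<theta>" and \<theta>: "\<theta> > 0"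
    and max: "\<And>x \<xi>. x \<in> U \<Longrightarrow> H x \<xi> \<bullet> \<xi> \<le> a * graph_metric (p x) \<xi> \<xi>"
    and x: "x \<in> U" and \<xi>: "\<xi> \<noteq> 0" "H x \<xi> \<bullet> \<xi> = a * graph_metric (p x) \<xi> \<xi>"
  shows False
proof -
  define w where "w = slope (p x)"
  have w: "w > 0" unfolding w_def by (rule slope_pos)
  interpret A: psd_operator "graph_curv (p x) (H x)" by (rule psd_operator_graph_curv[OF psd_hess[OF x]])
  interpret Hx: psd_operator "H x" by (rule psd_hess[OF x])
  obtain E where E: "onframe UNIV E (\<lambda>x. x)"
    and Ee: "\<And>e. e \<in> E \<Longrightarrow> graph_curv (p x) (H x) e = (graph_curv (p x) (H x) e \<bullet> e) *\<^sub>R e"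
    and Es: "arctan_sum UNIV (graph_curv (p x) (H x)) = (\<Sum>e\<in>E. arctan (graph_curv (p x) (H x) e \<bullet> e))"
    using A.eigenframe by blast
  have finE: "finite E" and cardE: "card E = DIM('a)"
    and onE: "\<And>k l. k \<in> E \<Longrightarrow> l \<in> E \<Longrightarrow> k \<bullet> l = (if k = l then 1 else 0)"
    using E unfolding onframe_def by auto
  define l where "l = (\<lambda>k. graph_curv (p x) (H x) k \<bullet> k)"
  define y where "y = (\<lambda>k. metric_inv_sqrt (p x) k)"
  have l0: "l k \<ge> 0" for k unfolding l_def by (rule A.psd)
  \<comment> \<open>The y k are eigenvectors of the Hessian relative to the graph metric, with
    eigenvalue w times the curvature l k.\<close>
  have Hy: "H x (y k) \<bullet> v = w * l k * graph_metric (p x) (y k) v" if "k \<in> E" for k v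
  proof -
    have "(H x (y k) \<bullet> v) / w = graph_curv (p x) (H x) k \<bullet> metric_sqrt (p x) v"
      using graph_curv_metric_sqrt[of "p x" "H x" "y k" v] unfolding y_def w_def by (simp add: metric_sqrt_inverse)
    also have "\<dots> = l k * (k \<bullet> metric_sqrt (p x) v)" by (subst Ee[OF that]) (simp add: l_def)
    also have "k \<bullet> metric_sqrt (p x) v = graph_metric (p x) (y k) v"
      unfolding y_def inner_metric_sqrt_metric_sqrt[symmetric] by (simp add: metric_sqrt_inverse)
    finally show ?thesis using w by (simp add: field_simps)
  qed
  have gy: "graph_metric (p x) (y k) (y j) = (if k = j then 1 else 0)" if "k \<in> E" "j \<in> E" for k j
    unfolding y_def graph_metric_metric_inv_sqrt using onE that by blast
  have l_le: "l k \<le> a / w" if "k \<in> E" for k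
    using max[OF x, of "y k"] gy[OF that that] w unfolding Hy[OF that] by (simp add: field_simps)
  \<comment> \<open>The maximising \<xi> need not be a frame vector. If all curvatures were below a
    / w, expanding \<xi> in the frame would contradict equality.\<close>
  have "\<exists>e\<in>E. l e = a / w"
  proof (rule ccontr)
    assume "\<not> ?thesis"
    then have lt: "l k < a / w" if "k \<in> E" for k using l_le[OF that] that by (simp add: order_less_le)
    define z where "z = metric_sqrt (p x) \<xi>"
    have "z \<noteq> 0" using \<xi>(1) metric_inv_sqrt_inverse[of "p x" \<xi>] linear_0[OF linear_metric_inv_sqrt] unfolding z_def by metis
    then obtain k where k: "k \<in> E" "z \<bullet> k \<noteq> 0"
      using onframe_expand[OF subspace_UNIV E, of z] by (metis (no_types, lifting) UNIV_I scale_eq_0_iff sum.neutral)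
    have "graph_curv (p x) (H x) z \<bullet> z = (\<Sum>k\<in>E. (z \<bullet> k)\<^sup>2 * l k)"
      unfolding l_def by (rule A.quadratic_eigenframe[OF E Ee])
    also have "\<dots> < (\<Sum>k\<in>E. (z \<bullet> k)\<^sup>2 * (a / w))"
    proof (rule sum_strict_mono_ex1[OF finE])
      show "\<forall>k\<in>E. (z \<bullet> k)\<^sup>2 * l k \<le> (z \<bullet> k)\<^sup>2 * (a / w)"
        by (intro ballI mult_left_mono less_imp_le[OF lt] zero_le_power2)
      show "\<exists>k\<in>E. (z \<bullet> k)\<^sup>2 * l k < (z \<bullet> k)\<^sup>2 * (a / w)"
        using k lt[OF k(1)] by (intro bexI[of _ k] mult_strict_left_mono) auto
    qed
    also have "\<dots> = (z \<bullet> z) * (a / w)"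
      unfolding onframe_parseval[OF subspace_UNIV E UNIV_I, of z z] sum_distrib_right by (simp add: power2_eq_square)
    finally show False using \<xi>(2) w unfolding z_def graph_curv_metric_sqrt inner_metric_sqrt_metric_sqrt w_def
      by (simp add: mult.commute)
  qed
  then obtain e where e: "e \<in> E" "l e = a / w" by blast
  \<comment> \<open>From \<theta> > 0: some curvature is positive, so a > 0. Then
    \<open>H x Y\<close> is nonzero below, and the final inequality is strict.\<close>
  have "\<exists>k\<in>E. l k > 0"
  proof (rule ccontr)
    assume "\<not> ?thesis"
    then have "l k = 0" if "k \<in> E" for k using l0[of k] that by force
    moreover have "\<theta> = (\<Sum>k\<in>E. arctan (l k))" using Es eq[OF x] unfolding l_def by simp
    ultimately show False using \<theta> by simp
  qed
  then have "a / w > 0" using l_le by force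
  then have a: "a > 0" and le: "l e > 0" using w e(2) by (auto simp: zero_less_divide_iff)
  define Y where "Y = y e"
  have HYY: "H x Y \<bullet> Y = a" unfolding Y_def Hy[OF e(1)] gy[OF e(1) e(1)] using e(2) w by simp
  have HYk: "H x Y \<bullet> y k = 0" if "k \<in> E" "k \<noteq> e" for k
    unfolding Y_def Hy[OF e(1)] using gy[OF e(1) that(1)] that(2) by simp
  \<comment> \<open>The moved Y keeps unit length in the graph metric, so its Q is at most a near x,
    with the value a at x.\<close>
  have Qmax: "\<forall>\<^sub>F t in nhds 0. - a \<le> - 1 * Q x Y (x + t *\<^sub>R d)" for d
    using near[OF x, of d]
  proof eventually_elim
    case (elim t)
    have "Q x Y (x + t *\<^sub>R d) \<le> a * graph_metric (p x) Y Y"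
      unfolding Q_def using max[OF elim] by (metis graph_metric_move_frame)
    then show ?case unfolding Y_def using gy[OF e(1) e(1)] by simp
  qed
  have QY: "b = 0 \<and> c \<le> 0" if "jet2 (\<lambda>t. Q x Y (x + t *\<^sub>R d)) (H x Y \<bullet> Y) b c" for d b c
    using jet2_local_min[OF jet2_cmult[OF that, of "-1"], unfolded HYY] Qmax[of d] by simp
  define h where "h = H x Y \<bullet> p x"
  define N where "N = H x Y \<bullet> H x Y"
  define c1 c2 where "c1 = - h / w ^ 3" and "c2 = - (N + D Y (D Y (D (p x) u)) x) / w ^ 3 + 3 * h\<^sup>2 / w ^ 5"
  have jc: "jet2 (\<lambda>t. inverse (slope (p (x + t *\<^sub>R Y)))) (1 / w) c1 c2"
    unfolding c1_def c2_def w_def h_def N_def by (rule jet2_inverse_slope[OF x])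
  \<comment> \<open>Moving Y in the direction \<open>p x\<close>, the first-order condition
    determines the third derivative in c2 as 2 h^2 / w^2. What remains is (h^2 / w^2 - N) / w^3,
    negative by Cauchy-Schwarz and |p| < w.\<close>
  have c2neg: "c2 < 0"
  proof -
    obtain c where "jet2 (\<lambda>t. Q x Y (x + t *\<^sub>R p x)) (H x Y \<bullet> Y)
      (D (p x) (D Y (D Y u)) x - 2 * (H x (p x) \<bullet> Y) * (H x Y \<bullet> p x) / (slope (p x))\<^sup>2) c"
      using jet2_Q[OF x, of Y "p x"] by blast
    from QY[OF this] have "D (p x) (D Y (D Y u)) x = 2 * h\<^sup>2 / w\<^sup>2"
      using Hx.sym[of "p x" Y] unfolding h_def w_def by (simp add: power2_eq_square inner_commute)
    then have YYp: "D Y (D Y (D (p x) u)) x = 2 * h\<^sup>2 / w\<^sup>2" using commute3[OF smooth x, of "p x" Y Y] by simp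
    have "c2 = (h\<^sup>2 / w\<^sup>2 - N) / w ^ 3"
      unfolding c2_def YYp using w by (simp add: field_simps power_numeral_reduce)
    moreover have "h\<^sup>2 / w\<^sup>2 < N"
    proof -
      have "H x Y \<noteq> 0" using HYY a by auto
      then have N: "N > 0" unfolding N_def by simp
      have "h\<^sup>2 \<le> N * (p x \<bullet> p x)" unfolding h_def N_def using Cauchy_Schwarz_ineq[of "H x Y" "p x"] by simp
      also have "\<dots> < N * w\<^sup>2" using N unfolding w_def slope_sq by (intro mult_strict_left_mono) auto
      finally show ?thesis using w by (simp add: field_simps)
    qed
    ultimately show ?thesis using w by (simp add: divide_neg_pos)
  qed
  \<comment> \<open>The second derivative of Q / w is w (l k) c2 + 2 b c1 + c / w. Everything but
    the first term, which has the sign of c2, is shown to be nonpositive.\<close>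
  have key: "\<exists>b s. jet2 (\<lambda>t. Q x (y k) (x + t *\<^sub>R Y) * inverse (slope (p (x + t *\<^sub>R Y)))) (l k) b s \<and> s \<le> w * l k * c2"
    if k: "k \<in> E" for k
  proof -
    let ?z = "y k"
    have Hzz: "H x ?z \<bullet> ?z = w * l k" unfolding Hy[OF k] gy[OF k k] by simp
    obtain c where c: "jet2 (\<lambda>t. Q x ?z (x + t *\<^sub>R Y)) (H x ?z \<bullet> ?z)
      (D Y (D ?z (D ?z u)) x - 2 * (H x Y \<bullet> ?z) * (H x ?z \<bullet> p x) / (slope (p x))\<^sup>2) c"
      "H x Y \<bullet> ?z = 0 \<Longrightarrow>
       c = D Y (D Y (D ?z (D ?z u))) x - 2 * D Y (D Y (D ?z u)) x * (H x ?z \<bullet> p x) / (slope (p x))\<^sup>2"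
      using jet2_Q[OF x, of ?z Y] by blast
    define b where "b = D Y (D ?z (D ?z u)) x - 2 * (H x Y \<bullet> ?z) * (H x ?z \<bullet> p x) / (slope (p x))\<^sup>2"
    note J = jet2_mult[OF c(1) jc, folded b_def, unfolded Hzz]
    have "2 * b * c1 + c * (1 / w) \<le> 0"
    proof (cases "k = e")
      case True
      have "b = 0 \<and> c \<le> 0" by (rule QY[OF c(1)[folded b_def, unfolded True Y_def[symmetric]]])
      then show ?thesis using w by (simp add: divide_nonpos_pos)
    next
      case False
      have Yz: "H x Y \<bullet> ?z = 0" using HYk[OF k False] .
      have zY: "H x ?z \<bullet> Y = 0" using Hx.sym[of ?z Y] Yz by (simp add: inner_commute)
      \<comment> \<open>The mirrored situation: Y is moved along \<open>?z\<close>. Its first-order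
        condition removes D^3u(z, Y, Y), and c' contains the same fourth derivative as c, by
        symmetry. So c' = c - 2 b h / w^2, which is w times the quantity to be estimated.\<close>
      obtain c' where c': "jet2 (\<lambda>t. Q x Y (x + t *\<^sub>R ?z)) (H x Y \<bullet> Y)
        (D ?z (D Y (D Y u)) x - 2 * (H x ?z \<bullet> Y) * (H x Y \<bullet> p x) / (slope (p x))\<^sup>2) c'"
        "H x ?z \<bullet> Y = 0 \<Longrightarrow>
         c' = D ?z (D ?z (D Y (D Y u))) x - 2 * D ?z (D ?z (D Y u)) x * (H x Y \<bullet> p x) / (slope (p x))\<^sup>2"
        using jet2_Q[OF x, of Y ?z] by blast
      have zYY: "D ?z (D Y (D Y u)) x = 0" using QY[OF c'(1)] zY by simp
      then have YYz: "D Y (D Y (D ?z u)) x = 0" using commute3[OF smooth x, of ?z Y Y] by simp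
      have bz: "b = D ?z (D ?z (D Y u)) x" unfolding b_def Yz using commute3[OF smooth x, of Y ?z ?z] by simp
      have "c = D ?z (D ?z (D Y (D Y u))) x" using c(2)[OF Yz] YYz commute4[OF smooth x, of Y ?z] by simp
      then have "c - 2 * b * h / w\<^sup>2 \<le> 0" using QY[OF c'(1)] c'(2)[OF zY] unfolding bz h_def w_def by simp
      then have "(c - 2 * b * h / w\<^sup>2) / w \<le> 0" using w by (simp add: divide_nonpos_pos)
      also have "(c - 2 * b * h / w\<^sup>2) / w = 2 * b * c1 + c * (1 / w)"
        unfolding c1_def using w by (simp add: field_simps power2_eq_square power3_eq_cube)
      finally show ?thesis .
    qed
    then have le: "w * l k * c2 + 2 * b * c1 + c * (1 / w) \<le> w * l k * c2" by simp
    have wl: "w * l k * (1 / w) = l k" using w by simp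
    show ?thesis by (rule exI, rule exI, rule conjI[OF J[unfolded wl] le])
  qed
  define \<Psi> where "\<Psi> = (\<lambda>k t. Q x (y k) (x + t *\<^sub>R Y) * inverse (slope (p (x + t *\<^sub>R Y))))"
  obtain b s where bs: "\<And>k. k \<in> E \<Longrightarrow> jet2 (\<Psi> k) (l k) (b k) (s k)" "\<And>k. k \<in> E \<Longrightarrow> s k \<le> w * l k * c2"
  proof -
    have "\<forall>k\<in>E. \<exists>r. jet2 (\<Psi> k) (l k) (fst r) (snd r) \<and> snd r \<le> w * l k * c2"
      using key unfolding \<Psi>_def by (metis (no_types) fst_conv snd_conv)
    then obtain f where "\<forall>k\<in>E. jet2 (\<Psi> k) (l k) (fst (f k)) (snd (f k)) \<and> snd (f k) \<le> w * l k * c2"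
      using bchoice[of E "\<lambda>k r. jet2 (\<Psi> k) (l k) (fst r) (snd r) \<and> snd r \<le> w * l k * c2"] by blast
    then show thesis using that[of "\<lambda>k. fst (f k)" "\<lambda>k. snd (f k)"] by blast
  qed
  \<comment> \<open>The derivatives of arctan at the curvatures, kept fixed along the line. Jensen's
    inequality followed by the tangent inequality shows that this linear combination has a minimum
    at 0.\<close>
  define G where "G = (\<lambda>k. 1 / (1 + (l k)\<^sup>2))"
  have G: "G k > 0" for k unfolding G_def by (simp add: add_pos_nonneg)
  have "jet2 (\<lambda>t. \<Sum>k\<in>E. G k * \<Psi> k t) (\<Sum>k\<in>E. G k * l k) (\<Sum>k\<in>E. G k * b k) (\<Sum>k\<in>E. G k * s k)"
    by (intro jet2_sum jet2_cmult bs)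
  moreover have "\<forall>\<^sub>F t in nhds 0. (\<Sum>k\<in>E. G k * l k) \<le> (\<Sum>k\<in>E. G k * \<Psi> k t)"
    using near[OF x, of Y]
  proof eventually_elim
    case (elim t)
    let ?z = "x + t *\<^sub>R Y"
    interpret Az: psd_operator "graph_curv (p ?z) (H ?z)" by (rule psd_operator_graph_curv[OF psd_hess[OF elim]])
    have fr: "onframe UNIV E (\<lambda>k. metric_sqrt (p ?z) (move_frame (p x) (p ?z) (y k)))"
      by (rule onframe_metric_sqrt[OF finE cardE]) (simp add: graph_metric_move_frame gy)
    have \<Psi>: "graph_curv (p ?z) (H ?z) (metric_sqrt (p ?z) (move_frame (p x) (p ?z) (y k)))
        \<bullet> metric_sqrt (p ?z) (move_frame (p x) (p ?z) (y k)) = \<Psi> k t" for k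
      unfolding graph_curv_metric_sqrt \<Psi>_def Q_def by (simp add: divide_inverse)
    have \<Psi>0: "\<Psi> k t \<ge> 0" for k using Az.psd \<Psi>[of k] by metis
    have "(\<Sum>k\<in>E. arctan (l k)) \<le> (\<Sum>k\<in>E. arctan (\<Psi> k t))"
      using Az.arctan_sum_le_frame[OF fr] unfolding \<Psi> eq[OF elim] using Es eq[OF x] unfolding l_def by simp
    also have "\<dots> \<le> (\<Sum>k\<in>E. arctan (l k) + (\<Psi> k t - l k) / (1 + (l k)\<^sup>2))"
      by (intro sum_mono arctan_le_tangent l0 \<Psi>0)
    also have "\<dots> = (\<Sum>k\<in>E. arctan (l k)) + ((\<Sum>k\<in>E. G k * \<Psi> k t) - (\<Sum>k\<in>E. G k * l k))"
      unfolding G_def by (simp add: sum.distrib diff_divide_distrib sum_subtractf)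
    finally show ?case by simp
  qed
  ultimately have "0 \<le> (\<Sum>k\<in>E. G k * s k)" by (rule jet2_local_min(2))
  also have "\<dots> \<le> (\<Sum>k\<in>E. G k * (w * l k * c2))"
    using bs(2) G by (intro sum_mono mult_left_mono) (auto intro: less_imp_le)
  also have "\<dots> = (w * c2) * (\<Sum>k\<in>E. G k * l k)"
    unfolding sum_distrib_left by (intro sum.cong) auto
  also have "\<dots> < 0"
  proof -
    have "(\<Sum>k\<in>E. G k * l k) > 0"
    proof (rule sum_pos2[OF finE e(1)])
      show "0 < G e * l e" using G le by simp
      show "0 \<le> G k * l k" for k using G[of k] l0[of k] by simp
    qed
    then show ?thesis using w c2neg by (simp add: mult_neg_pos mult_pos_neg)
  qed
  finally show False by simp
qed

end

section \<open>Boundary points of smooth domains\<close>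

text \<open>Directions in which a derivative within \<open>S\<close> is determined by the values on \<open>S\<close>.\<close>

definition approached :: "'a::euclidean_space set \<Rightarrow> 'a \<Rightarrow> 'a \<Rightarrow> bool" where
  "approached S x v \<longleftrightarrow> (\<exists>y t. (\<forall>k::nat. y k \<in> S \<and> t k > (0::real)) \<and> t \<longlonglongrightarrow> 0 \<and>
     (\<lambda>k. (y k - x) /\<^sub>R t k) \<longlonglongrightarrow> v)"

text \<open>For the difference N of the derivatives, the vectors N (y k - x) / t k tend to 0,
  because N is a derivative of the zero function; they also tend to N v.\<close>

lemma has_derivative_unique_approached:
  fixes f :: "'a::euclidean_space \<Rightarrow> 'b::real_normed_vector"
  assumes L: "(f has_derivative L) (at x within S)" and M: "(f has_derivative M) (at x within S)"
    and v: "approached S x v"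
  shows "L v = M v"
proof -
  define N where "N = (\<lambda>h. L h - M h)"
  have "((\<lambda>y. f y - f y) has_derivative N) (at x within S)"
    unfolding N_def using L M by (rule has_derivative_diff)
  then have N: "((\<lambda>y. 0 :: 'b) has_derivative N) (at x within S)" by simp
  have bl: "bounded_linear N" using N has_derivative_bounded_linear by blast
  obtain y t where yt: "\<And>k::nat. y k \<in> S" "\<And>k. t k > (0::real)" "t \<longlonglongrightarrow> 0"
    "(\<lambda>k. (y k - x) /\<^sub>R t k) \<longlonglongrightarrow> v" using v unfolding approached_def by blast
  have "(\<lambda>k. t k *\<^sub>R ((y k - x) /\<^sub>R t k)) \<longlonglongrightarrow> 0 *\<^sub>R v" by (intro tendsto_scaleR yt)
  moreover have "t k *\<^sub>R ((y k - x) /\<^sub>R t k) = y k - x" for k using yt(2)[of k] by simp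
  ultimately have yx: "(\<lambda>k. norm (y k - x)) \<longlonglongrightarrow> 0" by (simp add: tendsto_norm_zero)
  have "norm (N v) \<le> e * norm v" if e: "e > 0" for e
  proof -
    obtain d where d: "d > 0" "\<And>y. y \<in> S \<Longrightarrow> norm (y - x) < d \<Longrightarrow> norm (N (y - x)) \<le> e * norm (y - x)"
      using N e unfolding has_derivative_within_alt by auto
    have "\<forall>\<^sub>F k in sequentially. norm (y k - x) < d"
      using order_tendstoD(2)[OF yx d(1)] .
    then have "\<forall>\<^sub>F k in sequentially. norm (N ((y k - x) /\<^sub>R t k)) \<le> e * norm ((y k - x) /\<^sub>R t k)"
    proof eventually_elim
      case (elim k)
      have "norm (N ((y k - x) /\<^sub>R t k)) = norm (N (y k - x)) / t k"
        using yt(2)[of k] by (simp add: linear_scale[OF bounded_linear.linear[OF bl]] divide_inverse mult.commute)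
      also have "\<dots> \<le> e * norm (y k - x) / t k"
        using d(2)[OF yt(1) elim] yt(2)[of k] by (intro divide_right_mono) auto
      finally show ?case using yt(2)[of k] by (simp add: divide_inverse mult.commute mult.left_commute)
    qed
    then show ?thesis
      by (rule tendsto_le[OF sequentially_bot tendsto_mult[OF tendsto_const tendsto_norm[OF yt(4)]]
            tendsto_norm[OF bounded_linear.tendsto[OF bl yt(4)]]])
  qed
  note small = this
  have "norm (N v) \<le> 0 + \<epsilon>" if "\<epsilon> > 0" for \<epsilon>
  proof (cases "v = 0")
    case True
    then show ?thesis using that linear_0[OF bounded_linear.linear[OF bl]] by simp
  next
    case False
    then show ?thesis using small[of "\<epsilon> / norm v"] that by simp
  qed
  then have "norm (N v) \<le> 0" by (rule field_le_epsilon)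
  then show ?thesis unfolding N_def by simp
qed

lemma approached_ray:
  assumes "\<forall>\<^sub>F t in at_right 0. x + t *\<^sub>R v \<in> S"
  shows "approached S x v"
proof -
  obtain b where b: "b > 0" "\<And>t. 0 < t \<Longrightarrow> t < b \<Longrightarrow> x + t *\<^sub>R v \<in> S"
    using assms unfolding eventually_at_right_field by auto
  define t where "t = (\<lambda>k::nat. b / 2 * inverse (real (Suc k)))"
  have t: "0 < t k" "t k < b" for k
  proof -
    show "0 < t k" unfolding t_def using b(1) by simp
    have "t k \<le> b / 2 * 1" unfolding t_def using b(1) by (intro mult_left_mono) (auto simp: inverse_le_1_iff)
    then show "t k < b" using b(1) by simp
  qed
  have "t \<longlonglongrightarrow> 0" unfolding t_def
    by (rule tendsto_mult_right_zero[OF LIMSEQ_inverse_real_of_nat])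
  moreover have "(\<lambda>k. (x + t k *\<^sub>R v - x) /\<^sub>R t k) = (\<lambda>k. v)" using t(1) by (auto simp: fun_eq_iff less_imp_neq[THEN not_sym])
  ultimately show ?thesis unfolding approached_def
    by (intro exI[of _ "\<lambda>k. x + t k *\<^sub>R v"] exI[of _ t]) (auto simp: t b(2))
qed

lemma local_defining_DERIV:
  assumes ld: "local_defining \<Omega> U \<rho>" and x: "x \<in> U"
  shows "((\<lambda>t. \<rho> (x + t *\<^sub>R v)) has_real_derivative grad_on U \<rho> x \<bullet> v) (at 0)"
proof -
  have U: "open U" "smooth_on U \<rho>" using ld unfolding local_defining_def by auto
  show ?thesis
    using dir_deriv_along_line[OF unique_derivatives_open[OF U(1)] U(2) U(1) order_refl, of x 0 v] x
    by (simp add: inner_grad_on[OF unique_derivatives_open[OF U(1)] U(2) x])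
qed

lemma eventually_line_in_open:
  fixes x v :: "'a::real_normed_vector"
  assumes "open U" "x \<in> U"
  shows "\<forall>\<^sub>F t in at_right (0::real). x + t *\<^sub>R v \<in> U"
proof -
  have "((\<lambda>t. x + t *\<^sub>R v) \<longlongrightarrow> x + 0 *\<^sub>R v) (at_right 0)"
    by (auto intro!: tendsto_eq_intros)
  then show ?thesis using topological_tendstoD[of _ _ "at_right 0" U] assms by simp
qed

lemma local_defining_pos:
  assumes ld: "local_defining \<Omega> U \<rho>" and x: "x \<in> U" "\<rho> x = 0"
  shows "grad_on U \<rho> x \<bullet> v > 0 \<Longrightarrow> \<forall>\<^sub>F t in at_right 0. \<rho> (x + t *\<^sub>R v) > 0 \<and> x + t *\<^sub>R v \<in> \<Omega>"
    and "grad_on U \<rho> x \<bullet> v < 0 \<Longrightarrow> \<forall>\<^sub>F t in at_right 0. \<rho> (x + t *\<^sub>R v) < 0"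
proof -
  note d = local_defining_DERIV[OF ld x(1), of v]
  have U: "open U" "\<Omega> \<inter> U = {y \<in> U. \<rho> y > 0}" using ld unfolding local_defining_def by auto
  {
    assume "grad_on U \<rho> x \<bullet> v > 0"
    from DERIV_pos_inc_right[OF d this] obtain e where e: "e > 0" "\<And>h. 0 < h \<Longrightarrow> h < e \<Longrightarrow> \<rho> (x + h *\<^sub>R v) > 0"
      using x(2) by auto
    then have "\<forall>\<^sub>F t in at_right 0. \<rho> (x + t *\<^sub>R v) > 0" unfolding eventually_at_right_field by auto
    then show "\<forall>\<^sub>F t in at_right 0. \<rho> (x + t *\<^sub>R v) > 0 \<and> x + t *\<^sub>R v \<in> \<Omega>"
      using eventually_line_in_open[OF U(1) x(1), of v] by eventually_elim (use U(2) in auto)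
  }
  {
    assume "grad_on U \<rho> x \<bullet> v < 0"
    from DERIV_neg_dec_right[OF d this] obtain e where e: "e > 0" "\<And>h. 0 < h \<Longrightarrow> h < e \<Longrightarrow> \<rho> (x + h *\<^sub>R v) < 0"
      using x(2) by auto
    then show "\<forall>\<^sub>F t in at_right 0. \<rho> (x + t *\<^sub>R v) < 0" unfolding eventually_at_right_field by auto
  }
qed

lemma local_defining_isCont:
  assumes ld: "local_defining \<Omega> U \<rho>" and x: "x \<in> U"
  shows "isCont \<rho> x"
proof -
  have U: "open U" "smooth_on U \<rho>" using ld unfolding local_defining_def by auto
  show ?thesis using smooth_on_continuous[OF U(2)] U(1) x by (simp add: continuous_on_eq_continuous_at)
qed

text \<open>A point with \<rho> < 0 has a neighbourhood missing \<Omega>, and a point with \<rho> =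
  0 is reached from \<Omega> along the nonzero gradient.\<close>

lemma local_defining_frontier_iff:
  assumes ld: "local_defining \<Omega> U \<rho>" and \<Omega>: "open \<Omega>" and x: "x \<in> U"
  shows "x \<in> frontier \<Omega> \<longleftrightarrow> \<rho> x = 0"
proof
  have U: "open U" "\<Omega> \<inter> U = {y \<in> U. \<rho> y > 0}" "grad_on U \<rho> x \<noteq> 0"
    using ld x unfolding local_defining_def by auto
  {
    assume fr: "x \<in> frontier \<Omega>"
    then have nx: "x \<notin> \<Omega>" and cl: "x \<in> closure \<Omega>" using \<Omega> by (auto simp: frontier_def interior_open)
    then have "\<rho> x \<le> 0" using U(2) x by force
    moreover have "\<not> \<rho> x < 0"
    proof
      assume "\<rho> x < 0"
      then have "\<forall>\<^sub>F y in nhds x. \<rho> y < 0"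
        using local_defining_isCont[OF ld x] order_tendstoD(2)[of \<rho> "\<rho> x" "nhds x" 0]
        by (simp add: isCont_def tendsto_at_iff_tendsto_nhds)
      then have "\<forall>\<^sub>F y in nhds x. \<rho> y < 0 \<and> y \<in> U"
        using eventually_nhds_in_open[OF U(1) x] by (rule eventually_conj)
      then obtain W where W: "open W" "x \<in> W" "\<And>y. y \<in> W \<Longrightarrow> \<rho> y < 0 \<and> y \<in> U"
        unfolding eventually_nhds by blast
      then have "W \<inter> \<Omega> = {}" using U(2) by force
      then show False using cl W(1,2) by (meson disjoint_iff closure_iff_nhds_not_empty[THEN iffD1] open_Int_closure_eq_empty)
    qed
    ultimately show "\<rho> x = 0" by simp
  }
  {
    assume 0: "\<rho> x = 0"
    then have nx: "x \<notin> \<Omega>" using U(2) x by force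
    have ev: "\<forall>\<^sub>F t in at_right 0. x + t *\<^sub>R grad_on U \<rho> x \<in> \<Omega>"
      using local_defining_pos(1)[OF ld x 0, of "grad_on U \<rho> x"] U(3) by (auto elim: eventually_mono)
    have "((\<lambda>t. x + t *\<^sub>R grad_on U \<rho> x) \<longlongrightarrow> x + 0 *\<^sub>R grad_on U \<rho> x) (at_right 0)"
      by (auto intro!: tendsto_eq_intros)
    then have "x \<in> closure \<Omega>"
      using Lim_in_closed_set[OF closed_closure[of \<Omega>] _ trivial_limit_at_right_real] ev closure_subset[of \<Omega>]
      by (smt (verit, best) add.right_neutral eventually_mono scale_zero_left subsetD)
    then show "x \<in> frontier \<Omega>" using nx \<Omega> by (simp add: frontier_def interior_open)
  }
qed

text \<open>This replaces a parametrisation of the boundary. On the segment x + t (v + s n), |s|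
  \<le> \<epsilon>, with small t, \<rho> changes sign, so the intermediate value theorem gives a
  boundary point whose difference quotient v + s n is close to v.\<close>

lemma local_defining_tangent_approached:
  assumes ld: "local_defining \<Omega> U \<rho>" and \<Omega>: "open \<Omega>" and x: "x \<in> U" "x \<in> frontier \<Omega>"
    and v: "grad_on U \<rho> x \<bullet> v = 0"
  shows "approached (frontier \<Omega>) x v"
proof -
  have U: "open U" "grad_on U \<rho> x \<noteq> 0" using ld x unfolding local_defining_def by auto
  have 0: "\<rho> x = 0" using local_defining_frontier_iff[OF ld \<Omega> x(1)] x(2) by blast
  define n where "n = grad_on U \<rho> x"
  have nn: "n \<bullet> n > 0" using U(2) unfolding n_def by simp
  obtain r where r: "r > 0" "ball x r \<subseteq> U" using U(1) x(1) openE by blast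
  have ex: "\<exists>t s. 0 < t \<and> t < \<epsilon> \<and> \<bar>s\<bar> \<le> \<epsilon> \<and> x + t *\<^sub>R (v + s *\<^sub>R n) \<in> frontier \<Omega>" if e: "\<epsilon> > 0" for \<epsilon> :: real
  proof -
    \<comment> \<open>K exceeds |v + s n| for all |s| \<le> \<epsilon>, so t < r / K keeps the whole
      segment in the ball inside U.\<close>
    define K where "K = norm v + \<epsilon> * norm n + 1"
    have K: "K > 0" unfolding K_def using e by (simp add: add_nonneg_pos)
    have p1: "n \<bullet> (v + \<epsilon> *\<^sub>R n) > 0" and p2: "n \<bullet> (v + (- \<epsilon>) *\<^sub>R n) < 0"
      using v e nn unfolding n_def by (auto simp: inner_add_right inner_diff_right)
    have "\<forall>\<^sub>F t in at_right 0. \<rho> (x + t *\<^sub>R (v + \<epsilon> *\<^sub>R n)) > 0 \<and> \<rho> (x + t *\<^sub>R (v + (- \<epsilon>) *\<^sub>R n)) < 0 \<and> 0 < t \<and> t < \<epsilon> \<and> t < r / K"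
      using local_defining_pos(1)[OF ld x(1) 0, folded n_def, OF p1]
        local_defining_pos(2)[OF ld x(1) 0, folded n_def, OF p2]
        eventually_at_right_less[of "0::real"] eventually_at_rightI[of 0 \<epsilon> "\<lambda>t. t < \<epsilon>"]
        eventually_at_rightI[of 0 "r / K" "\<lambda>t. t < r / K"] e K r(1)
      by (auto simp: eventually_conj_iff elim: eventually_mono)
    then obtain t where t: "\<rho> (x + t *\<^sub>R (v + \<epsilon> *\<^sub>R n)) > 0" "\<rho> (x + t *\<^sub>R (v + (- \<epsilon>) *\<^sub>R n)) < 0"
      "0 < t" "t < \<epsilon>" "t < r / K"
      using eventually_happens[of _ "at_right (0::real)"] trivial_limit_at_right_real by blast
    have inU: "x + t *\<^sub>R (v + s *\<^sub>R n) \<in> U" if "\<bar>s\<bar> \<le> \<epsilon>" for s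
    proof -
      have "norm (v + s *\<^sub>R n) \<le> norm v + \<bar>s\<bar> * norm n" by (metis norm_scaleR norm_triangle_ineq)
      also have "\<dots> < K" unfolding K_def using that using mult_right_mono[OF that, of "norm n"] by simp
      finally have "t * norm (v + s *\<^sub>R n) < t * K" using t(3) by simp
      also have "\<dots> < r" using t(5) K by (simp add: field_simps)
      finally show ?thesis using r(2) t(3) by (auto simp: dist_norm)
    qed
    have "continuous_on {-\<epsilon>..\<epsilon>} (\<lambda>s. \<rho> (x + t *\<^sub>R (v + s *\<^sub>R n)))"
    proof (rule continuous_at_imp_continuous_on, rule ballI)
      fix s assume "s \<in> {-\<epsilon>..\<epsilon>}"
      then have \<rho>: "isCont \<rho> (x + t *\<^sub>R (v + s *\<^sub>R n))" by (intro local_defining_isCont[OF ld] inU) auto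
      have "isCont (\<lambda>s. x + t *\<^sub>R (v + s *\<^sub>R n)) s" by (intro continuous_intros)
      then show "isCont (\<lambda>s. \<rho> (x + t *\<^sub>R (v + s *\<^sub>R n))) s" using \<rho> by (rule isCont_o2)
    qed
    then obtain s where s: "- \<epsilon> \<le> s" "s \<le> \<epsilon>" "\<rho> (x + t *\<^sub>R (v + s *\<^sub>R n)) = 0"
      using IVT'[of "\<lambda>s. \<rho> (x + t *\<^sub>R (v + s *\<^sub>R n))" "- \<epsilon>" 0 \<epsilon>, OF less_imp_le[OF t(2)] less_imp_le[OF t(1)]] e
      by auto
    then have "x + t *\<^sub>R (v + s *\<^sub>R n) \<in> frontier \<Omega>"
      using local_defining_frontier_iff[OF ld \<Omega> inU[of s]] by auto
    then show ?thesis using t s by (intro exI[of _ t] exI[of _ s]) auto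
  qed
  define e where "e = (\<lambda>k::nat. 1 / real (Suc k))"
  have "\<forall>k. \<exists>z. 0 < fst z \<and> fst z < e k \<and> \<bar>snd z\<bar> \<le> e k \<and> x + fst z *\<^sub>R (v + snd z *\<^sub>R n) \<in> frontier \<Omega>"
    using ex[of "e _"] unfolding e_def by simp
  then obtain z where z: "\<And>k. 0 < fst (z k)" "\<And>k. fst (z k) < e k" "\<And>k. \<bar>snd (z k)\<bar> \<le> e k"
    "\<And>k. x + fst (z k) *\<^sub>R (v + snd (z k) *\<^sub>R n) \<in> frontier \<Omega>"
    by (metis (no_types))
  have e0: "e \<longlonglongrightarrow> 0" unfolding e_def using LIMSEQ_inverse_real_of_nat by (simp add: divide_inverse)
  have t0: "(\<lambda>k. fst (z k)) \<longlonglongrightarrow> 0"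
    by (rule tendsto_sandwich[OF _ _ tendsto_const e0]) (use z in \<open>auto intro: less_imp_le always_eventually\<close>)
  have s0: "(\<lambda>k. snd (z k)) \<longlonglongrightarrow> 0"
    by (rule tendsto_rabs_zero_cancel, rule tendsto_sandwich[OF _ _ tendsto_const e0]) (use z in auto)
  have "(\<lambda>k. v + snd (z k) *\<^sub>R n) \<longlonglongrightarrow> v + 0 *\<^sub>R n" by (intro tendsto_intros s0)
  moreover have "(x + fst (z k) *\<^sub>R (v + snd (z k) *\<^sub>R n) - x) /\<^sub>R fst (z k) = v + snd (z k) *\<^sub>R n" for k
    using z(1)[of k] by simp
  ultimately show ?thesis unfolding approached_def using z(1,4) t0
    by (intro exI[of _ "\<lambda>k. x + fst (z k) *\<^sub>R (v + snd (z k) *\<^sub>R n)"] exI[of _ "\<lambda>k. fst (z k)"]) auto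
qed

text \<open>At a boundary point all directions with n . v > 0 enter \<Omega>, so a derivative of 0
  vanishes on them. They span: any v becomes such a direction after adding a multiple of n.\<close>

lemma unique_derivatives_closure:
  assumes \<Omega>: "bounded_smooth_domain \<Omega>"
  shows "unique_derivatives (closure \<Omega>)"
  unfolding unique_derivatives_def
proof (intro ballI allI impI)
  fix x L assume x: "x \<in> closure \<Omega>" and L: "((\<lambda>_. 0 :: real) has_derivative L) (at x within closure \<Omega>)"
  have op: "open \<Omega>" using \<Omega> unfolding bounded_smooth_domain_def by blast
  have lin: "linear L" using L has_derivative_linear by blast
  have app: "L v = 0" if "\<forall>\<^sub>F t in at_right 0. x + t *\<^sub>R v \<in> \<Omega>" for v
  proof -
    have "approached (closure \<Omega>) x v"
      by (rule approached_ray, rule eventually_mono[OF that]) (use closure_subset in blast)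
    then show ?thesis using has_derivative_unique_approached[OF L has_derivative_const] by blast
  qed
  show "L = (\<lambda>_. 0)"
  proof (cases "x \<in> \<Omega>")
    case True
    then show ?thesis using app eventually_line_in_open[OF op True] by blast
  next
    case False
    then have "x \<in> frontier \<Omega>" using x op by (simp add: frontier_def interior_open)
    then obtain U \<rho> where ld: "x \<in> U" "local_defining \<Omega> U \<rho>"
      using \<Omega> unfolding bounded_smooth_domain_def by blast
    have 0: "\<rho> x = 0" using local_defining_frontier_iff[OF ld(2) op ld(1)] \<open>x \<in> frontier \<Omega>\<close> by blast
    define n where "n = grad_on U \<rho> x"
    have nn: "n \<bullet> n > 0" using ld unfolding n_def local_defining_def by auto
    have pos: "L v = 0" if "n \<bullet> v > 0" for v
      by (rule app, rule eventually_mono[OF local_defining_pos(1)[OF ld(2,1) 0, folded n_def, OF that]]) blast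
    show ?thesis
    proof
      fix v
      define k where "k = (\<bar>n \<bullet> v\<bar> + 1) / (n \<bullet> n)"
      have "n \<bullet> (v + k *\<^sub>R n) = n \<bullet> v + (\<bar>n \<bullet> v\<bar> + 1)" unfolding k_def using nn by (simp add: inner_add_right)
      then have "L (v + k *\<^sub>R n) = 0" by (intro pos) linarith
      moreover have "L n = 0" using pos nn by blast
      ultimately show "L v = 0" by (simp add: linear_add[OF lin] linear_scale[OF lin])
    qed
  qed
qed

text \<open>If two defining functions had different unit gradients, the difference of these unit
  vectors would enter \<Omega> according to one function and leave it according to the
  other.\<close>

lemma inward_normal_eq:
  assumes \<Omega>: "open \<Omega>" and ld: "local_defining \<Omega> U \<rho>" and x: "x \<in> U" "x \<in> frontier \<Omega>"
  shows "inward_normal \<Omega> x = sgn (grad_on U \<rho> x)"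
  unfolding inward_normal_def
proof (rule the_equality)
  show "\<exists>U' \<rho>'. x \<in> U' \<and> local_defining \<Omega> U' \<rho>' \<and> sgn (grad_on U \<rho> x) = sgn (grad_on U' \<rho>' x)"
    using ld x by blast
  fix v assume "\<exists>U' \<rho>'. x \<in> U' \<and> local_defining \<Omega> U' \<rho>' \<and> v = sgn (grad_on U' \<rho>' x)"
  then obtain U' \<rho>' where ld': "x \<in> U'" "local_defining \<Omega> U' \<rho>'" "v = sgn (grad_on U' \<rho>' x)" by blast
  define n n' where "n = grad_on U \<rho> x" and "n' = grad_on U' \<rho>' x"
  have nz: "n \<noteq> 0" "n' \<noteq> 0" using ld ld' x unfolding n_def n'_def local_defining_def by auto
  have 0: "\<rho> x = 0" "\<rho>' x = 0"
    using local_defining_frontier_iff[OF ld \<Omega> x(1)] local_defining_frontier_iff[OF ld'(2) \<Omega> ld'(1)] x(2) by auto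
  show "v = sgn (grad_on U \<rho> x)"
  proof (rule ccontr)
    assume "v \<noteq> sgn (grad_on U \<rho> x)"
    then have ne: "sgn n \<noteq> sgn n'" unfolding n_def n'_def ld'(3) by auto
    define d where "d = sgn n - sgn n'"
    have u: "sgn n \<bullet> sgn n = 1" "sgn n' \<bullet> sgn n' = 1" using nz by (auto simp: norm_eq_1[symmetric] norm_sgn)
    have "d \<bullet> d > 0" using ne unfolding d_def by simp
    then have lt: "sgn n \<bullet> sgn n' < 1" unfolding d_def using u by (simp add: inner_diff_left inner_diff_right inner_commute)
    have ns: "n = norm n *\<^sub>R sgn n" "n' = norm n' *\<^sub>R sgn n'" using nz by (auto simp: sgn_div_norm)
    have "n \<bullet> d = norm n * (sgn n \<bullet> d)" by (subst ns(1)) simp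
    then have p: "n \<bullet> d > 0" using lt u nz unfolding d_def by (simp add: inner_diff_right)
    have "n' \<bullet> d = norm n' * (sgn n' \<bullet> d)" by (subst ns(2)) simp
    then have q: "n' \<bullet> d < 0" using lt u nz unfolding d_def by (simp add: inner_diff_right inner_commute mult_pos_neg)
    have "\<forall>\<^sub>F t in at_right 0. \<rho>' (x + t *\<^sub>R d) < 0 \<and> x + t *\<^sub>R d \<in> \<Omega> \<and> x + t *\<^sub>R d \<in> U'"
      using local_defining_pos(1)[OF ld x(1) 0(1), folded n_def, OF p]
        local_defining_pos(2)[OF ld'(2,1) 0(2), folded n'_def, OF q]
        eventually_line_in_open[of U' x d] ld'(1,2) unfolding local_defining_def
      by (auto simp: eventually_conj_iff elim: eventually_mono)
    then obtain t where t: "\<rho>' (x + t *\<^sub>R d) < 0" "x + t *\<^sub>R d \<in> \<Omega>" "x + t *\<^sub>R d \<in> U'"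
      using eventually_happens[of _ "at_right (0::real)"] trivial_limit_at_right_real by blast
    then have "\<rho>' (x + t *\<^sub>R d) > 0" using ld'(2) unfolding local_defining_def by blast
    then show False using t(1) by simp
  qed
qed

section \<open>The boundary operators\<close>

lemma norm_sum_basis_le:
  fixes L :: "'a::euclidean_space \<Rightarrow> 'b::real_normed_vector"
  assumes "linear L"
  shows "norm (L v) \<le> (\<Sum>b\<in>Basis. norm (L b)) * norm v"
proof -
  have "L v = L (\<Sum>b\<in>Basis. (v \<bullet> b) *\<^sub>R b)" by (simp add: euclidean_representation)
  also have "\<dots> = (\<Sum>b\<in>Basis. (v \<bullet> b) *\<^sub>R L b)" by (simp add: linear_sum[OF assms] linear_scale[OF assms])
  also have "norm \<dots> \<le> (\<Sum>b\<in>Basis. norm v * norm (L b))"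
    by (intro sum_norm_le) (auto intro!: mult_right_mono Basis_le_norm)
  finally show ?thesis by (simp flip: sum_distrib_left add: mult.commute)
qed

text \<open>Joins local bounds that come from different defining functions: over a finite subcover
  the sum of their absolute values dominates each of them.\<close>

lemma compact_uniform_bound:
  fixes P :: "'a::topological_space \<Rightarrow> real \<Rightarrow> bool"
  assumes K: "compact K" and mono: "\<And>x B B'. P x B \<Longrightarrow> B \<le> B' \<Longrightarrow> P x B'"
    and loc: "\<And>x. x \<in> K \<Longrightarrow> \<exists>U B. open U \<and> x \<in> U \<and> (\<forall>y\<in>U \<inter> K. P y B)"
  shows "\<exists>B. \<forall>x\<in>K. P x B"
proof -
  define C where "C = {U. open U \<and> (\<exists>B. \<forall>y\<in>U \<inter> K. P y B)}"
  have C: "K \<subseteq> \<Union>C" "\<And>U. U \<in> C \<Longrightarrow> open U" using loc unfolding C_def by blast+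
  obtain F where F: "F \<subseteq> C" "finite F" "K \<subseteq> \<Union>F"
    using compactE[OF K C] by blast
  have "\<forall>U\<in>F. \<exists>B. \<forall>y\<in>U \<inter> K. P y B" using F(1) unfolding C_def by blast
  then obtain B where B: "\<And>U y. U \<in> F \<Longrightarrow> y \<in> U \<inter> K \<Longrightarrow> P y (B U)" by metis
  have "P x (\<Sum>U\<in>F. \<bar>B U\<bar>)" if x: "x \<in> K" for x
  proof -
    obtain U where U: "U \<in> F" "x \<in> U" using F(3) x by blast
    have "B U \<le> \<bar>B U\<bar>" by simp
    also have "\<dots> \<le> (\<Sum>U\<in>F. \<bar>B U\<bar>)" using F(2) U(1) by (intro member_le_sum) auto
    finally show ?thesis using mono[OF B[OF U(1)]] U(2) x by blast
  qed
  then show ?thesis by blast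
qed

lemma smooth_on_continuous_hess:
  assumes S: "unique_derivatives S" and f: "smooth_on S f"
  shows "continuous_on S (\<lambda>x. hess_on S f x v)"
proof -
  have "continuous_on S (\<lambda>x. \<Sum>b\<in>Basis. dir_deriv S v (dir_deriv S b f) x *\<^sub>R b)"
    by (intro continuous_on_sum continuous_on_scaleR continuous_on_const smooth_on_continuous
        smooth_on_dir_deriv S f)
  moreover have "hess_on S f x v = (\<Sum>b\<in>Basis. dir_deriv S v (dir_deriv S b f) x *\<^sub>R b)" if "x \<in> S" for x
    by (subst euclidean_representation[symmetric, of "hess_on S f x v"])
      (simp add: inner_hess_on[OF S f that])
  ultimately show ?thesis by (simp cong: continuous_on_cong)
qed

lemma smooth_on_continuous_grad:
  assumes S: "unique_derivatives S" and f: "smooth_on S f"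
  shows "continuous_on S (grad_on S f)"
  using has_derivative_grad_on[OF assms] by (rule has_derivative_continuous_on)

lemma has_derivative_sgn_comp:
  fixes G :: "'a::real_normed_vector \<Rightarrow> 'b::real_inner"
  assumes G: "(G has_derivative W) (at x within S)" and nz: "G x \<noteq> 0"
  shows "((\<lambda>y. sgn (G y)) has_derivative
     (\<lambda>h. (1 / norm (G x)) *\<^sub>R (W h - (W h \<bullet> sgn (G x)) *\<^sub>R sgn (G x)))) (at x within S)"
proof -
  have n: "((\<lambda>y. norm (G y)) has_derivative (\<lambda>h. W h \<bullet> sgn (G x))) (at x within S)"
    using has_derivative_compose[OF G has_derivative_norm[OF nz]] by simp
  have "((\<lambda>y. inverse (norm (G y)) *\<^sub>R G y) has_derivative
      (\<lambda>h. inverse (norm (G x)) *\<^sub>R W h + (- (inverse (norm (G x)) * (W h \<bullet> sgn (G x)) * inverse (norm (G x)))) *\<^sub>R G x))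
      (at x within S)"
    using nz by (intro has_derivative_scaleR Deriv.has_derivative_inverse n G) auto
  then show ?thesis
    unfolding sgn_div_norm by (simp add: divide_inverse algebra_simps)
qed

section \<open>Normal, tangent space and shape operator of the boundary\<close>

locale smooth_domain =
  fixes \<Omega> :: "'a::euclidean_space set"
  assumes dom: "bounded_smooth_domain \<Omega>"
begin

abbreviation "\<nu> \<equiv> inward_normal \<Omega>"
abbreviation "T \<equiv> tangent_space \<Omega>"
abbreviation "P \<equiv> tproj \<Omega>"

lemma openD: "open \<Omega>" using dom unfolding bounded_smooth_domain_def by blast

lemma local_def:
  assumes "x \<in> frontier \<Omega>"
  obtains U \<rho> where "x \<in> U" "local_defining \<Omega> U \<rho>" "\<nu> x = sgn (grad_on U \<rho> x)" "grad_on U \<rho> x \<noteq> 0"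
proof -
  obtain U \<rho> where "x \<in> U" "local_defining \<Omega> U \<rho>"
    using dom assms unfolding bounded_smooth_domain_def by blast
  then show thesis using that inward_normal_eq[OF openD _ _ assms] unfolding local_defining_def by blast
qed

lemma normal_unit: assumes "x \<in> frontier \<Omega>" shows "\<nu> x \<bullet> \<nu> x = 1"
proof -
  obtain U \<rho> where "\<nu> x = sgn (grad_on U \<rho> x)" "grad_on U \<rho> x \<noteq> 0" using local_def[OF assms] .
  then show ?thesis by (simp add: norm_sgn flip: norm_eq_1)
qed

lemma norm_normal: "x \<in> frontier \<Omega> \<Longrightarrow> norm (\<nu> x) = 1"
  using normal_unit by (simp add: norm_eq_1)

lemma tangent_approached:
  assumes x: "x \<in> frontier \<Omega>" and v: "v \<bullet> \<nu> x = 0"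
  shows "approached (frontier \<Omega>) x v"
proof -
  obtain U \<rho> where ld: "x \<in> U" "local_defining \<Omega> U \<rho>" "\<nu> x = sgn (grad_on U \<rho> x)" "grad_on U \<rho> x \<noteq> 0"
    using local_def[OF x] .
  have "grad_on U \<rho> x \<bullet> v = 0" using v ld(3,4) by (simp add: sgn_div_norm inner_commute)
  then show ?thesis by (rule local_defining_tangent_approached[OF ld(2) openD ld(1) x])
qed

lemma linear_P: "linear (P x)"
  unfolding tproj_def by (intro linearI) (auto simp: inner_add_left algebra_simps)

lemma P_tangent: "x \<in> frontier \<Omega> \<Longrightarrow> P x v \<bullet> \<nu> x = 0"
  unfolding tproj_def by (simp add: inner_diff_left normal_unit)

lemma P_in_T: "x \<in> frontier \<Omega> \<Longrightarrow> P x v \<in> T x"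
  unfolding tangent_space_def by (simp add: P_tangent)

lemma P_id: "v \<bullet> \<nu> x = 0 \<Longrightarrow> P x v = v"
  unfolding tproj_def by simp

lemma P_sym: "P x v \<bullet> w = v \<bullet> P x w"
  unfolding tproj_def by (simp add: inner_diff_left inner_diff_right inner_commute)

lemma norm_P_le: assumes x: "x \<in> frontier \<Omega>" shows "norm (P x v) \<le> norm v"
proof -
  have "P x v \<bullet> P x v = v \<bullet> v - (v \<bullet> \<nu> x)\<^sup>2"
    using normal_unit[OF x] unfolding tproj_def
    by (simp add: inner_diff_left inner_diff_right inner_commute power2_eq_square)
  then have "(norm (P x v))\<^sup>2 \<le> (norm v)\<^sup>2" by (simp add: power2_norm_eq_inner)
  then show ?thesis by (simp add: power2_le_iff_abs_le)
qed

lemma subspace_T: "subspace (T x)"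
  unfolding tangent_space_def subspace_def by (auto simp: inner_add_left)

lemma dim_T: assumes x: "x \<in> frontier \<Omega>" shows "dim (T x) = DIM('a) - 1"
proof -
  have "\<nu> x \<noteq> 0" using normal_unit[OF x] by auto
  then show ?thesis using dim_hyperplane[of "\<nu> x"] unfolding tangent_space_def by (simp add: inner_commute)
qed

lemma normal_has_derivative:
  assumes ld: "local_defining \<Omega> U \<rho>" and x: "x \<in> U" "x \<in> frontier \<Omega>"
  shows "(\<nu> has_derivative (\<lambda>h. (1 / norm (grad_on U \<rho> x)) *\<^sub>R
      (hess_on U \<rho> x h - (hess_on U \<rho> x h \<bullet> \<nu> x) *\<^sub>R \<nu> x))) (at x within frontier \<Omega>)"
proof -
  have U: "open U" "smooth_on U \<rho>" "grad_on U \<rho> x \<noteq> 0" using ld x unfolding local_defining_def by auto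
  have \<nu>: "sgn (grad_on U \<rho> y) = \<nu> y" if "y \<in> U" "y \<in> frontier \<Omega>" for y
    using inward_normal_eq[OF openD ld that] ..
  have "(grad_on U \<rho> has_derivative hess_on U \<rho> x) (at x within U)"
    by (rule has_derivative_grad_on[OF unique_derivatives_open[OF U(1)] U(2) x(1)])
  then have "(grad_on U \<rho> has_derivative hess_on U \<rho> x) (at x within frontier \<Omega>)"
    using U(1) x(1) by (metis at_within_open has_derivative_at_withinI)
  from has_derivative_sgn_comp[OF this U(3)]
  have d: "((\<lambda>y. sgn (grad_on U \<rho> y)) has_derivative (\<lambda>h. (1 / norm (grad_on U \<rho> x)) *\<^sub>R
      (hess_on U \<rho> x h - (hess_on U \<rho> x h \<bullet> \<nu> x) *\<^sub>R \<nu> x))) (at x within frontier \<Omega>)"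
    unfolding \<nu>[OF x] .
  obtain r where r: "r > 0" "ball x r \<subseteq> U" using U(1) x(1) openE by blast
  show ?thesis
    by (rule has_derivative_transform_within[OF d r(1) x(2)])
      (intro \<nu> subsetD[OF r(2)], auto simp: dist_commute)
qed

lemma shape_op_local:
  assumes ld: "local_defining \<Omega> U \<rho>" and x: "x \<in> U" "x \<in> frontier \<Omega>"
  shows "shape_op \<Omega> x \<xi> = - ((1 / norm (grad_on U \<rho> x)) *\<^sub>R
      (hess_on U \<rho> x (P x \<xi>) - (hess_on U \<rho> x (P x \<xi>) \<bullet> \<nu> x) *\<^sub>R \<nu> x))"
proof -
  note d = normal_has_derivative[OF assms]
  then have "(\<nu> has_derivative frechet_derivative \<nu> (at x within frontier \<Omega>)) (at x within frontier \<Omega>)"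
    using frechet_derivative_works differentiable_def by blast
  from has_derivative_unique_approached[OF this d tangent_approached[OF x(2) P_tangent[OF x(2)]]]
  show ?thesis unfolding shape_op_def by simp
qed

text \<open>The constant through which the boundary geometry enters the estimates. Locally the shape
  operator is, up to sign, the tangential part of D^2 \<rho> / |D \<rho>|, which is bounded near
  each boundary point.\<close>

lemma shape_op_bounded: "\<exists>B. \<forall>x\<in>frontier \<Omega>. \<forall>\<xi>. norm (shape_op \<Omega> x \<xi>) \<le> B * norm \<xi>"
proof (rule compact_uniform_bound)
  show "compact (frontier \<Omega>)" using dom unfolding bounded_smooth_domain_def by (simp add: compact_frontier_bounded)
  show "\<forall>\<xi>. norm (shape_op \<Omega> x \<xi>) \<le> B' * norm \<xi>" if "\<forall>\<xi>. norm (shape_op \<Omega> x \<xi>) \<le> B * norm \<xi>" "B \<le> B'" for x B B'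
    using that by (meson mult_right_mono norm_ge_zero order_trans)
  fix x assume x: "x \<in> frontier \<Omega>"
  obtain U \<rho> where ld: "x \<in> U" "local_defining \<Omega> U \<rho>" using local_def[OF x] by metis
  have U: "open U" "smooth_on U \<rho>" "\<And>y. y \<in> U \<Longrightarrow> grad_on U \<rho> y \<noteq> 0" using ld(2) unfolding local_defining_def by auto
  note ud = unique_derivatives_open[OF U(1)]
  define m where "m = (\<lambda>y. (\<Sum>b\<in>Basis. norm (hess_on U \<rho> y b)) / norm (grad_on U \<rho> y))"
  have "continuous_on U m" unfolding m_def
    by (intro continuous_intros smooth_on_continuous_hess[OF ud U(2)] smooth_on_continuous_grad[OF ud U(2)]) (simp add: U(3))
  then have "isCont m x" using U(1) ld(1) by (simp add: continuous_on_eq_continuous_at)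
  then have "(m \<longlongrightarrow> m x) (nhds x)" by (simp add: isCont_def tendsto_at_iff_tendsto_nhds)
  then have "\<forall>\<^sub>F y in nhds x. m y < m x + 1" by (rule order_tendstoD) simp
  then have "\<forall>\<^sub>F y in nhds x. m y < m x + 1 \<and> y \<in> U"
    using eventually_nhds_in_open[OF U(1) ld(1)] by (rule eventually_conj)
  then obtain W where W: "open W" "x \<in> W" "\<And>y. y \<in> W \<Longrightarrow> m y < m x + 1 \<and> y \<in> U"
    unfolding eventually_nhds by blast
  have "norm (shape_op \<Omega> y \<xi>) \<le> (m x + 1) * norm \<xi>" if y: "y \<in> W" "y \<in> frontier \<Omega>" for y \<xi>
  proof -
    have yU: "y \<in> U" using W(3)[OF y(1)] by simp
    define h where "h = hess_on U \<rho> y (P y \<xi>)"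
    have g: "norm (grad_on U \<rho> y) > 0" using U(3)[OF yU] by simp
    have "norm (shape_op \<Omega> y \<xi>) = norm (P y h) / norm (grad_on U \<rho> y)"
      unfolding shape_op_local[OF ld(2) yU y(2)] h_def[symmetric] tproj_def[symmetric] by simp
    also have "\<dots> \<le> norm h / norm (grad_on U \<rho> y)" using norm_P_le[OF y(2)] g by (simp add: divide_right_mono)
    also have "norm h \<le> (\<Sum>b\<in>Basis. norm (hess_on U \<rho> y b)) * norm (P y \<xi>)"
      unfolding h_def by (rule norm_sum_basis_le[OF linear_hess_on[OF ud U(2) yU]])
    also have "\<dots> \<le> (\<Sum>b\<in>Basis. norm (hess_on U \<rho> y b)) * norm \<xi>"
      by (intro mult_left_mono norm_P_le[OF y(2)] sum_nonneg) auto
    finally have "norm (shape_op \<Omega> y \<xi>) \<le> m y * norm \<xi>" using g unfolding m_def by (simp add: divide_right_mono)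
    also have "\<dots> \<le> (m x + 1) * norm \<xi>" using W(3)[OF y(1)] by (intro mult_right_mono) auto
    finally show ?thesis .
  qed
  then show "\<exists>U B. open U \<and> x \<in> U \<and> (\<forall>y\<in>U \<inter> frontier \<Omega>. \<forall>\<xi>. norm (shape_op \<Omega> y \<xi>) \<le> B * norm \<xi>)"
    using W(1,2) by (intro exI[of _ W] exI[of _ "m x + 1"]) auto
qed

end

section \<open>Boundary values of a smooth function and its norms\<close>

locale smooth_domain_fun = smooth_domain +
  fixes u :: "'a \<Rightarrow> real"
  assumes smooth_u: "smooth_on (closure \<Omega>) u"
begin

abbreviation "p \<equiv> grad_on (closure \<Omega>) u"
abbreviation "H \<equiv> hess_on (closure \<Omega>) u"
abbreviation "s \<equiv> \<lambda>x. p x \<bullet> \<nu> x"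

lemma ud: "unique_derivatives (closure \<Omega>)" by (rule unique_derivatives_closure[OF dom])

lemma frontier_closure: "x \<in> frontier \<Omega> \<Longrightarrow> x \<in> closure \<Omega>" by (simp add: frontier_def)

lemma tgrad_eq: assumes x: "x \<in> frontier \<Omega>" shows "tgrad \<Omega> u x = P x (p x)"
proof -
  note xc = frontier_closure[OF x]
  have "(u has_derivative (\<lambda>h. p x \<bullet> h)) (at x within closure \<Omega>)"
    using smooth_on_has_derivative[OF ud smooth_u xc] by (simp add: inner_grad_on[OF ud smooth_u xc])
  then have d: "(u has_derivative (\<lambda>h. p x \<bullet> h)) (at x within frontier \<Omega>)"
    by (rule has_derivative_subset) (simp add: frontier_def)
  then have "(u has_derivative frechet_derivative u (at x within frontier \<Omega>)) (at x within frontier \<Omega>)"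
    using frechet_derivative_works differentiable_def by blast
  from has_derivative_unique_approached[OF this d tangent_approached[OF x P_tangent[OF x]]]
  have "frechet_derivative u (at x within frontier \<Omega>) (P x b) = P x (p x) \<bullet> b" for b by (simp add: P_sym)
  then show ?thesis unfolding tgrad_def by (simp add: euclidean_representation)
qed

text \<open>The Gauss formula: when p - s \<nu> is differentiated along the boundary and projected,
  the derivative of s drops out, and -s times the derivative of \<nu> is s times the shape operator.
  Therefore M(x, s) at the actual normal derivative s is the tangential block of D^2u.\<close>

lemma boundary_hess_eq:
  assumes x: "x \<in> frontier \<Omega>"
  shows "boundary_hess \<Omega> u x \<xi> = P x (H x (P x \<xi>)) + s x *\<^sub>R shape_op \<Omega> x \<xi>"
proof -
  note xc = frontier_closure[OF x]
  obtain U \<rho> where ld: "x \<in> U" "local_defining \<Omega> U \<rho>" using local_def[OF x] by metis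
  define N where "N = (\<lambda>h. (1 / norm (grad_on U \<rho> x)) *\<^sub>R
      (hess_on U \<rho> x h - (hess_on U \<rho> x h \<bullet> \<nu> x) *\<^sub>R \<nu> x))"
  have N: "(\<nu> has_derivative N) (at x within frontier \<Omega>)"
    unfolding N_def by (rule normal_has_derivative[OF ld(2,1) x])
  have shape: "shape_op \<Omega> x \<xi> = - N (P x \<xi>)" unfolding N_def by (rule shape_op_local[OF ld(2,1) x])
  have N\<nu>: "N h \<bullet> \<nu> x = 0" for h unfolding N_def by (simp add: inner_diff_left normal_unit[OF x])
  have pd: "(p has_derivative H x) (at x within frontier \<Omega>)"
    by (rule has_derivative_subset[OF has_derivative_grad_on[OF ud smooth_u xc]]) (simp add: frontier_def)
  have d: "((\<lambda>y. p y - s y *\<^sub>R \<nu> y) has_derivative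
     (\<lambda>h. H x h - (s x *\<^sub>R N h + (p x \<bullet> N h + H x h \<bullet> \<nu> x) *\<^sub>R \<nu> x))) (at x within frontier \<Omega>)"
    by (intro has_derivative_diff has_derivative_scaleR has_derivative_inner pd N)
  have "(tgrad \<Omega> u has_derivative
     (\<lambda>h. H x h - (s x *\<^sub>R N h + (p x \<bullet> N h + H x h \<bullet> \<nu> x) *\<^sub>R \<nu> x))) (at x within frontier \<Omega>)"
    by (rule has_derivative_transform[OF x _ d]) (simp add: tgrad_eq tproj_def)
  note d' = this
  then have "(tgrad \<Omega> u has_derivative frechet_derivative (tgrad \<Omega> u) (at x within frontier \<Omega>)) (at x within frontier \<Omega>)"
    using frechet_derivative_works differentiable_def by blast
  from has_derivative_unique_approached[OF this d' tangent_approached[OF x P_tangent[OF x]]]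
  have "boundary_hess \<Omega> u x \<xi> = P x (H x (P x \<xi>) - (s x *\<^sub>R N (P x \<xi>) + (p x \<bullet> N (P x \<xi>) + H x (P x \<xi>) \<bullet> \<nu> x) *\<^sub>R \<nu> x))"
    unfolding boundary_hess_def by simp
  also have "\<dots> = P x (H x (P x \<xi>)) - s x *\<^sub>R N (P x \<xi>)"
  proof -
    have "P x (\<nu> x) = 0" unfolding tproj_def by (simp add: normal_unit[OF x])
    moreover have "P x (N h) = N h" for h by (rule P_id[OF N\<nu>])
    ultimately show ?thesis
      by (simp add: linear_diff[OF linear_P] linear_add[OF linear_P] linear_scale[OF linear_P])
  qed
  finally show ?thesis unfolding shape by simp
qed

lemma bdry_M_eq: "x \<in> frontier \<Omega> \<Longrightarrow> bdry_M \<Omega> u x (s x) \<xi> = P x (H x (P x \<xi>))"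
  unfolding bdry_M_def by (simp add: boundary_hess_eq)

text \<open>Partial derivatives commute inside \<Omega>; continuity carries the symmetry to the
  boundary.\<close>

lemma hess_sym: assumes x: "x \<in> closure \<Omega>" shows "H x v \<bullet> w = v \<bullet> H x w"
proof -
  have "H y v \<bullet> w - H y w \<bullet> v = 0" if "y \<in> \<Omega>" for y
    using dir_deriv_commute[OF ud smooth_u openD closure_subset that, of v w]
    by (simp add: inner_hess_on[OF ud smooth_u subsetD[OF closure_subset that]])
  moreover have "continuous_on (closure \<Omega>) (\<lambda>y. H y v \<bullet> w - H y w \<bullet> v)"
    by (intro continuous_intros smooth_on_continuous_hess[OF ud smooth_u])
  ultimately have "H x v \<bullet> w - H x w \<bullet> v = 0"
    using continuous_constant_on_closure[of \<Omega> "\<lambda>y. H y v \<bullet> w - H y w \<bullet> v" 0] x by blast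
  then show ?thesis by (simp add: inner_commute)
qed

lemma linear_H: "x \<in> closure \<Omega> \<Longrightarrow> linear (H x)"
  by (rule linear_hess_on[OF ud smooth_u])

lemma compact_closure_dom: "compact (closure \<Omega>)"
  using dom unfolding bounded_smooth_domain_def by simp

lemma hess_bounded: "\<exists>B. \<forall>x\<in>closure \<Omega>. \<forall>v. norm (H x v) \<le> B * norm v"
proof -
  have "continuous_on (closure \<Omega>) (\<lambda>x. \<Sum>b\<in>Basis. norm (H x b))"
    by (intro continuous_intros smooth_on_continuous_hess[OF ud smooth_u])
  then have "bdd_above ((\<lambda>x. \<Sum>b\<in>Basis. norm (H x b)) ` closure \<Omega>)"
    using compact_closure_dom by (simp add: bounded_imp_bdd_above compact_continuous_image compact_imp_bounded)
  then obtain B where "\<And>x. x \<in> closure \<Omega> \<Longrightarrow> (\<Sum>b\<in>Basis. norm (H x b)) \<le> B" unfolding bdd_above_def by auto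
  then have "norm (H x v) \<le> B * norm v" if "x \<in> closure \<Omega>" for x v
    using norm_sum_basis_le[OF linear_H[OF that]] that
    by (meson mult_right_mono norm_ge_zero order_trans)
  then show ?thesis by blast
qed

lemma grad_bdd: "bdd_above ((\<lambda>x. norm (p x)) ` closure \<Omega>)"
  using smooth_on_continuous_grad[OF ud smooth_u] compact_closure_dom
  by (intro bounded_imp_bdd_above compact_imp_bounded compact_continuous_image continuous_on_norm)

lemma u_bdd: "bdd_above ((\<lambda>x. \<bar>u x\<bar>) ` closure \<Omega>)"
  using smooth_on_continuous[OF smooth_u] compact_closure_dom
  by (intro bounded_imp_bdd_above compact_imp_bounded compact_continuous_image continuous_on_rabs)

lemma frontier_nonempty: "frontier \<Omega> \<noteq> {}"
  using dom unfolding bounded_smooth_domain_def frontier_eq_empty by (metis not_bounded_UNIV)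

lemma C1_norm_bound:
  assumes "C1_norm \<Omega> u \<le> K" "x \<in> closure \<Omega>"
  shows "norm (p x) \<le> K"
proof -
  have "\<bar>u x\<bar> \<le> (SUP x\<in>closure \<Omega>. \<bar>u x\<bar>)" by (rule cSUP_upper[OF assms(2) u_bdd])
  moreover have "norm (p x) \<le> (SUP x\<in>closure \<Omega>. norm (p x))" by (rule cSUP_upper[OF assms(2) grad_bdd])
  ultimately show ?thesis using assms(1) unfolding C1_norm_def by linarith
qed

text \<open>A real supremum bounds its members only once the set is known to be bounded. Smoothness
  of u and the bounded shape operator supply such bounds, which then disappear in favour of K. The
  other two summands of the norm are nonnegative.\<close>

lemma boundary_C2_norm_bound:
  assumes K: "boundary_C2_norm \<Omega> u \<le> K" and x: "x \<in> frontier \<Omega>"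
  shows "norm (boundary_hess \<Omega> u x v) \<le> K * norm v"
proof -
  obtain B where B: "\<And>x v. x \<in> closure \<Omega> \<Longrightarrow> norm (H x v) \<le> B * norm v" using hess_bounded by blast
  obtain B' where B': "\<And>x v. x \<in> frontier \<Omega> \<Longrightarrow> norm (shape_op \<Omega> x v) \<le> B' * norm v" using shape_op_bounded by blast
  obtain G where G: "\<And>x. x \<in> closure \<Omega> \<Longrightarrow> norm (p x) \<le> G" using grad_bdd unfolding bdd_above_def by auto
  have le: "norm (boundary_hess \<Omega> u y v) \<le> (\<bar>B\<bar> + G * \<bar>B'\<bar>) * norm v" if y: "y \<in> frontier \<Omega>" for y v
  proof -
    have "norm (P y (H y (P y v))) \<le> norm (H y (P y v))" by (rule norm_P_le[OF y])
    also have "\<dots> \<le> B * norm (P y v)" by (rule B[OF frontier_closure[OF y]])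
    also have "\<dots> \<le> \<bar>B\<bar> * norm v" by (intro mult_mono norm_P_le[OF y]) auto
    finally have 1: "norm (P y (H y (P y v))) \<le> \<bar>B\<bar> * norm v" .
    have "\<bar>s y\<bar> \<le> norm (p y)" using Cauchy_Schwarz_ineq2[of "p y" "\<nu> y"] norm_normal[OF y] by simp
    also have "\<dots> \<le> G" by (rule G[OF frontier_closure[OF y]])
    finally have sG: "\<bar>s y\<bar> \<le> G" .
    have "norm (shape_op \<Omega> y v) \<le> \<bar>B'\<bar> * norm v"
      using B'[OF y, of v] by (meson abs_ge_self mult_right_mono norm_ge_zero order_trans)
    then have "\<bar>s y\<bar> * norm (shape_op \<Omega> y v) \<le> G * (\<bar>B'\<bar> * norm v)"
      using sG by (intro mult_mono) auto
    then have "norm (s y *\<^sub>R shape_op \<Omega> y v) \<le> G * \<bar>B'\<bar> * norm v" by simp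
    then show ?thesis unfolding boundary_hess_eq[OF y]
      using norm_triangle_ineq[of "P y (H y (P y v))" "s y *\<^sub>R shape_op \<Omega> y v"] 1 by (simp add: algebra_simps)
  qed
  have "bdd_above ((\<lambda>x. onorm (boundary_hess \<Omega> u x)) ` frontier \<Omega>)"
    by (intro bdd_aboveI2[where M = "\<bar>B\<bar> + G * \<bar>B'\<bar>"] onorm_le le)
  then have 1: "onorm (boundary_hess \<Omega> u x) \<le> (SUP x\<in>frontier \<Omega>. onorm (boundary_hess \<Omega> u x))"
    using x by (intro cSUP_upper)
  have "bdd_above ((\<lambda>x. \<bar>u x\<bar>) ` frontier \<Omega>)"
    by (rule bdd_above_mono[OF u_bdd]) (auto simp: frontier_def)
  then have "\<bar>u x\<bar> \<le> (SUP x\<in>frontier \<Omega>. \<bar>u x\<bar>)" using x by (intro cSUP_upper)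
  then have 2: "0 \<le> (SUP x\<in>frontier \<Omega>. \<bar>u x\<bar>)" by linarith
  have "norm (tgrad \<Omega> u y) \<le> G" if "y \<in> frontier \<Omega>" for y
    unfolding tgrad_eq[OF that] using norm_P_le[OF that, of "p y"] G[OF frontier_closure[OF that]] by linarith
  then have "bdd_above ((\<lambda>x. norm (tgrad \<Omega> u x)) ` frontier \<Omega>)" by (intro bdd_aboveI2[where M = G])
  then have "norm (tgrad \<Omega> u x) \<le> (SUP x\<in>frontier \<Omega>. norm (tgrad \<Omega> u x))" using x by (intro cSUP_upper)
  then have 3: "0 \<le> (SUP x\<in>frontier \<Omega>. norm (tgrad \<Omega> u x))" by (meson norm_ge_zero order_trans)
  have "linear (\<lambda>\<xi>. P x (H x (P x \<xi>)) + s x *\<^sub>R shape_op \<Omega> x \<xi>)"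
  proof -
    obtain U \<rho> where ld: "x \<in> U" "local_defining \<Omega> U \<rho>" using local_def[OF x] by metis
    have U: "open U" "smooth_on U \<rho>" using ld(2) unfolding local_defining_def by auto
    note l1 = linear_hess_on[OF unique_derivatives_open[OF U(1)] U(2) ld(1)]
    note l2 = linear_H[OF frontier_closure[OF x]]
    show ?thesis unfolding shape_op_local[OF ld(2,1) x]
      by (intro linearI) (auto simp: linear_add[OF linear_P] linear_scale[OF linear_P] linear_add[OF l1]
          linear_scale[OF l1] linear_add[OF l2] linear_scale[OF l2] inner_add_left algebra_simps)
  qed
  then have "linear (boundary_hess \<Omega> u x)" using boundary_hess_eq[OF x] by presburger
  then have "norm (boundary_hess \<Omega> u x v) \<le> onorm (boundary_hess \<Omega> u x) * norm v"
    by (intro onorm) (simp add: linear_linear)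
  also have "\<dots> \<le> K * norm v" using 1 2 3 K unfolding boundary_C2_norm_def by (intro mult_right_mono) auto
  finally show ?thesis .
qed

text \<open>In dimension at least 2 every boundary point has unit tangent vectors. The inner suprema
  then range over nonempty sets and are themselves bounded, so the double supremum really dominates
  each entry.\<close>

lemma mixed_bound:
  assumes dim: "DIM('a) \<ge> 2"
    and Z: "(SUP x\<in>frontier \<Omega>. SUP \<xi>\<in>{\<xi>\<in>T x. norm \<xi> = 1}. \<bar>H x \<xi> \<bullet> \<nu> x\<bar>) \<le> Z"
    and x: "x \<in> frontier \<Omega>" and v: "v \<bullet> \<nu> x = 0"
  shows "\<bar>H x v \<bullet> \<nu> x\<bar> \<le> Z * norm v"
proof -
  obtain B where B: "\<And>x v. x \<in> closure \<Omega> \<Longrightarrow> norm (H x v) \<le> B * norm v" using hess_bounded by blast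
  have le: "\<bar>H y \<xi> \<bullet> \<nu> y\<bar> \<le> B" if "y \<in> frontier \<Omega>" "norm \<xi> = 1" for y \<xi>
    using Cauchy_Schwarz_ineq2[of "H y \<xi>" "\<nu> y"] norm_normal[OF that(1)] B[OF frontier_closure[OF that(1)], of \<xi>] that(2) by simp
  have ne: "{\<xi>\<in>T y. norm \<xi> = 1} \<noteq> {}" if "y \<in> frontier \<Omega>" for y
  proof -
    obtain w where w: "w \<noteq> 0" "orthogonal (\<nu> y) w" using orthogonal_to_vector_exists[OF dim] by metis
    then have "w /\<^sub>R norm w \<in> {\<xi>\<in>T y. norm \<xi> = 1}"
      unfolding tangent_space_def orthogonal_def by (simp add: inner_commute)
    then show ?thesis by blast
  qed
  have inner: "(SUP \<xi>\<in>{\<xi>\<in>T y. norm \<xi> = 1}. \<bar>H y \<xi> \<bullet> \<nu> y\<bar>) \<le> B" if "y \<in> frontier \<Omega>" for y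
    using ne[OF that] le[OF that] by (intro cSUP_least) auto
  have Zx: "(SUP \<xi>\<in>{\<xi>\<in>T x. norm \<xi> = 1}. \<bar>H x \<xi> \<bullet> \<nu> x\<bar>) \<le> Z"
    by (rule order_trans[OF cSUP_upper[OF x] Z]) (intro bdd_aboveI2[where M = B] inner)
  show ?thesis
  proof (cases "v = 0")
    case True
    then show ?thesis using linear_0[OF linear_H[OF frontier_closure[OF x]]] by simp
  next
    case False
    let ?w = "v /\<^sub>R norm v"
    have w: "?w \<in> {\<xi>\<in>T x. norm \<xi> = 1}" using False v unfolding tangent_space_def by simp
    have "\<bar>H x ?w \<bullet> \<nu> x\<bar> \<le> Z"
      by (rule order_trans[OF cSUP_upper[OF w] Zx]) (auto intro: bdd_aboveI2[where M = B] le[OF x])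
    then show ?thesis using False
      by (simp add: linear_scale[OF linear_H[OF frontier_closure[OF x]]] abs_mult field_simps)
  qed
qed

end

section \<open>The equation in a boundary frame\<close>

context psd_operator
begin

text \<open>An arrowhead matrix: diagonalising the tangential block leaves the row of z with
  arbitrary mixed entries.\<close>

lemma bordered_decomp:
  assumes fr: "onframe UNIV (insert z J) b" and z: "z \<notin> J"
    and diag: "pairwise (\<lambda>i j. A (b i) \<bullet> b j = 0) J"
  defines "y v \<equiv> \<Sum>j\<in>J. (v \<bullet> b j) *\<^sub>R b j"
  shows "v = y v + (v \<bullet> b z) *\<^sub>R b z"
    and "A (y v) \<bullet> y v = (\<Sum>j\<in>J. (A (b j) \<bullet> b j) * (v \<bullet> b j)\<^sup>2)"
    and "A (y v) \<bullet> b z = (\<Sum>j\<in>J. (v \<bullet> b j) * (A (b j) \<bullet> b z))"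
    and "v \<bullet> v = (\<Sum>j\<in>J. (v \<bullet> b j)\<^sup>2) + (v \<bullet> b z)\<^sup>2"
proof -
  have fin: "finite J" using fr unfolding onframe_def by simp
  show "v = y v + (v \<bullet> b z) *\<^sub>R b z"
    unfolding y_def using onframe_expand[OF subspace_UNIV fr UNIV_I, of v] fin z by (simp add: add.commute)
  show "v \<bullet> v = (\<Sum>j\<in>J. (v \<bullet> b j)\<^sup>2) + (v \<bullet> b z)\<^sup>2"
    using onframe_parseval[OF subspace_UNIV fr UNIV_I, of v v] fin z by (simp add: power2_eq_square)
  show "A (y v) \<bullet> b z = (\<Sum>j\<in>J. (v \<bullet> b j) * (A (b j) \<bullet> b z))"
    unfolding y_def by (simp add: linear_sum[OF lin] linear_scale[OF lin] inner_sum_left)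
  have "A (y v) \<bullet> y v = (\<Sum>i\<in>J. \<Sum>j\<in>J. (v \<bullet> b i) * (v \<bullet> b j) * (A (b i) \<bullet> b j))"
  proof -
    have "A (y v) \<bullet> y v = (\<Sum>i\<in>J. (v \<bullet> b i) * (A (b i) \<bullet> y v))"
      by (subst y_def) (simp add: linear_sum[OF lin] linear_scale[OF lin] inner_sum_left)
    then show ?thesis unfolding y_def by (simp add: inner_sum_right sum_distrib_left mult.assoc)
  qed
  also have "\<dots> = (\<Sum>i\<in>J. (A (b i) \<bullet> b i) * (v \<bullet> b i)\<^sup>2)"
  proof (rule sum.cong[OF refl])
    fix i assume i: "i \<in> J"
    have "(\<Sum>j\<in>J. (v \<bullet> b i) * (v \<bullet> b j) * (A (b i) \<bullet> b j))
        = (\<Sum>j\<in>J. if j = i then (A (b i) \<bullet> b i) * (v \<bullet> b i)\<^sup>2 else 0)"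
      using diag i unfolding pairwise_def by (intro sum.cong) (auto simp: power2_eq_square)
    then show "(\<Sum>j\<in>J. (v \<bullet> b i) * (v \<bullet> b j) * (A (b i) \<bullet> b j)) = (A (b i) \<bullet> b i) * (v \<bullet> b i)\<^sup>2"
      using fin i by simp
  qed
  finally show "A (y v) \<bullet> y v = (\<Sum>j\<in>J. (A (b j) \<bullet> b j) * (v \<bullet> b j)\<^sup>2)" .
qed

text \<open>Positivity at the difference of the two components bounds the mixed terms, at the price
  of a factor 2, so no bound on the mixed entries is involved.\<close>

lemma bordered_quadratic_le:
  assumes fr: "onframe UNIV (insert z J) b" and z: "z \<notin> J"
    and diag: "pairwise (\<lambda>i j. A (b i) \<bullet> b j = 0) J"
    and K: "K \<ge> 0" "\<And>j. j \<in> J \<Longrightarrow> A (b j) \<bullet> b j \<le> K"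
  shows "A v \<bullet> v \<le> 2 * (K + A (b z) \<bullet> b z) * (v \<bullet> v)"
proof -
  note d = bordered_decomp[OF fr z diag]
  let ?y = "\<Sum>j\<in>J. (v \<bullet> b j) *\<^sub>R b j"
  define m where "m = A (b z) \<bullet> b z"
  have m: "m \<ge> 0" unfolding m_def by (rule psd)
  have "A v \<bullet> v = A (?y + (v \<bullet> b z) *\<^sub>R b z) \<bullet> (?y + (v \<bullet> b z) *\<^sub>R b z)"
    using arg_cong[where f = "\<lambda>v. A v \<bullet> v", OF d(1)[of v]] .
  also have "\<dots> \<le> 2 * (A ?y \<bullet> ?y) + 2 * (A ((v \<bullet> b z) *\<^sub>R b z) \<bullet> ((v \<bullet> b z) *\<^sub>R b z))"
    by (rule quadratic_add_le)
  also have "A ((v \<bullet> b z) *\<^sub>R b z) \<bullet> ((v \<bullet> b z) *\<^sub>R b z) = m * (v \<bullet> b z)\<^sup>2"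
    unfolding m_def by (simp add: linear_scale[OF lin] power2_eq_square)
  also have "A ?y \<bullet> ?y \<le> (\<Sum>j\<in>J. K * (v \<bullet> b j)\<^sup>2)"
    unfolding d(2) by (intro sum_mono mult_right_mono K) auto
  also have "\<dots> = K * (\<Sum>j\<in>J. (v \<bullet> b j)\<^sup>2)" by (simp add: sum_distrib_left)
  also have "\<dots> \<le> K * (v \<bullet> v)" using d(4)[of v] K(1) by (intro mult_left_mono) auto
  also have "m * (v \<bullet> b z)\<^sup>2 \<le> m * (v \<bullet> v)"
    using d(4)[of v] m by (intro mult_left_mono) (auto intro: sum_nonneg)
  finally show ?thesis unfolding m_def by (simp add: algebra_simps)
qed

text \<open>Completing the square in the last variable costs \<open>2 |z|\<^sup>2 / m\<close> on the first block.\<close>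

lemma bordered_arctan_sum_ge:
  assumes fr: "onframe UNIV (insert z J) b" and z: "z \<notin> J"
    and diag: "pairwise (\<lambda>i j. A (b i) \<bullet> b j = 0) J"
    and Z: "\<And>j. j \<in> J \<Longrightarrow> \<bar>A (b j) \<bullet> b z\<bar> \<le> Z" and m: "A (b z) \<bullet> b z > 0"
  shows "(\<Sum>j\<in>J. arctan (A (b j) \<bullet> b j)) + pi / 2
     \<le> arctan_sum UNIV A + (2 + 2 * (real DIM('a))\<^sup>2 * Z\<^sup>2) / (A (b z) \<bullet> b z)"
proof -
  note d = bordered_decomp[OF fr z diag]
  have fin: "finite J" and cardJ: "card J \<le> DIM('a)" using fr z unfolding onframe_def by auto
  define m where "m = A (b z) \<bullet> b z"
  have m0: "m > 0" unfolding m_def by (rule m)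
  define n where "n = real DIM('a)"
  \<comment> \<open>From 2 r^2 / m, the remainder of the completed square, where r^2 is at most n
    Z^2 |v|^2.\<close>
  define \<epsilon> where "\<epsilon> = 2 * (n * Z\<^sup>2) / m"
  have \<epsilon>: "\<epsilon> \<ge> 0" unfolding \<epsilon>_def n_def using m0 by simp
  \<comment> \<open>Only half of m is kept on the diagonal; the other half absorbs the mixed term,
    since (m / 2) s^2 + 2 s r + 2 r^2 / m is a square.\<close>
  define dd where "dd = (\<lambda>i. if i = z then m / 2 else A (b i) \<bullet> b i)"
  have "(\<Sum>i\<in>insert z J. arctan (dd i)) \<le> arctan_sum UNIV A + real DIM('a) * \<epsilon>"
  proof (rule arctan_sum_ge_frame[OF fr])
    show "0 \<le> dd i" for i unfolding dd_def using m0 psd by simp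
    show "0 \<le> \<epsilon>" by (rule \<epsilon>)
    fix v
    let ?y = "\<Sum>j\<in>J. (v \<bullet> b j) *\<^sub>R b j"
    define s where "s = v \<bullet> b z"
    define r where "r = (\<Sum>j\<in>J. (v \<bullet> b j) * (A (b j) \<bullet> b z))"
    have "r\<^sup>2 \<le> (\<Sum>j\<in>J. (v \<bullet> b j)\<^sup>2) * (\<Sum>j\<in>J. (A (b j) \<bullet> b z)\<^sup>2)"
      unfolding r_def by (rule Cauchy_Schwarz_ineq_sum)
    also have "\<dots> \<le> (v \<bullet> v) * (n * Z\<^sup>2)"
    proof (rule mult_mono)
      show "(\<Sum>j\<in>J. (v \<bullet> b j)\<^sup>2) \<le> v \<bullet> v" using d(4)[of v] by simp
      have "(A (b j) \<bullet> b z)\<^sup>2 \<le> Z\<^sup>2" if "j \<in> J" for j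
        using power_mono[OF Z[OF that], of 2] by simp
      then have "(\<Sum>j\<in>J. (A (b j) \<bullet> b z)\<^sup>2) \<le> (\<Sum>j\<in>J. Z\<^sup>2)" by (rule sum_mono)
      also have "\<dots> \<le> n * Z\<^sup>2" unfolding n_def using cardJ by (simp add: mult_right_mono)
      finally show "(\<Sum>j\<in>J. (A (b j) \<bullet> b z)\<^sup>2) \<le> n * Z\<^sup>2" .
    qed (auto intro: sum_nonneg)
    finally have r2: "r\<^sup>2 \<le> (v \<bullet> v) * (n * Z\<^sup>2)" .
    have expand: "A (y + s *\<^sub>R b z) \<bullet> (y + s *\<^sub>R b z) = A y \<bullet> y + 2 * s * (A y \<bullet> b z) + m * s\<^sup>2" for y
      using sym[of "b z" y] unfolding m_def
      by (simp add: linear_add[OF lin] linear_scale[OF lin] inner_add_left inner_add_right power2_eq_square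
          inner_commute algebra_simps)
    have "A v \<bullet> v = A ?y \<bullet> ?y + 2 * s * (A ?y \<bullet> b z) + m * s\<^sup>2"
      using arg_cong[where f = "\<lambda>v. A v \<bullet> v", OF d(1)[of v]] unfolding s_def[symmetric] expand .
    then have Av: "A v \<bullet> v = (\<Sum>j\<in>J. (A (b j) \<bullet> b j) * (v \<bullet> b j)\<^sup>2) + 2 * s * r + m * s\<^sup>2"
      unfolding d(2) d(3) r_def .
    have "0 \<le> (m * s + 2 * r)\<^sup>2 / (2 * m)" using m0 by simp
    also have "(m * s + 2 * r)\<^sup>2 / (2 * m) = m / 2 * s\<^sup>2 + 2 * s * r + 2 * r\<^sup>2 / m"
      using m0 by (simp add: field_simps power2_eq_square)
    finally have sq: "m / 2 * s\<^sup>2 \<le> m * s\<^sup>2 + 2 * s * r + 2 * r\<^sup>2 / m" by (simp add: algebra_simps)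
    have "2 * r\<^sup>2 / m \<le> \<epsilon> * (v \<bullet> v)"
    proof -
      have "2 * r\<^sup>2 / m \<le> 2 * ((v \<bullet> v) * (n * Z\<^sup>2)) / m" using r2 m0 by (intro divide_right_mono) auto
      then show ?thesis unfolding \<epsilon>_def by (simp add: algebra_simps)
    qed
    then have "m / 2 * s\<^sup>2 \<le> m * s\<^sup>2 + 2 * s * r + \<epsilon> * (v \<bullet> v)" using sq by linarith
    moreover have "(\<Sum>i\<in>insert z J. dd i * (v \<bullet> b i)\<^sup>2) = m / 2 * s\<^sup>2 + (\<Sum>j\<in>J. (A (b j) \<bullet> b j) * (v \<bullet> b j)\<^sup>2)"
    proof -
      have "(\<Sum>i\<in>J. dd i * (v \<bullet> b i)\<^sup>2) = (\<Sum>j\<in>J. (A (b j) \<bullet> b j) * (v \<bullet> b j)\<^sup>2)"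
        unfolding dd_def using z by (intro sum.cong) auto
      then show ?thesis using fin z unfolding s_def by (simp add: dd_def)
    qed
    ultimately show "(\<Sum>i\<in>insert z J. dd i * (v \<bullet> b i)\<^sup>2) \<le> A v \<bullet> v + \<epsilon> * (v \<bullet> v)"
      unfolding Av by linarith
  qed
  moreover have "(\<Sum>i\<in>insert z J. arctan (dd i)) = arctan (m / 2) + (\<Sum>j\<in>J. arctan (A (b j) \<bullet> b j))"
  proof -
    have "(\<Sum>i\<in>J. arctan (dd i)) = (\<Sum>j\<in>J. arctan (A (b j) \<bullet> b j))"
      unfolding dd_def using z by (intro sum.cong) auto
    then show ?thesis using fin z by (simp add: dd_def)
  qed
  \<comment> \<open>The arctangent of a large entry misses pi / 2 by the arctangent of its
    reciprocal. This loss 2 / m joins the n \<epsilon> from the first block in the stated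
    constant.\<close>
  moreover have "arctan (m / 2) \<ge> pi / 2 - 2 / m"
  proof -
    have "arctan (1 / (m / 2)) = sgn (m / 2) * pi / 2 - arctan (m / 2)"
      using m0 arctan_inverse[of "m / 2"] by simp
    then have "arctan (m / 2) = pi / 2 - arctan (2 / m)" using m0 by simp
    moreover have "arctan (2 / m) \<le> 2 / m" using arctan_add_le[of "2 / m" 0] m0 by simp
    ultimately show ?thesis by linarith
  qed
  moreover have "real DIM('a) * \<epsilon> + 2 / m = (2 + 2 * (real DIM('a))\<^sup>2 * Z\<^sup>2) / m"
    unfolding \<epsilon>_def n_def by (simp add: add_divide_distrib power2_eq_square)
  ultimately show ?thesis unfolding m_def by linarith
qed

end

text \<open>On this range 1 \<le> sin d + cos d and sin d \<le> d, hence 1 / d \<le> 1 / sin d \<le>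
  1 + cot d. This turns bounds of the form C / d into the stated form.\<close>

lemma one_le_cot:
  fixes d :: real
  assumes "0 < d" "d \<le> pi / 2"
  shows "1 / d \<le> 1 + cot d" "cot d \<ge> 0"
proof -
  have s: "sin d > 0" and c: "cos d \<ge> 0" using assms by (auto intro!: sin_gt_zero cos_ge_zero)
  have "1 \<le> (sin d + cos d)\<^sup>2" using s c sin_cos_squared_add[of d] by (simp add: power2_sum)
  then have "1 \<le> sin d + cos d" using s c by (metis abs_le_square_iff abs_of_nonneg add_nonneg_nonneg less_imp_le one_power2 abs_one)
  have "1 / d \<le> 1 / sin d" using s assms sin_x_le_x[of d] by (intro divide_left_mono) auto
  also have "\<dots> \<le> (sin d + cos d) / sin d" using \<open>1 \<le> sin d + cos d\<close> s by (intro divide_right_mono) auto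
  also have "\<dots> = 1 + cot d" using s by (simp add: cot_def add_divide_distrib)
  finally show "1 / d \<le> 1 + cot d" .
  show "cot d \<ge> 0" using s c unfolding cot_def by simp
qed

lemma cot_eq_tan: "cot d = tan (pi / 2 - d)" for d :: real
  by (simp add: cot_def tan_def sin_diff cos_diff)

lemma cot_antimono:
  fixes x y :: real
  assumes "0 < x" "x \<le> y" "y < pi"
  shows "cot y \<le> cot x"
  unfolding cot_eq_tan using assms by (intro tan_mono_le) auto

text \<open>Applied to the Hessian and to the curvature alike. If d j \<ge> e, the upper bound keeps
  a j below C (1 + cot e); conversely a j is at least 1 / d j - 1.\<close>

lemma filterlim_cot_iff:
  fixes a d :: "nat \<Rightarrow> real"
  assumes d: "\<And>j. 0 < d j" "\<And>j. d j \<le> pi / 2"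
    and lo: "\<And>j. cot (d j) \<le> a j" and up: "\<And>j. a j \<le> C * (1 + cot (d j))" and C: "C \<ge> 0"
  shows "filterlim a at_top sequentially \<longleftrightarrow> d \<longlonglongrightarrow> 0"
proof
  assume a: "filterlim a at_top sequentially"
  show "d \<longlonglongrightarrow> 0"
  proof (rule order_tendstoI)
    fix e :: real assume "e < 0"
    then show "\<forall>\<^sub>F j in sequentially. e < d j" using d(1) by (intro always_eventually) (metis less_trans)
  next
    fix e :: real assume e: "0 < e"
    have "\<forall>\<^sub>F j in sequentially. C * (1 + cot e) < a j"
      using a unfolding filterlim_at_top_dense by blast
    then show "\<forall>\<^sub>F j in sequentially. d j < e"
    proof eventually_elim
      case (elim j)
      show ?case
      proof (rule ccontr)
        assume "\<not> d j < e"
        then have "cot (d j) \<le> cot e" using e d(2)[of j] pi_gt_zero by (intro cot_antimono) auto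
        then have "C * (1 + cot (d j)) \<le> C * (1 + cot e)" using C by (intro mult_left_mono) auto
        then show False using elim up[of j] by linarith
      qed
    qed
  qed
next
  assume "d \<longlonglongrightarrow> 0"
  then have "filterlim (\<lambda>j. inverse (d j)) at_top sequentially"
    using d(1) by (intro filterlim_inverse_at_top) auto
  then have "filterlim (\<lambda>j. -1 + inverse (d j)) at_top sequentially"
    by (rule filterlim_tendsto_add_at_top[OF tendsto_const])
  then show "filterlim a at_top sequentially"
  proof (rule filterlim_at_top_mono)
    have "-1 + inverse (d j) \<le> a j" for j
      using one_le_cot(1)[OF d(1) d(2), of j] lo[of j] by (simp add: divide_inverse)
    then show "\<forall>\<^sub>F j in sequentially. -1 + inverse (d j) \<le> a j" by simp
  qed
qed

section \<open>The curvature operator up to the boundary\<close>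

context smooth_domain_fun
begin

abbreviation "Curv \<equiv> \<lambda>x. graph_curv (p x) (H x)"

lemma linear_expand_basis:
  assumes "linear (L :: 'a \<Rightarrow> 'a)"
  shows "L v = (\<Sum>c\<in>Basis. (v \<bullet> c) *\<^sub>R L c)"
proof -
  have "L v = L (\<Sum>b\<in>Basis. (v \<bullet> b) *\<^sub>R b)" by (simp add: euclidean_representation)
  then show ?thesis by (simp add: linear_sum[OF assms] linear_scale[OF assms])
qed

lemma continuous_grad: "continuous_on (closure \<Omega>) p"
  by (rule smooth_on_continuous_grad[OF ud smooth_u])

lemma continuous_hess: "continuous_on (closure \<Omega>) (\<lambda>x. H x v)"
  by (rule smooth_on_continuous_hess[OF ud smooth_u])

lemma continuous_curv: "continuous_on (closure \<Omega>) (\<lambda>x. Curv x v)"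
proof -
  have sl: "continuous_on (closure \<Omega>) (\<lambda>x. slope (p x))"
    unfolding slope_def by (intro continuous_intros continuous_grad)
  have nz: "slope (p x) \<noteq> 0" "slope (p x) * (1 + slope (p x)) \<noteq> 0" for x
    using slope_pos[of "p x"] by (auto simp: add_pos_pos less_imp_neq[THEN not_sym])
  have mi: "continuous_on (closure \<Omega>) (\<lambda>x. metric_inv_sqrt (p x) (f x))" if "continuous_on (closure \<Omega>) f" for f
    unfolding metric_inv_sqrt_def by (intro continuous_intros continuous_grad sl that) (use nz in auto)
  \<comment> \<open>The argument of H moves with x as well, so it is expanded in the basis, where
    only H at fixed vectors occurs.\<close>
  have "continuous_on (closure \<Omega>) (\<lambda>x. \<Sum>c\<in>Basis. (metric_inv_sqrt (p x) v \<bullet> c) *\<^sub>R H x c)"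
    by (intro continuous_intros continuous_hess mi)
  then have "continuous_on (closure \<Omega>) (\<lambda>x. H x (metric_inv_sqrt (p x) v))"
    by (rule continuous_on_eq) (rule linear_expand_basis[OF linear_H, symmetric])
  then show ?thesis unfolding graph_curv_def
    by (intro continuous_intros sl mi) (use nz in auto)
qed

end

locale convex_fun = smooth_domain_fun +
  assumes hess_nonneg: "\<And>x \<xi>. x \<in> closure \<Omega> \<Longrightarrow> H x \<xi> \<bullet> \<xi> \<ge> 0"
begin

lemma psd_H: assumes "x \<in> closure \<Omega>" shows "psd_operator (H x)"
  by (rule psd_operator.intro) (intro linear_H hess_sym hess_nonneg assms)+

lemma psd_Curv: "x \<in> closure \<Omega> \<Longrightarrow> psd_operator (Curv x)"
  by (intro psd_operator_graph_curv psd_H)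

text \<open>The equation is assumed in the open set; this continuity extends it to the boundary,
  where it is compared with the boundary phase.\<close>

lemma continuous_arctan_sum: "continuous_on (closure \<Omega>) (\<lambda>x. arctan_sum UNIV (Curv x))"
  unfolding continuous_on_def
proof
  fix x0 assume x0: "x0 \<in> closure \<Omega>"
  define r where "r = (\<lambda>x. \<Sum>b\<in>Basis. norm (Curv x b - Curv x0 b))"
  have quad: "Curv x v \<bullet> v \<le> Curv x0 v \<bullet> v + r x" "Curv x0 v \<bullet> v \<le> Curv x v \<bullet> v + r x"
    if x: "x \<in> closure \<Omega>" and v: "norm v = 1" for x v
  proof -
    have "linear (\<lambda>v. Curv x v - Curv x0 v)"
      by (intro linear_compose_sub psd_operator.lin psd_Curv x x0)
    from norm_sum_basis_le[OF this, of v] have "norm (Curv x v - Curv x0 v) \<le> r x" using v unfolding r_def by simp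
    moreover have "\<bar>(Curv x v - Curv x0 v) \<bullet> v\<bar> \<le> norm (Curv x v - Curv x0 v) * norm v" by (rule Cauchy_Schwarz_ineq2)
    ultimately have "\<bar>(Curv x v - Curv x0 v) \<bullet> v\<bar> \<le> r x" using v by simp
    then show "Curv x v \<bullet> v \<le> Curv x0 v \<bullet> v + r x" "Curv x0 v \<bullet> v \<le> Curv x v \<bullet> v + r x"
      by (auto simp: inner_diff_left abs_le_iff)
  qed
  have rpos: "r x \<ge> 0" for x unfolding r_def by (intro sum_nonneg) auto
  have le: "norm (arctan_sum UNIV (Curv x) - arctan_sum UNIV (Curv x0)) \<le> real DIM('a) * r x" if x: "x \<in> closure \<Omega>" for x
    using psd_operator.arctan_sum_perturb[OF psd_Curv[OF x0] psd_Curv[OF x] quad(1)[OF x] rpos]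
      psd_operator.arctan_sum_perturb[OF psd_Curv[OF x] psd_Curv[OF x0] quad(2)[OF x] rpos]
    by (simp add: abs_le_iff)
  have "((\<lambda>x. r x) \<longlongrightarrow> (\<Sum>b\<in>Basis. norm (Curv x0 b - Curv x0 b))) (at x0 within closure \<Omega>)"
    unfolding r_def using continuous_curv x0 unfolding continuous_on_def
    by (intro tendsto_intros) auto
  then have "((\<lambda>x. real DIM('a) * r x) \<longlongrightarrow> 0) (at x0 within closure \<Omega>)"
    by (auto intro: tendsto_mult_right_zero)
  then have "((\<lambda>x. arctan_sum UNIV (Curv x) - arctan_sum UNIV (Curv x0)) \<longlongrightarrow> 0) (at x0 within closure \<Omega>)"
    by (rule Lim_null_comparison[rotated]) (use le in \<open>auto simp: eventually_at_filter\<close>)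
  then show "((\<lambda>x. arctan_sum UNIV (Curv x)) \<longlongrightarrow> arctan_sum UNIV (Curv x0)) (at x0 within closure \<Omega>)"
    by (simp add: Lim_null[symmetric])
qed

text \<open>The tangential eigenframe together with the normal to the tangent space in the graph metric.\<close>

lemma boundary_frame:
  assumes x: "x \<in> frontier \<Omega>"
    and Kt: "\<And>v. v \<bullet> \<nu> x = 0 \<Longrightarrow> norm (P x (H x v)) \<le> Kt * norm v"
    and Z: "\<And>v. v \<bullet> \<nu> x = 0 \<Longrightarrow> \<bar>H x v \<bullet> \<nu> x\<bar> \<le> Z * norm v"
    and nn: "Kt \<ge> 0" "Z \<ge> 0"
  obtains J b where "onframe UNIV (insert (\<nu> x) J) b" "\<nu> x \<notin> J"
    "pairwise (\<lambda>i j. Curv x (b i) \<bullet> b j = 0) J"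
    "bdry_phase \<Omega> u x (s x) = pi / 2 + (\<Sum>j\<in>J. arctan (Curv x (b j) \<bullet> b j))"
    "\<And>j. j \<in> J \<Longrightarrow> Curv x (b j) \<bullet> b j \<le> Kt"
    "\<And>j. j \<in> J \<Longrightarrow> \<bar>Curv x (b j) \<bullet> b (\<nu> x)\<bar> \<le> Kt + 2 * Z"
proof -
  note xc = frontier_closure[OF x]
  interpret Hx: psd_operator "H x" by (rule psd_H[OF xc])
  define q w \<sigma> where "q = P x (p x)" and "w = slope (p x)" and "\<sigma> = s x"
  have w: "w \<ge> 1" "w > 0" unfolding w_def by (rule slope_ge_1, rule slope_pos)
  have q\<nu>: "q \<bullet> \<nu> x = 0" unfolding q_def by (rule P_tangent[OF x])
  have pdec: "p x = q + \<sigma> *\<^sub>R \<nu> x" unfolding q_def \<sigma>_def tproj_def by simp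
  have \<nu>\<nu>: "\<nu> x \<bullet> \<nu> x = 1" by (rule normal_unit[OF x])
  have pp: "p x \<bullet> p x = q \<bullet> q + \<sigma>\<^sup>2"
    unfolding pdec using q\<nu> \<nu>\<nu> by (simp add: inner_add_left inner_add_right inner_commute power2_eq_square)
  have w2: "w\<^sup>2 = 1 + q \<bullet> q + \<sigma>\<^sup>2" unfolding w_def slope_sq pp by simp
  have pt: "p x \<bullet> v = q \<bullet> v" if "v \<bullet> \<nu> x = 0" for v
    unfolding pdec using that by (simp add: inner_add_left inner_commute[of _ v] inner_add_right)
  \<comment> \<open>At s = u_\<nu> the root is the slope w of the full gradient, so the boundary
    operator is w times the graph metric restricted to the tangent space.\<close>
  have bC: "bdry_C \<Omega> u x (s x) = (\<lambda>v. w *\<^sub>R (v + (q \<bullet> v) *\<^sub>R q))"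
  proof -
    have "sqrt (1 + (norm q)\<^sup>2 + \<sigma>\<^sup>2) = w" using w2 w by (simp add: power2_norm_eq_inner real_sqrt_unique)
    then show ?thesis unfolding bdry_C_def tgrad_eq[OF x] q_def[symmetric] \<sigma>_def[symmetric] Let_def by auto
  qed
  define R where "R = (\<lambda>v. (1 / sqrt w) *\<^sub>R metric_inv_sqrt q (P x v))"
  have R: "inv_sqrt_on (T x) (bdry_C \<Omega> u x (s x)) = R"
    unfolding bC R_def
  proof (rule inv_sqrt_on_rank_one[OF subspace_T])
    show "q \<in> T x" unfolding q_def by (rule P_in_T[OF x])
    show "P x v \<in> T x" for v by (rule P_in_T[OF x])
    show "v \<in> T x \<Longrightarrow> P x v = v" for v unfolding tangent_space_def by (simp add: P_id)
    show "P x v = 0" if "v \<in> orthogonal_comp (T x)" for v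
    proof -
      have "v \<bullet> P x v = 0" using that P_in_T[OF x, of v] unfolding orthogonal_comp_def orthogonal_def
        by (auto simp: inner_commute)
      then have "P x v \<bullet> P x v = 0" using P_id[OF P_tangent[OF x]] by (simp add: P_sym)
      then show ?thesis by simp
    qed
  qed (use w linear_P in auto)
  have mT: "metric_inv_sqrt q v \<bullet> \<nu> x = 0" if "v \<bullet> \<nu> x = 0" for v
    unfolding metric_inv_sqrt_def using that q\<nu> by (simp add: inner_diff_left)
  define L where "L = (\<lambda>v. R (bdry_M \<Omega> u x (s x) (R v)))"
  note lm = linear_metric_inv_sqrt[of q]
  have Rlin: "linear R" unfolding R_def
    by (intro linearI) (auto simp: linear_add[OF linear_P] linear_scale[OF linear_P] linear_add[OF lm]
        linear_scale[OF lm] algebra_simps)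
  have RT: "R v \<bullet> \<nu> x = 0" for v unfolding R_def using mT[OF P_tangent[OF x]] by simp
  have Rsym: "R v \<bullet> v' = v \<bullet> R v'" if "v' \<bullet> \<nu> x = 0" "v \<bullet> \<nu> x = 0" for v v'
    unfolding R_def by (simp add: P_id[OF that(1)] P_id[OF that(2)] metric_inv_sqrt_sym)
  have Llin: "linear L" unfolding L_def bdry_M_eq[OF x]
    by (intro linearI) (simp_all add: linear_add[OF Rlin] linear_scale[OF Rlin] linear_add[OF linear_P]
        linear_scale[OF linear_P] linear_add[OF Hx.lin] linear_scale[OF Hx.lin])
  have Lval: "L v \<bullet> v' = (H x (metric_inv_sqrt q v) \<bullet> metric_inv_sqrt q v') / w"
    if "v \<bullet> \<nu> x = 0" "v' \<bullet> \<nu> x = 0" for v v'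
  proof -
    have "L v \<bullet> v' = P x (H x (P x (R v))) \<bullet> R v'"
      unfolding L_def bdry_M_eq[OF x] by (rule Rsym[OF that(2) P_tangent[OF x]])
    also have "\<dots> = H x (R v) \<bullet> R v'" by (simp add: P_sym P_id[OF RT])
    also have "\<dots> = (1 / sqrt w * (1 / sqrt w)) * (H x (metric_inv_sqrt q v) \<bullet> metric_inv_sqrt q v')"
      unfolding R_def P_id[OF that(1)] P_id[OF that(2)] by (simp add: linear_scale[OF Hx.lin])
    also have "1 / sqrt w * (1 / sqrt w) = 1 / w" using w by simp
    finally show ?thesis by simp
  qed
  obtain E :: "'a set" where E: "onframe (T x) E (\<lambda>x. x)" "\<forall>e\<in>E. L e = (L e \<bullet> e) *\<^sub>R e"
    using symmetric_eigenframe[OF Llin subspace_T[of x]]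
  proof -
    have "L v \<in> T x" for v unfolding L_def tangent_space_def using RT by simp
    moreover have "L v \<bullet> v' = v \<bullet> L v'" if "v \<in> T x" "v' \<in> T x" for v v'
      using that Lval[of v v'] Lval[of v' v] Hx.sym[of "metric_inv_sqrt q v"] unfolding tangent_space_def
      by (simp add: inner_commute)
    ultimately show thesis using symmetric_eigenframe[OF Llin subspace_T[of x]] that by blast
  qed
  have ET: "e \<bullet> \<nu> x = 0" if "e \<in> E" for e using E(1) that unfolding onframe_def tangent_space_def by auto
  have EE: "e \<bullet> e' = (if e = e' then 1 else 0)" if "e \<in> E" "e' \<in> E" for e e'
    using E(1) that unfolding onframe_def by auto
  have \<nu>E: "\<nu> x \<notin> E" using ET \<nu>\<nu> by force
  \<comment> \<open>The inverse metric I - p \<otimes> p / w^2 applied to \<nu>. Hence g(n0, v) =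
    \<nu> . v: n0 is orthogonal to the tangent space in the graph metric, and its squared length
    there is N^2.\<close>
  define n0 where "n0 = \<nu> x - (\<sigma> / w\<^sup>2) *\<^sub>R p x"
  define N where "N = sqrt (1 - \<sigma>\<^sup>2 / w\<^sup>2)"
  have pn0: "p x \<bullet> n0 = \<sigma> / w\<^sup>2"
  proof -
    have "p x \<bullet> n0 = \<sigma> - \<sigma> / w\<^sup>2 * (w\<^sup>2 - 1)"
      unfolding n0_def \<sigma>_def w_def slope_sq by (simp add: inner_diff_right)
    then show ?thesis using w by (simp add: field_simps)
  qed
  have gn0: "graph_metric (p x) n0 v = \<nu> x \<bullet> v" for v
    unfolding graph_metric_def pn0 unfolding n0_def by (simp add: inner_diff_left)
  have \<nu>n0: "\<nu> x \<bullet> n0 = 1 - \<sigma>\<^sup>2 / w\<^sup>2"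
    unfolding n0_def \<sigma>_def using \<nu>\<nu> by (simp add: inner_diff_right power2_eq_square inner_commute)
  have N2ge: "1 / w\<^sup>2 \<le> 1 - \<sigma>\<^sup>2 / w\<^sup>2"
  proof -
    have "1 \<le> w\<^sup>2 - \<sigma>\<^sup>2" using w2 by simp
    then have "1 / w\<^sup>2 \<le> (w\<^sup>2 - \<sigma>\<^sup>2) / w\<^sup>2" by (intro divide_right_mono) auto
    then show ?thesis using w by (simp add: diff_divide_distrib)
  qed
  then have Npos: "1 - \<sigma>\<^sup>2 / w\<^sup>2 > 0" using w by (smt (verit) zero_less_divide_1_iff zero_less_power)
  then have N: "N > 0" "N\<^sup>2 = 1 - \<sigma>\<^sup>2 / w\<^sup>2" unfolding N_def by auto
  \<comment> \<open>Indeed w^2 N^2 = w^2 - \<sigma>^2 = 1 + |q|^2 \<ge> 1. This factor scales the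
    mixed entries, so normalising n0 does not enlarge them.\<close>
  have wN: "1 / (w * N) \<le> 1"
  proof -
    have "sqrt (1 / w\<^sup>2) \<le> N" unfolding N_def using N2ge by (rule real_sqrt_le_mono)
    then have "1 / w \<le> N" using w by (simp add: real_sqrt_divide)
    then show ?thesis using w N by (simp add: field_simps)
  qed
  \<comment> \<open>Here \<nu> x is merely an index, distinct from all of E; the vector it labels is
    the normalised n0.\<close>
  define f where "f = (\<lambda>j. if j = \<nu> x then (1 / N) *\<^sub>R n0 else metric_inv_sqrt q j)"
  define b where "b = (\<lambda>j. metric_sqrt (p x) (f j))"
  have f\<nu>: "f (\<nu> x) = (1 / N) *\<^sub>R n0" and fE: "\<And>e. e \<in> E \<Longrightarrow> f e = metric_inv_sqrt q e"
    unfolding f_def using \<nu>E by auto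
  have fT: "f e \<bullet> \<nu> x = 0" if "e \<in> E" for e unfolding fE[OF that] by (rule mT[OF ET[OF that]])
  have g1: "graph_metric (p x) (f e) (f e') = (if e = e' then 1 else 0)" if "e \<in> E" "e' \<in> E" for e e'
  proof -
    have "graph_metric (p x) (f e) (f e') = graph_metric q (f e) (f e')"
      unfolding graph_metric_def by (simp add: pt fT that)
    then show ?thesis unfolding fE[OF that(1)] fE[OF that(2)] graph_metric_metric_inv_sqrt by (rule trans[OF _ EE[OF that]])
  qed
  have g2: "graph_metric (p x) (f (\<nu> x)) (f e) = 0" if "e \<in> E" for e
    using gn0[of "f e"] fT[OF that] unfolding f\<nu> graph_metric_def by (simp add: inner_commute flip: distrib_left divide_inverse add_divide_distrib)
  have g3: "graph_metric (p x) (f (\<nu> x)) (f (\<nu> x)) = 1"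
  proof -
    have "graph_metric (p x) (f (\<nu> x)) (f (\<nu> x)) = (1 / N)\<^sup>2 * graph_metric (p x) n0 n0"
      unfolding f\<nu> graph_metric_def by (simp add: power2_eq_square algebra_simps)
    also have "graph_metric (p x) n0 n0 = N\<^sup>2" unfolding gn0 \<nu>n0 N(2) ..
    finally show ?thesis using N(1) by (simp add: power_divide)
  qed
  have gsym: "graph_metric (p x) v v' = graph_metric (p x) v' v" for v v'
    unfolding graph_metric_def by (simp add: inner_commute mult.commute)
  have fin: "finite E" and card: "card (insert (\<nu> x) E) = DIM('a)"
    using E(1) \<nu>E dim_T[OF x] DIM_positive[where 'a='a] unfolding onframe_def by auto
  have fr: "onframe UNIV (insert (\<nu> x) E) b"
    unfolding b_def
  proof (rule onframe_metric_sqrt)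
    show "graph_metric (p x) (f i) (f j) = (if i = j then 1 else 0)"
      if "i \<in> insert (\<nu> x) E" "j \<in> insert (\<nu> x) E" for i j
      using that g1 g2 g3 gsym \<nu>E by (metis insertE)
  qed (use fin card in auto)
  have curv: "Curv x (b i) \<bullet> b j = (H x (f i) \<bullet> f j) / w" for i j
    unfolding b_def graph_curv_metric_sqrt w_def ..
  \<comment> \<open>The tangential block of the curvature operator agrees with the operator in the
    boundary phase, so one eigenframe diagonalises both.\<close>
  have LA: "Curv x (b e) \<bullet> b e' = L e \<bullet> e'" if "e \<in> E" "e' \<in> E" for e e'
    unfolding curv fE[OF that(1)] fE[OF that(2)] Lval[OF ET[OF that(1)] ET[OF that(2)]] ..
  have nf: "norm (f e) \<le> 1" if "e \<in> E" for e
  proof -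
    have "norm e = 1" using EE[OF that that] by (simp add: norm_eq_1)
    then show ?thesis using norm_metric_inv_sqrt_le[of q e] fE[OF that] by simp
  qed
  show thesis
  proof (rule that[OF fr \<nu>E])
    have "Curv x (b i) \<bullet> b j = 0" if "i \<in> E" "j \<in> E" "i \<noteq> j" for i j
    proof -
      have "L i \<bullet> j = (L i \<bullet> i) * (i \<bullet> j)" using E(2) that(1) by (metis inner_scaleR_left)
      then show ?thesis unfolding LA[OF that(1,2)] using EE[OF that(1,2)] that(3) by simp
    qed
    then show "pairwise (\<lambda>i j. Curv x (b i) \<bullet> b j = 0) E" unfolding pairwise_def by blast
    have "arctan_sum (T x) L = (\<Sum>e\<in>E. arctan (L e \<bullet> e))"
      using arctan_sum_eigenframe[OF Llin subspace_T E(1), of "\<lambda>e. L e \<bullet> e"] E(2) by blast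
    then show "bdry_phase \<Omega> u x (s x) = pi / 2 + (\<Sum>j\<in>E. arctan (Curv x (b j) \<bullet> b j))"
      unfolding bdry_phase_def R Let_def L_def[symmetric] by (simp add: LA)
    fix e assume e: "e \<in> E"
    have PH: "norm (P x (H x (f e))) \<le> Kt"
    proof -
      have "norm (P x (H x (f e))) \<le> Kt * norm (f e)" by (rule Kt[OF fT[OF e]])
      also have "\<dots> \<le> Kt" using nf[OF e] nn by (simp add: mult_left_le)
      finally show ?thesis .
    qed
    have Zf: "\<bar>H x (f e) \<bullet> \<nu> x\<bar> \<le> Z"
    proof -
      have "\<bar>H x (f e) \<bullet> \<nu> x\<bar> \<le> Z * norm (f e)" by (rule Z[OF fT[OF e]])
      also have "\<dots> \<le> Z" using nf[OF e] nn by (simp add: mult_left_le)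
      finally show ?thesis .
    qed
    show "Curv x (b e) \<bullet> b e \<le> Kt"
    proof -
      have "H x (f e) \<bullet> f e = P x (H x (f e)) \<bullet> f e" by (simp add: P_sym P_id[OF fT[OF e]])
      also have "\<dots> \<le> norm (P x (H x (f e))) * norm (f e)" by (rule norm_cauchy_schwarz)
      also have "\<dots> \<le> Kt * 1" using PH nf[OF e] nn by (intro mult_mono) auto
      finally have "(H x (f e) \<bullet> f e) / w \<le> Kt / w" using w by (simp add: divide_right_mono)
      also have "\<dots> \<le> Kt / 1" using w nn by (intro divide_left_mono) auto
      finally show ?thesis unfolding curv by simp
    qed
    show "\<bar>Curv x (b e) \<bullet> b (\<nu> x)\<bar> \<le> Kt + 2 * Z"
    proof -
      define h where "h = H x (f e)"
      have hq: "\<bar>h \<bullet> q\<bar> \<le> Kt * norm q"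
      proof -
        have "h \<bullet> q = P x h \<bullet> q" unfolding q_def by (simp add: P_sym P_id[OF P_tangent[OF x]])
        then have "\<bar>h \<bullet> q\<bar> \<le> norm (P x h) * norm q" using Cauchy_Schwarz_ineq2 by simp
        also have "\<dots> \<le> Kt * norm q" using PH unfolding h_def by (intro mult_right_mono) auto
        finally show ?thesis .
      qed
      have "(norm q)\<^sup>2 \<le> w\<^sup>2" "\<sigma>\<^sup>2 \<le> w\<^sup>2" using w2 inner_ge_zero[of q] by (auto simp: power2_norm_eq_inner)
      then have nq: "norm q \<le> w" "\<bar>\<sigma>\<bar> \<le> w" using w by (auto simp: power2_le_iff_abs_le)
      \<comment> \<open>Splitting p into q and \<sigma> \<nu> gives one factor w. The other factor
        |\<sigma>| \<le> w in n0 then cancels w^2, so the mixed bound Kt + 2 Z does not involve the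
        slope.\<close>
      have hp: "\<bar>h \<bullet> p x\<bar> \<le> (Kt + Z) * w"
      proof -
        have "h \<bullet> p x = h \<bullet> q + \<sigma> * (h \<bullet> \<nu> x)" unfolding pdec by (simp add: inner_add_right)
        then have "\<bar>h \<bullet> p x\<bar> \<le> \<bar>h \<bullet> q\<bar> + \<bar>\<sigma>\<bar> * \<bar>h \<bullet> \<nu> x\<bar>" using abs_triangle_ineq[of "h \<bullet> q" "\<sigma> * (h \<bullet> \<nu> x)"] by (simp add: abs_mult)
        also have "\<dots> \<le> Kt * w + w * Z"
          using hq mult_left_mono[OF nq(1) nn(1)] mult_mono[OF nq(2) Zf] w unfolding h_def by simp
        finally show ?thesis by (simp add: algebra_simps)
      qed
      have "\<bar>\<sigma> / w\<^sup>2 * (h \<bullet> p x)\<bar> \<le> Kt + Z"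
      proof -
        have "\<bar>\<sigma> / w\<^sup>2 * (h \<bullet> p x)\<bar> = \<bar>\<sigma>\<bar> * \<bar>h \<bullet> p x\<bar> / w\<^sup>2" by (simp add: abs_mult)
        also have "\<dots> \<le> w * ((Kt + Z) * w) / w\<^sup>2" using hp nq(2) w by (intro divide_right_mono mult_mono) auto
        also have "\<dots> = Kt + Z" using w by (simp add: power2_eq_square)
        finally show ?thesis .
      qed
      moreover have "\<bar>h \<bullet> \<nu> x\<bar> \<le> Z" using Zf unfolding h_def .
      moreover have "h \<bullet> n0 = h \<bullet> \<nu> x - \<sigma> / w\<^sup>2 * (h \<bullet> p x)" unfolding n0_def by (simp add: inner_diff_right)
      ultimately have "\<bar>h \<bullet> n0\<bar> \<le> Z + (Kt + Z)"
        using abs_triangle_ineq4[of "h \<bullet> \<nu> x" "\<sigma> / w\<^sup>2 * (h \<bullet> p x)"] by linarith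
      then have "1 / (w * N) * \<bar>h \<bullet> n0\<bar> \<le> 1 * (Z + (Kt + Z))" using wN w N nn by (intro mult_mono) auto
      moreover have "\<bar>Curv x (b e) \<bullet> b (\<nu> x)\<bar> = 1 / (w * N) * \<bar>h \<bullet> n0\<bar>"
        unfolding curv f\<nu> h_def[symmetric] using w N by (simp add: abs_mult mult.commute)
      ultimately show ?thesis by simp
    qed
  qed
qed

end

section \<open>The estimates\<close>

context convex_fun
begin

lemma onorm_H: "x \<in> closure \<Omega> \<Longrightarrow> norm (H x v) \<le> onorm (H x) * norm v"
  by (intro onorm) (simp add: linear_H linear_linear)

lemma onorm_curv_le_onorm_hess: assumes x: "x \<in> closure \<Omega>" shows "onorm (Curv x) \<le> onorm (H x)"
proof (rule onorm_le)
  fix v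
  define y where "y = H x (metric_inv_sqrt (p x) v)"
  have "norm (Curv x v) = norm (metric_inv_sqrt (p x) y) / slope (p x)"
    unfolding graph_curv_def y_def using slope_pos[of "p x"] by simp
  also have "\<dots> \<le> norm y / 1"
    using slope_ge_1[of "p x"] norm_metric_inv_sqrt_le[of "p x" y] by (intro frac_le) auto
  also have "norm y \<le> onorm (H x) * norm (metric_inv_sqrt (p x) v)" unfolding y_def by (rule onorm_H[OF x])
  also have "\<dots> \<le> onorm (H x) * norm v"
    by (intro mult_left_mono norm_metric_inv_sqrt_le onorm_pos_le) (simp add: linear_H linear_linear x)
  finally show "norm (Curv x v) \<le> onorm (H x) * norm v" by simp
qed

lemma bdd_hess: "bdd_above ((\<lambda>x. onorm (H x)) ` closure \<Omega>)"
proof -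
  obtain B where "\<And>x v. x \<in> closure \<Omega> \<Longrightarrow> norm (H x v) \<le> B * norm v" using hess_bounded by blast
  then show ?thesis by (intro bdd_aboveI2[where M = B] onorm_le)
qed

lemma bdd_curv: "bdd_above ((\<lambda>x. onorm (Curv x)) ` closure \<Omega>)"
proof -
  obtain M where "\<And>x. x \<in> closure \<Omega> \<Longrightarrow> onorm (H x) \<le> M" using bdd_hess unfolding bdd_above_def by auto
  then show ?thesis using onorm_curv_le_onorm_hess by (intro bdd_aboveI2[where M = M]) (meson order_trans)
qed

lemma sup_curv_eq: "sup_curv \<Omega> u = (SUP x\<in>closure \<Omega>. onorm (Curv x))"
  unfolding sup_curv_def curv_op_eq ..

lemma closure_nonempty: "closure \<Omega> \<noteq> {}"
  using frontier_nonempty frontier_closure by (metis ex_in_conv)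

lemma sup_curv_le_sup_hess: "sup_curv \<Omega> u \<le> sup_hess \<Omega> u"
  unfolding sup_curv_eq sup_hess_def
  by (intro cSUP_mono closure_nonempty bdd_hess) (use onorm_curv_le_onorm_hess in blast)

text \<open>The maximum is taken jointly over points and unit directions, a compact set; homogeneity
  extends the inequality to all vectors.\<close>

lemma quadratic_ratio_attains_max:
  obtains x0 \<xi>0 a where "x0 \<in> closure \<Omega>" "norm \<xi>0 = 1" "H x0 \<xi>0 \<bullet> \<xi>0 = a * graph_metric (p x0) \<xi>0 \<xi>0" "a \<ge> 0"
    "\<And>x \<xi>. x \<in> closure \<Omega> \<Longrightarrow> H x \<xi> \<bullet> \<xi> \<le> a * graph_metric (p x) \<xi> \<xi>"
proof -
  let ?K = "closure \<Omega> \<times> sphere (0 :: 'a) 1"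
  define f where "f = (\<lambda>z. (H (fst z) (snd z) \<bullet> snd z) / graph_metric (p (fst z)) (snd z) (snd z))"
  have gpos: "graph_metric q \<xi> \<xi> > 0" if "\<xi> \<noteq> 0" for q \<xi> :: 'a
  proof -
    have "\<xi> \<bullet> \<xi> > 0" using that by simp
    then show ?thesis using graph_metric_ge[of \<xi> q] by linarith
  qed
  have "continuous_on ?K f"
  proof -
    have cp: "continuous_on ?K (\<lambda>z. p (fst z))"
      by (rule continuous_on_compose2[OF continuous_grad continuous_on_fst[OF continuous_on_id]]) auto
    have ch: "continuous_on ?K (\<lambda>z. H (fst z) b)" for b
      by (rule continuous_on_compose2[OF continuous_hess continuous_on_fst[OF continuous_on_id]]) auto
    have cs: "continuous_on ?K snd" by (rule continuous_on_snd[OF continuous_on_id])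
    have "continuous_on ?K (\<lambda>z. \<Sum>c\<in>Basis. (snd z \<bullet> c) *\<^sub>R H (fst z) c)"
      by (intro continuous_intros ch cs)
    then have cH: "continuous_on ?K (\<lambda>z. H (fst z) (snd z))"
      by (rule continuous_on_eq) (auto intro: linear_expand_basis[OF linear_H, symmetric])
    have "graph_metric (p (fst z)) (snd z) (snd z) \<noteq> 0" if "z \<in> ?K" for z
      using gpos[of "snd z" "p (fst z)"] that by force
    then show ?thesis unfolding f_def graph_metric_def
      by (intro continuous_on_divide continuous_on_inner continuous_on_add continuous_on_mult cH cs cp)
        (auto simp: graph_metric_def)
  qed
  moreover have "compact ?K" by (intro compact_Times compact_closure_dom compact_sphere)
  moreover have "?K \<noteq> {}" using closure_nonempty by simp
  ultimately obtain z where z: "z \<in> ?K" "\<And>z'. z' \<in> ?K \<Longrightarrow> f z' \<le> f z"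
    using continuous_attains_sup[of ?K f] by blast
  define x0 \<xi>0 a where "x0 = fst z" and "\<xi>0 = snd z" and "a = f z"
  have x0: "x0 \<in> closure \<Omega>" and \<xi>0: "norm \<xi>0 = 1" using z(1) unfolding x0_def \<xi>0_def by auto
  then have "\<xi>0 \<noteq> 0" by auto
  note g0 = gpos[OF this, of "p x0"]
  have a: "a = (H x0 \<xi>0 \<bullet> \<xi>0) / graph_metric (p x0) \<xi>0 \<xi>0" unfolding a_def f_def x0_def \<xi>0_def ..
  show thesis
  proof (rule that[OF x0 \<xi>0])
    show "H x0 \<xi>0 \<bullet> \<xi>0 = a * graph_metric (p x0) \<xi>0 \<xi>0" unfolding a using g0 by simp
    show "a \<ge> 0" unfolding a using g0 hess_nonneg[OF x0] by simp
    fix x \<xi> assume x: "x \<in> closure \<Omega>"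
    show "H x \<xi> \<bullet> \<xi> \<le> a * graph_metric (p x) \<xi> \<xi>"
    proof (cases "\<xi> = 0")
      case True
      then show ?thesis by (simp add: graph_metric_def linear_0[OF linear_H[OF x]])
    next
      case False
      define c where "c = inverse (norm \<xi>)"
      have c: "c > 0" unfolding c_def using False by simp
      have "(x, c *\<^sub>R \<xi>) \<in> ?K" using x False unfolding c_def by simp
      from z(2)[OF this] have "(H x (c *\<^sub>R \<xi>) \<bullet> (c *\<^sub>R \<xi>)) / graph_metric (p x) (c *\<^sub>R \<xi>) (c *\<^sub>R \<xi>) \<le> a"
        unfolding a_def[symmetric] by (simp add: f_def)
      moreover have "graph_metric (p x) (c *\<^sub>R \<xi>) (c *\<^sub>R \<xi>) = c\<^sup>2 * graph_metric (p x) \<xi> \<xi>"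
        unfolding graph_metric_def by (simp add: power2_eq_square algebra_simps)
      moreover have "H x (c *\<^sub>R \<xi>) \<bullet> (c *\<^sub>R \<xi>) = c\<^sup>2 * (H x \<xi> \<bullet> \<xi>)"
        by (simp add: linear_scale[OF linear_H[OF x]] power2_eq_square)
      ultimately have "(H x \<xi> \<bullet> \<xi>) / graph_metric (p x) \<xi> \<xi> \<le> a" using c by simp
      then show ?thesis using gpos[OF False, of "p x"] by (simp add: divide_le_eq)
    qed
  qed
qed

text \<open>Kt bounds the tangential block: the intrinsic Hessian contributes K, the shape operator
  times the normal derivative contributes G B. C1 is the constant of the completed square for mixed
  entries up to Kt + 2 Z. Neither involves \<theta>.\<close>

lemma solution_estimates:
  fixes G K Z B \<theta> :: real
  assumes dim: "DIM('a) \<ge> 2" and eq: "\<And>x. x \<in> \<Omega> \<Longrightarrow> arctan_sum UNIV (curv_op \<Omega> u x) = \<theta>" and \<theta>: "\<theta> > 0"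
    and ctrl: "controlled \<Omega> G K Z u" and nn: "G \<ge> 0" "K \<ge> 0" "Z \<ge> 0" "B \<ge> 0"
    and B: "\<And>x \<xi>. x \<in> frontier \<Omega> \<Longrightarrow> norm (shape_op \<Omega> x \<xi>) \<le> B * norm \<xi>"
  defines "d \<equiv> boundary_gap \<Omega> \<theta> u" and "Kt \<equiv> K + G * B"
  defines "C1 \<equiv> 2 + 2 * (real DIM('a))\<^sup>2 * (Kt + 2 * Z)\<^sup>2"
  shows "0 < d" "d \<le> pi / 2" "cot d \<le> sup_curv \<Omega> u"
    "sup_hess \<Omega> u + sup_curv \<Omega> u \<le> ((1 + G)\<^sup>2 + 1) * (2 * (1 + G) * (Kt + C1)) * (1 + cot d)"
proof -
  have Kt: "Kt \<ge> 0" and C1: "C1 \<ge> 0" unfolding Kt_def C1_def using nn by auto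
  have eqc: "arctan_sum UNIV (Curv x) = \<theta>" if "x \<in> closure \<Omega>" for x
    using continuous_constant_on_closure[OF continuous_arctan_sum _ that] eq unfolding curv_op_eq by blast
  have grad: "norm (p x) \<le> G" if "x \<in> closure \<Omega>" for x
    using C1_norm_bound[OF _ that] ctrl unfolding controlled_def by blast
  have slope: "slope (p x) \<le> 1 + G" if "x \<in> closure \<Omega>" for x
    using slope_le[of "p x"] grad[OF that] by linarith
  define \<delta> where "\<delta> = (\<lambda>x. bdry_phase \<Omega> u x (s x) - \<theta>)"
  \<comment> \<open>m is the last diagonal entry of the curvature operator at x in the boundary
    frame. It ties the local gap to the local curvature from both sides.\<close>
  have bdry: "\<exists>m\<ge>0. \<delta> x \<le> pi / 2 \<and> pi / 2 - arctan m \<le> \<delta> x \<and> (m > 0 \<longrightarrow> \<delta> x \<le> C1 / m) \<and>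
      (\<forall>v. Curv x v \<bullet> v \<le> 2 * (Kt + m) * (v \<bullet> v)) \<and> m \<le> sup_curv \<Omega> u"
    if x: "x \<in> frontier \<Omega>" for x
  proof -
    note xc = frontier_closure[OF x]
    interpret A: psd_operator "Curv x" by (rule psd_Curv[OF xc])
    have tang: "norm (P x (H x v)) \<le> Kt * norm v" if v: "v \<bullet> \<nu> x = 0" for v
    proof -
      have "P x (H x v) = boundary_hess \<Omega> u x v - s x *\<^sub>R shape_op \<Omega> x v"
        unfolding boundary_hess_eq[OF x] P_id[OF v] by simp
      then have "norm (P x (H x v)) \<le> norm (boundary_hess \<Omega> u x v) + \<bar>s x\<bar> * norm (shape_op \<Omega> x v)"
        using norm_triangle_ineq4[of "boundary_hess \<Omega> u x v" "s x *\<^sub>R shape_op \<Omega> x v"] by simp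
      also have "norm (boundary_hess \<Omega> u x v) \<le> K * norm v"
        using boundary_C2_norm_bound[OF _ x] ctrl unfolding controlled_def by blast
      also have "\<bar>s x\<bar> * norm (shape_op \<Omega> x v) \<le> G * (B * norm v)"
      proof (rule mult_mono)
        have "\<bar>s x\<bar> \<le> norm (p x)" using Cauchy_Schwarz_ineq2[of "p x" "\<nu> x"] norm_normal[OF x] by simp
        then show "\<bar>s x\<bar> \<le> G" using grad[OF xc] by linarith
      qed (use B[OF x] nn in auto)
      finally show ?thesis unfolding Kt_def by (simp add: algebra_simps)
    qed
    have mixed: "\<bar>H x v \<bullet> \<nu> x\<bar> \<le> Z * norm v" if v: "v \<bullet> \<nu> x = 0" for v
      by (rule mixed_bound[OF dim _ x v]) (use ctrl in \<open>simp add: controlled_def\<close>)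
    obtain J b where fr: "onframe UNIV (insert (\<nu> x) J) b" and z: "\<nu> x \<notin> J"
      and diag: "pairwise (\<lambda>i j. Curv x (b i) \<bullet> b j = 0) J"
      and ph: "bdry_phase \<Omega> u x (s x) = pi / 2 + (\<Sum>j\<in>J. arctan (Curv x (b j) \<bullet> b j))"
      and bd: "\<And>j. j \<in> J \<Longrightarrow> Curv x (b j) \<bullet> b j \<le> Kt"
        "\<And>j. j \<in> J \<Longrightarrow> \<bar>Curv x (b j) \<bullet> b (\<nu> x)\<bar> \<le> Kt + 2 * Z"
    proof (rule boundary_frame[OF x _ _ Kt nn(3)])
      show "norm (P x (H x v)) \<le> Kt * norm v" if v: "v \<bullet> \<nu> x = 0" for v by (rule tang[OF v])
      show "\<bar>H x v \<bullet> \<nu> x\<bar> \<le> Z * norm v" if v: "v \<bullet> \<nu> x = 0" for v by (rule mixed[OF v])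
    qed (rule that)
    define m where "m = Curv x (b (\<nu> x)) \<bullet> b (\<nu> x)"
    have fin: "finite J" and on: "\<And>i j. i \<in> insert (\<nu> x) J \<Longrightarrow> j \<in> insert (\<nu> x) J \<Longrightarrow> b i \<bullet> b j = (if i = j then 1 else 0)"
      using fr unfolding onframe_def by auto
    \<comment> \<open>The tangential arctangents alone do not exceed \<theta>, so the gap is at most
      pi / 2, the range where cot is nonnegative.\<close>
    have "(\<Sum>j\<in>J. arctan (Curv x (b j) \<bullet> b j)) \<le> arctan_sum UNIV (Curv x)"
      by (rule A.arctan_sum_ge_compression[OF fin _ diag]) (use on in auto)
    then have 1: "\<delta> x \<le> pi / 2" unfolding \<delta>_def ph eqc[OF xc] by simp
    have "arctan_sum UNIV (Curv x) \<le> arctan m + (\<Sum>j\<in>J. arctan (Curv x (b j) \<bullet> b j))"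
      using A.arctan_sum_le_frame[OF fr] fin z unfolding m_def by simp
    then have 2: "pi / 2 - arctan m \<le> \<delta> x" unfolding \<delta>_def ph eqc[OF xc] by simp
    have 3: "\<delta> x \<le> C1 / m" if "m > 0"
      using A.bordered_arctan_sum_ge[OF fr z diag bd(2)] that
      unfolding \<delta>_def ph eqc[OF xc] m_def C1_def by simp
    have 4: "Curv x v \<bullet> v \<le> 2 * (Kt + m) * (v \<bullet> v)" for v
      unfolding m_def by (rule A.bordered_quadratic_le[OF fr z diag Kt bd(1)])
    have bn: "norm (b (\<nu> x)) = 1" using on[of "\<nu> x" "\<nu> x"] by (simp add: norm_eq_1)
    have "m \<le> norm (Curv x (b (\<nu> x))) * norm (b (\<nu> x))" unfolding m_def by (rule norm_cauchy_schwarz)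
    also have "\<dots> \<le> onorm (Curv x)" using onorm[of "Curv x" "b (\<nu> x)"] A.lin bn by (simp add: linear_linear)
    also have "\<dots> \<le> sup_curv \<Omega> u" unfolding sup_curv_eq by (rule cSUP_upper[OF xc bdd_curv])
    finally have 5: "m \<le> sup_curv \<Omega> u" .
    have "m \<ge> 0" unfolding m_def by (rule A.psd)
    then show ?thesis using 1 2 3 4 5 by blast
  qed
  define l where "l = sup_curv \<Omega> u"
  \<comment> \<open>Replacing m by the finite supremum l makes the lower bound uniform over the
    boundary, so the infimum of the gaps is positive as well.\<close>
  have \<delta>lo: "pi / 2 - arctan l \<le> \<delta> x" if x: "x \<in> frontier \<Omega>" for x
  proof -
    obtain m where "pi / 2 - arctan m \<le> \<delta> x" "m \<le> l" using bdry[OF x] unfolding l_def by blast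
    moreover have "arctan m \<le> arctan l" using \<open>m \<le> l\<close> by (simp add: arctan_le_iff)
    ultimately show ?thesis by linarith
  qed
  have d: "d = (INF x\<in>frontier \<Omega>. \<delta> x)" unfolding d_def boundary_gap_def \<delta>_def ..
  have bddb: "bdd_below (\<delta> ` frontier \<Omega>)" by (rule bdd_belowI2[OF \<delta>lo])
  have dlo: "pi / 2 - arctan l \<le> d" unfolding d by (rule cINF_greatest[OF frontier_nonempty \<delta>lo])
  then show dpos: "0 < d" using arctan_ubound[of l] by linarith
  have d\<delta>: "d \<le> \<delta> x" if "x \<in> frontier \<Omega>" for x unfolding d by (rule cINF_lower[OF bddb that])
  obtain x1 where "x1 \<in> frontier \<Omega>" using frontier_nonempty by blast
  then show dhi: "d \<le> pi / 2" using d\<delta>[of x1] bdry[of x1] by force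
  have "tan (pi / 2 - d) \<le> tan (arctan l)"
    by (rule tan_mono_le) (use dlo dhi arctan_ubound[of l] pi_gt_zero in linarith)+
  then show "cot d \<le> sup_curv \<Omega> u" unfolding cot_eq_tan l_def by (simp add: tan_arctan)
  obtain x0 \<xi>0 a where x0: "x0 \<in> closure \<Omega>" and \<xi>0: "norm \<xi>0 = 1"
    and att: "H x0 \<xi>0 \<bullet> \<xi>0 = a * graph_metric (p x0) \<xi>0 \<xi>0" and a: "a \<ge> 0"
    and max: "\<And>x \<xi>. x \<in> closure \<Omega> \<Longrightarrow> H x \<xi> \<bullet> \<xi> \<le> a * graph_metric (p x) \<xi> \<xi>"
    using quadratic_ratio_attains_max by blast
  have "x0 \<notin> \<Omega>"
  proof
    assume "x0 \<in> \<Omega>"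
    interpret SG: smooth_graph "closure \<Omega>" \<Omega> u
      by (rule smooth_graph.intro) (use ud smooth_u openD closure_subset hess_nonneg in auto)
    show False
    proof (rule SG.no_interior_max[OF _ \<theta> _ \<open>x0 \<in> \<Omega>\<close> _ att])
      show "\<xi>0 \<noteq> 0" using \<xi>0 by auto
      show "arctan_sum UNIV (Curv x) = \<theta>" if x: "x \<in> \<Omega>" for x
        by (rule eqc[OF subsetD[OF closure_subset x]])
      show "H x \<xi> \<bullet> \<xi> \<le> a * graph_metric (p x) \<xi> \<xi>" if x: "x \<in> \<Omega>" for x \<xi>
        by (rule max[OF subsetD[OF closure_subset x]])
    qed
  qed
  then have x0f: "x0 \<in> frontier \<Omega>" using x0 openD by (simp add: frontier_def interior_open)
  obtain m where m: "m \<ge> 0" "m > 0 \<longrightarrow> \<delta> x0 \<le> C1 / m" "\<forall>v. Curv x0 v \<bullet> v \<le> 2 * (Kt + m) * (v \<bullet> v)"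
    using bdry[OF x0f] by blast
  note cot = one_le_cot[OF dpos dhi]
  \<comment> \<open>The maximum point x0 need not realise the minimal gap; d \<le> \<delta> x0
    suffices. The case m = 0 is separate because the bound C1 / m requires m > 0.\<close>
  have "m \<le> C1 / d"
  proof (cases "m = 0")
    case True
    then show ?thesis using C1 dpos by simp
  next
    case False
    then have "d \<le> C1 / m" using m d\<delta>[OF x0f] by auto
    then show ?thesis using False m(1) dpos by (simp add: field_simps)
  qed
  also have "\<dots> \<le> C1 * (1 + cot d)" using mult_left_mono[OF cot(1) C1] by simp
  finally have m_le: "m \<le> C1 * (1 + cot d)" .
  \<comment> \<open>At x0 the quantity a is w times a curvature, which costs the factor 1 + G; the
    term Kt is absorbed using 1 + cot d \<ge> 1.\<close>
  have a_le: "a \<le> 2 * (1 + G) * (Kt + C1) * (1 + cot d)"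
  proof -
    define g where "g = graph_metric (p x0) \<xi>0 \<xi>0"
    have g: "g > 0" using graph_metric_ge[of \<xi>0 "p x0"] \<xi>0 unfolding g_def by (simp add: norm_eq_1)
    have "a * g / slope (p x0) \<le> 2 * (Kt + m) * g"
      using m(3)[rule_format, of "metric_sqrt (p x0) \<xi>0"]
      unfolding graph_curv_metric_sqrt inner_metric_sqrt_metric_sqrt att g_def .
    then have "(a / slope (p x0)) * g \<le> 2 * (Kt + m) * g" by simp
    then have "a / slope (p x0) \<le> 2 * (Kt + m)" using g by (rule mult_right_le_imp_le)
    then have "a \<le> 2 * (Kt + m) * slope (p x0)" using slope_pos[of "p x0"] by (simp add: divide_le_eq)
    also have "\<dots> \<le> 2 * (Kt + m) * (1 + G)" using slope[OF x0] Kt m(1) by (intro mult_left_mono) auto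
    also have "\<dots> \<le> 2 * ((Kt + C1) * (1 + cot d)) * (1 + G)"
    proof -
      have "Kt + m \<le> Kt * (1 + cot d) + C1 * (1 + cot d)"
        using m_le mult_nonneg_nonneg[OF Kt cot(2)] by (simp add: algebra_simps)
      then show ?thesis using nn(1) by (intro mult_right_mono) (auto simp: algebra_simps)
    qed
    finally show ?thesis by (simp add: algebra_simps)
  qed
  \<comment> \<open>The graph metric is at most w^2 times the Euclidean one, which gives (1 + G)^2
    for the Hessian; for the curvature w \<ge> 1 gives the factor 1. Their sum is the leading
    constant.\<close>
  have "sup_hess \<Omega> u \<le> a * (1 + G)\<^sup>2"
    unfolding sup_hess_def
  proof (intro cSUP_least closure_nonempty onorm_le)
    fix x v assume x: "x \<in> closure \<Omega>"
    interpret Hx: psd_operator "H x" by (rule psd_H[OF x])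
    show "norm (H x v) \<le> a * (1 + G)\<^sup>2 * norm v"
    proof (rule Hx.norm_le_of_quadratic_le)
      fix v
      have "H x v \<bullet> v \<le> a * graph_metric (p x) v v" by (rule max[OF x])
      also have "\<dots> \<le> a * ((1 + G)\<^sup>2 * (v \<bullet> v))"
      proof (rule mult_left_mono[OF _ a])
        have "(slope (p x))\<^sup>2 \<le> (1 + G)\<^sup>2" using slope[OF x] slope_pos[of "p x"] by (intro power_mono) auto
        then have "(slope (p x))\<^sup>2 * (v \<bullet> v) \<le> (1 + G)\<^sup>2 * (v \<bullet> v)" by (rule mult_right_mono) simp
        then show "graph_metric (p x) v v \<le> (1 + G)\<^sup>2 * (v \<bullet> v)" using graph_metric_le[of "p x" v] by linarith
      qed
      finally show "H x v \<bullet> v \<le> a * (1 + G)\<^sup>2 * (v \<bullet> v)" by (simp add: mult.assoc)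
    qed
  qed
  moreover have "sup_curv \<Omega> u \<le> a"
    unfolding sup_curv_eq
  proof (intro cSUP_least closure_nonempty onorm_le)
    fix x v assume x: "x \<in> closure \<Omega>"
    interpret A: psd_operator "Curv x" by (rule psd_Curv[OF x])
    show "norm (Curv x v) \<le> a * norm v"
    proof (rule A.norm_le_of_quadratic_le)
      fix v
      define y where "y = metric_inv_sqrt (p x) v"
      have "Curv x v \<bullet> v = (H x y \<bullet> y) / slope (p x)"
        using graph_curv_metric_sqrt[of "p x" "H x" y y] unfolding y_def metric_sqrt_inverse .
      also have "\<dots> \<le> (a * graph_metric (p x) y y) / 1"
        using max[OF x, of y] hess_nonneg[OF x, of y] slope_ge_1[of "p x"] by (intro frac_le) auto
      finally show "Curv x v \<bullet> v \<le> a * (v \<bullet> v)" unfolding y_def graph_metric_metric_inv_sqrt by simp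
    qed
  qed
  ultimately have "sup_hess \<Omega> u + sup_curv \<Omega> u \<le> ((1 + G)\<^sup>2 + 1) * a" by (simp add: algebra_simps)
  also have "\<dots> \<le> ((1 + G)\<^sup>2 + 1) * (2 * (1 + G) * (Kt + C1) * (1 + cot d))"
    using a_le by (intro mult_left_mono) auto
  finally show "sup_hess \<Omega> u + sup_curv \<Omega> u \<le> ((1 + G)\<^sup>2 + 1) * (2 * (1 + G) * (Kt + C1)) * (1 + cot d)"
    by (simp add: mult.assoc)
qed

end

theorem theorem1p7:
  fixes \<Omega> :: "(real ^ 'n) set" and P K Z :: real
  assumes "CARD('n) \<ge> 2"
    and "bounded_smooth_domain \<Omega>"
    and "P \<ge> 0" and "K \<ge> 0" and "Z \<ge> 0"
  shows "(\<exists>C::real. \<forall>\<theta> u. 0 < \<theta> \<and> \<theta> < real CARD('n) * pi / 2 \<and>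
             convex_solution \<Omega> \<theta> u \<and> controlled \<Omega> P K Z u \<longrightarrow>
               sup_hess \<Omega> u + sup_curv \<Omega> u \<le> C * (1 + cot (boundary_gap \<Omega> \<theta> u)) \<and>
               sup_hess \<Omega> u \<ge> cot (boundary_gap \<Omega> \<theta> u) - C) \<and>
         (\<forall>\<theta> (u :: nat \<Rightarrow> real ^ 'n \<Rightarrow> real). 0 < \<theta> \<and> \<theta> < real CARD('n) * pi / 2 \<and>
             (\<forall>j. convex_solution \<Omega> \<theta> (u j) \<and> controlled \<Omega> P K Z (u j)) \<longrightarrow>
               (filterlim (\<lambda>j. sup_hess \<Omega> (u j)) at_top sequentially \<longleftrightarrow>
                  (\<lambda>j. boundary_gap \<Omega> \<theta> (u j)) \<longlonglongrightarrow> 0) \<and>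
               (filterlim (\<lambda>j. sup_curv \<Omega> (u j)) at_top sequentially \<longleftrightarrow>
                  (\<lambda>j. boundary_gap \<Omega> \<theta> (u j)) \<longlonglongrightarrow> 0))"
proof -
  interpret smooth_domain \<Omega> by (rule smooth_domain.intro[OF assms(2)])
  obtain B0 where B0: "\<And>x \<xi>. x \<in> frontier \<Omega> \<Longrightarrow> norm (shape_op \<Omega> x \<xi>) \<le> B0 * norm \<xi>"
    using shape_op_bounded by blast
  define B where "B = \<bar>B0\<bar>"
  have B: "norm (shape_op \<Omega> x \<xi>) \<le> B * norm \<xi>" if "x \<in> frontier \<Omega>" for x \<xi>
    using B0[OF that, of \<xi>] unfolding B_def by (meson abs_ge_self mult_right_mono norm_ge_zero order_trans)
  define C where "C = ((1 + P)\<^sup>2 + 1) * (2 * (1 + P) *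
      (K + P * B + (2 + 2 * (real DIM(real ^ 'n))\<^sup>2 * (K + P * B + 2 * Z)\<^sup>2)))"
  have C: "C \<ge> 0" unfolding C_def B_def using assms by (intro mult_nonneg_nonneg add_nonneg_nonneg) auto
  have est: "0 < boundary_gap \<Omega> \<theta> u \<and> boundary_gap \<Omega> \<theta> u \<le> pi / 2 \<and>
      cot (boundary_gap \<Omega> \<theta> u) \<le> sup_curv \<Omega> u \<and> sup_curv \<Omega> u \<le> sup_hess \<Omega> u \<and>
      sup_hess \<Omega> u + sup_curv \<Omega> u \<le> C * (1 + cot (boundary_gap \<Omega> \<theta> u))"
    if \<theta>: "0 < \<theta>" and sol: "convex_solution \<Omega> \<theta> u" and ctrl: "controlled \<Omega> P K Z u" for \<theta> and u :: "real ^ 'n \<Rightarrow> real"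
  proof -
    interpret convex_fun \<Omega> u
      using sol unfolding convex_solution_def by unfold_locales auto
    have eq: "\<And>x. x \<in> \<Omega> \<Longrightarrow> arctan_sum UNIV (curv_op \<Omega> u x) = \<theta>"
      using sol unfolding convex_solution_def by blast
    have dim: "DIM(real ^ 'n) \<ge> 2" using assms(1) by simp
    have "B \<ge> 0" unfolding B_def by simp
    note e = solution_estimates[OF dim eq \<theta> ctrl assms(3-5) this B]
    show ?thesis using e sup_curv_le_sup_hess unfolding C_def by blast
  qed
  have nonneg: "0 \<le> sup_curv \<Omega> u" "0 \<le> sup_hess \<Omega> u"
    if "0 < \<theta>" "convex_solution \<Omega> \<theta> u" "controlled \<Omega> P K Z u" for \<theta> and u :: "real ^ 'n \<Rightarrow> real"
    using est[OF that] one_le_cot(2)[of "boundary_gap \<Omega> \<theta> u"] by linarith+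
  show ?thesis
  proof (intro conjI exI[of _ C] allI impI)
    fix \<theta> and u :: "real ^ 'n \<Rightarrow> real"
    assume h: "0 < \<theta> \<and> \<theta> < real CARD('n) * pi / 2 \<and> convex_solution \<Omega> \<theta> u \<and> controlled \<Omega> P K Z u"
    then show "sup_hess \<Omega> u + sup_curv \<Omega> u \<le> C * (1 + cot (boundary_gap \<Omega> \<theta> u))" using est by blast
    \<comment> \<open>The lower bound passes through the curvature, whose supremum is at most that
      of the Hessian.\<close>
    have "cot (boundary_gap \<Omega> \<theta> u) \<le> sup_hess \<Omega> u" using est h by (meson order_trans)
    then show "cot (boundary_gap \<Omega> \<theta> u) - C \<le> sup_hess \<Omega> u" using C by linarith
  next
    fix \<theta> and u :: "nat \<Rightarrow> real ^ 'n \<Rightarrow> real"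
    assume h: "0 < \<theta> \<and> \<theta> < real CARD('n) * pi / 2 \<and>
             (\<forall>j. convex_solution \<Omega> \<theta> (u j) \<and> controlled \<Omega> P K Z (u j))"
    have e: "0 < boundary_gap \<Omega> \<theta> (u j)" "boundary_gap \<Omega> \<theta> (u j) \<le> pi / 2"
      "cot (boundary_gap \<Omega> \<theta> (u j)) \<le> sup_curv \<Omega> (u j)" "cot (boundary_gap \<Omega> \<theta> (u j)) \<le> sup_hess \<Omega> (u j)"
      "sup_hess \<Omega> (u j) \<le> C * (1 + cot (boundary_gap \<Omega> \<theta> (u j)))"
      "sup_curv \<Omega> (u j) \<le> C * (1 + cot (boundary_gap \<Omega> \<theta> (u j)))" for j
      using est[of \<theta> "u j"] nonneg[of \<theta> "u j"] h by auto
    show "filterlim (\<lambda>j. sup_hess \<Omega> (u j)) at_top sequentially \<longleftrightarrow> (\<lambda>j. boundary_gap \<Omega> \<theta> (u j)) \<longlonglongrightarrow> 0"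
      by (rule filterlim_cot_iff[OF e(1,2,4,5) C])
    show "filterlim (\<lambda>j. sup_curv \<Omega> (u j)) at_top sequentially \<longleftrightarrow> (\<lambda>j. boundary_gap \<Omega> \<theta> (u j)) \<longlonglongrightarrow> 0"
      by (rule filterlim_cot_iff[OF e(1,2,3,6) C])
  qed
qed

end
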